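(* Let $G = C_3 \times C_3$, and let $k$ be a field of characteristic $3$. Then the ghost number of $kG$ is $3$.
   Context: $C_n$ denotes the cyclic group of order $n$. Let $G$ be a finite group and $k$ a field whose characteristic divides $|G|$. $\mathrm{StMod}(kG)$ is the stable module category: its objects are left $kG$-modules, and its morphisms are $[M,N] = \mathrm{Hom}_{kG}(M,N)$ modulo the maps that factor through a projective module. It is a triangulated category in which $\Omega M$ (the desuspension) is the kernel of a surjection from a projective onto $M$, with inverse $\Sigma=\Omega^{-1}$. $\mathrm{Thick}\langle k\rangle$ is the smallest full triangulated subcategory of $\mathrm{StMod}(kG)$ that is closed under retracts and contains the trivial module $k$. A map $f$ in $\mathrm{StMod}(kG)$ is a ghost if it induces the zero map on Tate cohomology, i.e. $[\Omega^n k, f]=0$ for all $n\in\mathbb{Z}$. The ghost length of $M\in\mathrm{Thick}\langle k\rangle$ is the smallest integer $n\ge 0$ such that every composite of $n$ ghosts between objects of $\mathrm{Thick}\langle k\rangle$ with domain $M$ is zero in $\mathrm{StMod}(kG)$ (a composite of $0$ ghosts being any map). The ghost number of $kG$ is the least upper bound of the ghost lengths of modules in $\mathrm{Thick}\langle k\rangle$. *)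

theory Defs
  imports "HOL-Algebra.Algebra" "HOL-Library.Extended_Nat" "HOL-Library.Equipollence"
begin

section \<open>Group rings and their left modules\<close>

text \<open>The characteristic is the order of the unit in the additive group; \<^const>\<open>group.ord\<close> is 0 on
  elements of infinite order.\<close>

definition ring_char :: "('k, 'b) ring_scheme \<Rightarrow> nat" where
  "ring_char K = group.ord (add_monoid K) \<one>\<^bsub>K\<^esub>"

text \<open>For a finite group \<open>G\<close>. Elements are coefficient functions on \<open>G\<close>, made extensional outside
  the carrier; multiplication is convolution.\<close>

definition group_ring :: "('g, 'a) monoid_scheme \<Rightarrow> ('k, 'b) ring_scheme \<Rightarrow> ('g \<Rightarrow> 'k) ring" where
  "group_ring G K =
    \<lparr> carrier = carrier G \<rightarrow>\<^sub>E carrier K,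
      monoid.mult = (\<lambda>a b. \<lambda>g\<in>carrier G.
        \<Oplus>\<^bsub>K\<^esub>h\<in>carrier G. a h \<otimes>\<^bsub>K\<^esub> b (inv\<^bsub>G\<^esub> h \<otimes>\<^bsub>G\<^esub> g)),
      one = (\<lambda>g\<in>carrier G. if g = \<one>\<^bsub>G\<^esub> then \<one>\<^bsub>K\<^esub> else \<zero>\<^bsub>K\<^esub>),
      ring.zero = (\<lambda>g\<in>carrier G. \<zero>\<^bsub>K\<^esub>),
      ring.add = (\<lambda>a b. \<lambda>g\<in>carrier G. a g \<oplus>\<^bsub>K\<^esub> b g) \<rparr>"

text \<open>The library locale \<^locale>\<open>module\<close> requires a commutative ring. The record type
  \<^typ>\<open>('r, 'm) module\<close> is reused; its fields \<open>mult\<close> and \<open>one\<close> play no role.\<close>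

locale left_module = R?: ring R + M?: abelian_group M
  for R :: "'r ring" (structure) and M :: "('r, 'm) module" (structure) +
  assumes smult_closed [simp, intro]:
      "\<lbrakk> a \<in> carrier R; x \<in> carrier M \<rbrakk> \<Longrightarrow> a \<odot>\<^bsub>M\<^esub> x \<in> carrier M"
    and smult_l_distr:
      "\<lbrakk> a \<in> carrier R; b \<in> carrier R; x \<in> carrier M \<rbrakk> \<Longrightarrow>
       (a \<oplus> b) \<odot>\<^bsub>M\<^esub> x = a \<odot>\<^bsub>M\<^esub> x \<oplus>\<^bsub>M\<^esub> b \<odot>\<^bsub>M\<^esub> x"
    and smult_r_distr:
      "\<lbrakk> a \<in> carrier R; x \<in> carrier M; y \<in> carrier M \<rbrakk> \<Longrightarrow>
       a \<odot>\<^bsub>M\<^esub> (x \<oplus>\<^bsub>M\<^esub> y) = a \<odot>\<^bsub>M\<^esub> x \<oplus>\<^bsub>M\<^esub> a \<odot>\<^bsub>M\<^esub> y"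
    and smult_assoc1:
      "\<lbrakk> a \<in> carrier R; b \<in> carrier R; x \<in> carrier M \<rbrakk> \<Longrightarrow>
       (a \<otimes> b) \<odot>\<^bsub>M\<^esub> x = a \<odot>\<^bsub>M\<^esub> (b \<odot>\<^bsub>M\<^esub> x)"
    and smult_one [simp]:
      "x \<in> carrier M \<Longrightarrow> \<one> \<odot>\<^bsub>M\<^esub> x = x"

text \<open>A homomorphism is only constrained on the carrier of its source.\<close>

definition lmod_hom :: "'r ring \<Rightarrow> ('r, 'm) module \<Rightarrow> ('r, 'n) module \<Rightarrow> ('m \<Rightarrow> 'n) set" where
  "lmod_hom R M N = {f \<in> carrier M \<rightarrow> carrier N.
     (\<forall>x\<in>carrier M. \<forall>y\<in>carrier M. f (x \<oplus>\<^bsub>M\<^esub> y) = f x \<oplus>\<^bsub>N\<^esub> f y) \<and>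
     (\<forall>a\<in>carrier R. \<forall>x\<in>carrier M. f (a \<odot>\<^bsub>M\<^esub> x) = a \<odot>\<^bsub>N\<^esub> f x)}"

definition lmod_iso :: "'r ring \<Rightarrow> ('r, 'm) module \<Rightarrow> ('r, 'n) module \<Rightarrow> bool" where
  "lmod_iso R M N \<longleftrightarrow> (\<exists>f\<in>lmod_hom R M N. bij_betw f (carrier M) (carrier N))"

text \<open>The module \<open>k\<close>, every group element acting as the identity; an element of \<open>kG\<close> therefore acts
  through the sum of its coefficients.\<close>

definition trivial_module ::
    "('g, 'a) monoid_scheme \<Rightarrow> ('k, 'b) ring_scheme \<Rightarrow> ('g \<Rightarrow> 'k, 'k) module" where
  "trivial_module G K =
    \<lparr> carrier = carrier K, monoid.mult = monoid.mult K, one = \<one>\<^bsub>K\<^esub>,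
      ring.zero = \<zero>\<^bsub>K\<^esub>, ring.add = ring.add K,
      smult = (\<lambda>a x. (\<Oplus>\<^bsub>K\<^esub>g\<in>carrier G. a g) \<otimes>\<^bsub>K\<^esub> x) \<rparr>"

section \<open>The stable module category\<close>

text \<open>From here on, all modules of one category have carriers inside a common type \<open>'m\<close>, which plays
  the role of the universe: if \<open>'m\<close> is infinite and at least as large as the ring \<open>R\<close>, every left
  \<open>R\<close>-module of cardinality at most that of \<open>'m\<close> is represented up to isomorphism. In particular
  the lifting property below may then be tested on modules in \<open>'m\<close> alone.\<close>

definition projective :: "'r ring \<Rightarrow> ('r, 'm) module \<Rightarrow> bool" where
  "projective R P \<longleftrightarrow> left_module R P \<and>
    (\<forall>(M :: ('r, 'm) module) (N :: ('r, 'm) module) p f.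
       left_module R M \<longrightarrow> left_module R N \<longrightarrow>
       p \<in> lmod_hom R M N \<longrightarrow> p ` carrier M = carrier N \<longrightarrow> f \<in> lmod_hom R P N \<longrightarrow>
       (\<exists>h\<in>lmod_hom R P M. \<forall>x\<in>carrier P. p (h x) = f x))"

text \<open>Morphisms of the stable category are represented by module homomorphisms; \<open>stably_zero\<close> and
  \<open>stably_eq\<close> express that the classes in \<open>[M, N]\<close> are zero, respectively equal.\<close>

definition stably_zero ::
    "'r ring \<Rightarrow> ('r, 'm) module \<Rightarrow> ('r, 'm) module \<Rightarrow> ('m \<Rightarrow> 'm) \<Rightarrow> bool" where
  "stably_zero R M N f \<longleftrightarrow>
    (\<exists>(P :: ('r, 'm) module) a b. projective R P \<and> a \<in> lmod_hom R M P \<and> b \<in> lmod_hom R P N \<and>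
       (\<forall>x\<in>carrier M. f x = b (a x)))"

definition stably_eq ::
    "'r ring \<Rightarrow> ('r, 'm) module \<Rightarrow> ('r, 'm) module \<Rightarrow> ('m \<Rightarrow> 'm) \<Rightarrow> ('m \<Rightarrow> 'm) \<Rightarrow> bool" where
  "stably_eq R M N f g \<longleftrightarrow> stably_zero R M N (\<lambda>x. f x \<ominus>\<^bsub>N\<^esub> g x)"

definition stable_iso_map ::
    "'r ring \<Rightarrow> ('r, 'm) module \<Rightarrow> ('r, 'm) module \<Rightarrow> ('m \<Rightarrow> 'm) \<Rightarrow> bool" where
  "stable_iso_map R M N f \<longleftrightarrow> f \<in> lmod_hom R M N \<and>
    (\<exists>g\<in>lmod_hom R N M. stably_eq R M M (g \<circ> f) id \<and> stably_eq R N N (f \<circ> g) id)"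

definition stable_retract :: "'r ring \<Rightarrow> ('r, 'm) module \<Rightarrow> ('r, 'm) module \<Rightarrow> bool" where
  "stable_retract R M N \<longleftrightarrow>
    (\<exists>s\<in>lmod_hom R M N. \<exists>r\<in>lmod_hom R N M. stably_eq R M M (r \<circ> s) id)"

definition short_exact :: "'r ring \<Rightarrow> ('r, 'm) module \<Rightarrow> ('r, 'm) module \<Rightarrow> ('r, 'm) module \<Rightarrow>
    ('m \<Rightarrow> 'm) \<Rightarrow> ('m \<Rightarrow> 'm) \<Rightarrow> bool" where
  "short_exact R A B C f g \<longleftrightarrow>
    left_module R A \<and> left_module R B \<and> left_module R C \<and>
    f \<in> lmod_hom R A B \<and> g \<in> lmod_hom R B C \<and>
    inj_on f (carrier A) \<and> g ` carrier B = carrier C \<and>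
    f ` carrier A = {x \<in> carrier B. g x = \<zero>\<^bsub>C\<^esub>}"

text \<open>\<open>Omega_seq R L P M i p\<close>: the sequence \<open>0 \<rightarrow> L \<rightarrow> P \<rightarrow> M \<rightarrow> 0\<close> exhibits \<open>L\<close> as \<open>\<Omega>M\<close>, equivalently
  \<open>M\<close> as \<open>\<Sigma>L\<close>. Both are determined only up to stable isomorphism, so they are kept as relations
  rather than made into functions by a choice.\<close>

definition Omega_seq :: "'r ring \<Rightarrow> ('r, 'm) module \<Rightarrow> ('r, 'm) module \<Rightarrow> ('r, 'm) module \<Rightarrow>
    ('m \<Rightarrow> 'm) \<Rightarrow> ('m \<Rightarrow> 'm) \<Rightarrow> bool" where
  "Omega_seq R L P M i p \<longleftrightarrow> short_exact R L P M i p \<and> projective R P"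

definition is_Omega :: "'r ring \<Rightarrow> ('r, 'm) module \<Rightarrow> ('r, 'm) module \<Rightarrow> bool" where
  "is_Omega R M L \<longleftrightarrow> (\<exists>P i p. Omega_seq R L P M i p)"

primrec is_Omega_nat :: "'r ring \<Rightarrow> nat \<Rightarrow> ('r, 'm) module \<Rightarrow> ('r, 'm) module \<Rightarrow> bool" where
  "is_Omega_nat R 0 M N \<longleftrightarrow> N = M"
| "is_Omega_nat R (Suc n) M N \<longleftrightarrow> (\<exists>L. is_Omega_nat R n M L \<and> is_Omega R L N)"

definition is_Omega_int :: "'r ring \<Rightarrow> int \<Rightarrow> ('r, 'm) module \<Rightarrow> ('r, 'm) module \<Rightarrow> bool" where
  "is_Omega_int R n M N \<longleftrightarrow>
    (if n \<ge> 0 then is_Omega_nat R (nat n) M N else is_Omega_nat R (nat (- n)) N M)"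

section \<open>Distinguished triangles and thick subcategories\<close>

text \<open>\<open>s\<close> represents \<open>\<Sigma>a\<close>, for the suspensions \<open>S\<close> of \<open>A\<close> and \<open>S'\<close> of \<open>A'\<close> given by
  \<open>0 \<rightarrow> A \<rightarrow> I \<rightarrow> S \<rightarrow> 0\<close> and \<open>0 \<rightarrow> A' \<rightarrow> I' \<rightarrow> S' \<rightarrow> 0\<close>.\<close>

definition suspends_to ::
    "'r ring \<Rightarrow> ('r, 'm) module \<Rightarrow> ('r, 'm) module \<Rightarrow> ('r, 'm) module \<Rightarrow> ('m \<Rightarrow> 'm) \<Rightarrow> ('m \<Rightarrow> 'm) \<Rightarrow>
     ('r, 'm) module \<Rightarrow> ('r, 'm) module \<Rightarrow> ('r, 'm) module \<Rightarrow> ('m \<Rightarrow> 'm) \<Rightarrow> ('m \<Rightarrow> 'm) \<Rightarrow>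
     ('m \<Rightarrow> 'm) \<Rightarrow> ('m \<Rightarrow> 'm) \<Rightarrow> bool" where
  "suspends_to R A I S i q A' I' S' i' q' a s \<longleftrightarrow>
    Omega_seq R A I S i q \<and> Omega_seq R A' I' S' i' q' \<and>
    a \<in> lmod_hom R A A' \<and> s \<in> lmod_hom R S S' \<and>
    (\<exists>e\<in>lmod_hom R I I'. (\<forall>x\<in>carrier A. e (i x) = i' (a x)) \<and>
                          (\<forall>x\<in>carrier I. s (q x) = q' (e x)))"

text \<open>The triangle \<open>A \<rightarrow> B \<rightarrow> C \<rightarrow> S = \<Sigma>A\<close> of a short exact sequence: \<open>h\<close> is induced by an extension
  \<open>u\<close> of \<open>i\<close> to \<open>B\<close>. (Some authors use \<open>-h\<close>; this does not affect which triples \<open>A, B, C\<close> occur.)\<close>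

definition standard_triangle ::
    "'r ring \<Rightarrow> ('r, 'm) module \<Rightarrow> ('r, 'm) module \<Rightarrow> ('r, 'm) module \<Rightarrow>
     ('r, 'm) module \<Rightarrow> ('r, 'm) module \<Rightarrow> ('m \<Rightarrow> 'm) \<Rightarrow> ('m \<Rightarrow> 'm) \<Rightarrow>
     ('m \<Rightarrow> 'm) \<Rightarrow> ('m \<Rightarrow> 'm) \<Rightarrow> ('m \<Rightarrow> 'm) \<Rightarrow> bool" where
  "standard_triangle R A B C I S i q f g h \<longleftrightarrow>
    short_exact R A B C f g \<and> Omega_seq R A I S i q \<and> h \<in> lmod_hom R C S \<and>
    (\<exists>u\<in>lmod_hom R B I. (\<forall>x\<in>carrier A. u (f x) = i x) \<and>
                         (\<forall>y\<in>carrier B. h (g y) = q (u y)))"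

definition distinguished_triangle ::
    "'r ring \<Rightarrow> ('r, 'm) module \<Rightarrow> ('r, 'm) module \<Rightarrow> ('r, 'm) module \<Rightarrow>
     ('r, 'm) module \<Rightarrow> ('r, 'm) module \<Rightarrow> ('m \<Rightarrow> 'm) \<Rightarrow> ('m \<Rightarrow> 'm) \<Rightarrow>
     ('m \<Rightarrow> 'm) \<Rightarrow> ('m \<Rightarrow> 'm) \<Rightarrow> ('m \<Rightarrow> 'm) \<Rightarrow> bool" where
  "distinguished_triangle R A B C I S i q f g h \<longleftrightarrow>
    left_module R B \<and> left_module R C \<and> Omega_seq R A I S i q \<and>
    f \<in> lmod_hom R A B \<and> g \<in> lmod_hom R B C \<and> h \<in> lmod_hom R C S \<and>
    (\<exists>A' B' C' I' S' i' q' f' g' h' a b c s.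
       standard_triangle R A' B' C' I' S' i' q' f' g' h' \<and>
       stable_iso_map R A A' a \<and> stable_iso_map R B B' b \<and> stable_iso_map R C C' c \<and>
       suspends_to R A I S i q A' I' S' i' q' a s \<and>
       stably_eq R A B' (b \<circ> f) (f' \<circ> a) \<and>
       stably_eq R B C' (c \<circ> g) (g' \<circ> b) \<and>
       stably_eq R C S' (s \<circ> h) (h' \<circ> c))"

text \<open>Full subcategories are given by their sets of objects.\<close>

definition triangulated_subcategory :: "'r ring \<Rightarrow> ('r, 'm) module set \<Rightarrow> bool" where
  "triangulated_subcategory R \<C> \<longleftrightarrow>
    (\<forall>M\<in>\<C>. left_module R M) \<and>
    (\<forall>Z. left_module R Z \<and> carrier Z = {\<zero>\<^bsub>Z\<^esub>} \<longrightarrow> Z \<in> \<C>) \<and>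
    (\<forall>M N f. left_module R M \<and> N \<in> \<C> \<and> stable_iso_map R M N f \<longrightarrow> M \<in> \<C>) \<and>
    (\<forall>M L. is_Omega R M L \<longrightarrow> (M \<in> \<C> \<longleftrightarrow> L \<in> \<C>)) \<and>
    (\<forall>A B C I S i q f g h. distinguished_triangle R A B C I S i q f g h \<longrightarrow>
       (A \<in> \<C> \<and> B \<in> \<C> \<longrightarrow> C \<in> \<C>) \<and> (A \<in> \<C> \<and> C \<in> \<C> \<longrightarrow> B \<in> \<C>) \<and> (B \<in> \<C> \<and> C \<in> \<C> \<longrightarrow> A \<in> \<C>))"

definition thick_subcategory :: "'r ring \<Rightarrow> ('r, 'm) module set \<Rightarrow> bool" where
  "thick_subcategory R \<C> \<longleftrightarrow> triangulated_subcategory R \<C> \<and>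
    (\<forall>M N. left_module R M \<and> N \<in> \<C> \<and> stable_retract R M N \<longrightarrow> M \<in> \<C>)"

text \<open>The trivial module has carrier in \<open>'k\<close>; inside \<open>'m\<close> it is represented by all its isomorphic
  copies.\<close>

definition is_trivial ::
    "('g, 'a) monoid_scheme \<Rightarrow> ('k, 'b) ring_scheme \<Rightarrow> ('g \<Rightarrow> 'k, 'm) module \<Rightarrow> bool" where
  "is_trivial G K T \<longleftrightarrow> left_module (group_ring G K) T \<and>
     lmod_iso (group_ring G K) T (trivial_module G K)"

definition Thick_k ::
    "('g, 'a) monoid_scheme \<Rightarrow> ('k, 'b) ring_scheme \<Rightarrow> ('g \<Rightarrow> 'k, 'm) module set" where
  "Thick_k G K = \<Inter> {\<C>. thick_subcategory (group_ring G K) \<C> \<and> {T. is_trivial G K T} \<subseteq> \<C>}"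

section \<open>Ghosts\<close>

definition ghost :: "('g, 'a) monoid_scheme \<Rightarrow> ('k, 'b) ring_scheme \<Rightarrow>
    ('g \<Rightarrow> 'k, 'm) module \<Rightarrow> ('g \<Rightarrow> 'k, 'm) module \<Rightarrow> ('m \<Rightarrow> 'm) \<Rightarrow> bool" where
  "ghost G K M N f \<longleftrightarrow> f \<in> lmod_hom (group_ring G K) M N \<and>
    (\<forall>(n :: int) (T :: ('g \<Rightarrow> 'k, 'm) module) (L :: ('g \<Rightarrow> 'k, 'm) module).
       is_trivial G K T \<longrightarrow> is_Omega_int (group_ring G K) n T L \<longrightarrow>
       (\<forall>t\<in>lmod_hom (group_ring G K) L M. stably_zero (group_ring G K) L N (f \<circ> t)))"

inductive ghost_composite :: "('g, 'a) monoid_scheme \<Rightarrow> ('k, 'b) ring_scheme \<Rightarrow> nat \<Rightarrow>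
    ('g \<Rightarrow> 'k, 'm) module \<Rightarrow> ('g \<Rightarrow> 'k, 'm) module \<Rightarrow> ('m \<Rightarrow> 'm) \<Rightarrow> bool"
  for G :: "('g, 'a) monoid_scheme" and K :: "('k, 'b) ring_scheme" where
  none: "\<lbrakk> M \<in> Thick_k G K; N \<in> Thick_k G K; f \<in> lmod_hom (group_ring G K) M N \<rbrakk>
         \<Longrightarrow> ghost_composite G K 0 M N f"
| one: "\<lbrakk> M \<in> Thick_k G K; N \<in> Thick_k G K; ghost G K M N f \<rbrakk>
        \<Longrightarrow> ghost_composite G K 1 M N f"
| step: "\<lbrakk> n \<ge> 1; ghost_composite G K n M L f; N \<in> Thick_k G K; ghost G K L N g \<rbrakk>
         \<Longrightarrow> ghost_composite G K (Suc n) M N (g \<circ> f)"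

text \<open>Infima and suprema are taken in \<^typ>\<open>enat\<close>: the value is \<open>\<infinity>\<close> where no finite one exists.\<close>

definition ghost_length ::
    "('g, 'a) monoid_scheme \<Rightarrow> ('k, 'b) ring_scheme \<Rightarrow> ('g \<Rightarrow> 'k, 'm) module \<Rightarrow> enat" where
  "ghost_length G K M =
    Inf {enat n | n. \<forall>N f. ghost_composite G K n M N f \<longrightarrow> stably_zero (group_ring G K) M N f}"

definition ghost_number ::
    "'m itself \<Rightarrow> ('g, 'a) monoid_scheme \<Rightarrow> ('k, 'b) ring_scheme \<Rightarrow> enat" where
  "ghost_number _ G K =
    (SUP M \<in> (Thick_k G K :: ('g \<Rightarrow> 'k, 'm) module set). ghost_length G K M)"

end

theory Submission
  imports Defs
begin

text \<open>
  In characteristic 3 the group algebra of \<open>C\<^sub>3 \<times> C\<^sub>3\<close> is \<open>R = k[x, y]/(x\<^sup>3, y\<^sup>3)\<close>, with \<open>x\<close> and \<open>y\<close> the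
  two generators minus 1. Write \<open>J = (x, y)\<close>; then \<open>J\<^sup>3\<close> is spanned by \<open>x\<^sup>2y\<close>, \<open>xy\<^sup>2\<close> and \<open>x\<^sup>2y\<^sup>2\<close>, and \<open>J\<^sup>4\<close> by
  \<open>x\<^sup>2y\<^sup>2\<close>. The linear form reading off the coefficient of \<open>x\<^sup>2y\<^sup>2\<close> makes \<open>x\<^sup>iy\<^sup>j\<close> and \<open>x\<^sup>2\<^sup>-\<^sup>iy\<^sup>2\<^sup>-\<^sup>j\<close> dual
  bases, and with this a map of modules is stably zero exactly if it is a trace
  \<open>u \<mapsto> \<Sum> x\<^sup>i y\<^sup>j L(x\<^sup>2\<^sup>-\<^sup>i y\<^sup>2\<^sup>-\<^sup>j u)\<close> of some \<open>k\<close>-linear map \<open>L\<close> (\<open>stably_zero_iff_traced\<close>). Stable vanishing thus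
  becomes linear algebra, for modules of any dimension.

  Upper bound. Every module is a stable retract of one annihilated by \<open>x\<^sup>2y\<^sup>2\<close> (\<open>socle_free_part\<close>). Testing a
  ghost \<open>f\<close> between such modules on \<open>k\<close>, on \<open>\<Omega>\<^sup>-\<^sup>1k = R/x\<^sup>2y\<^sup>2R\<close> and on \<open>\<Omega>\<^sup>-\<^sup>2k = R\<^sup>2/(x, -y)R\<close> shows that \<open>f\<close>
  kills the elements annihilated by \<open>J\<close>, that its values lie in \<open>J\<close> times the target, and that \<open>xu = yv\<close>
  implies \<open>f u = x\<^sup>2a + yb\<close> and \<open>f v = xb + y\<^sup>2c\<close> for some \<open>a\<close>, \<open>b\<close>, \<open>c\<close> (\<open>ghostly\<close>, \<open>ghostly_if_tests\<close>). For a
  composite \<open>h\<close> of three ghosts it follows that \<open>h\<close> kills \<open>JM\<close>, that every value of \<open>h\<close> has the form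
  \<open>x\<^sup>2y\<beta> + xy\<^sup>2\<alpha>\<close>, and that for a relation \<open>xu = yv\<close> there are \<open>a\<close>, \<open>b\<close>, \<open>c\<close> with \<open>h u = x\<^sup>2ya + xy\<^sup>2b\<close> and
  \<open>h v = x\<^sup>2yb + xy\<^sup>2c\<close>, sharing the middle coefficient \<open>b\<close>. If \<open>\<alpha>\<close> and \<open>\<beta>\<close> can be chosen as linear functions on
  \<open>M\<close> that vanish on \<open>JM\<close> and satisfy \<open>\<alpha> u = \<beta> v\<close> for every relation, then \<open>\<Lambda>(xu + yv) = \<alpha> u + \<beta> v\<close> is well
  defined and \<open>h\<close> is its trace (\<open>h_traced\<close>). The choice succeeds because relations only interact through
  elements on which \<open>h\<close> vanishes: if \<open>xu = yu'\<close>, \<open>xv = yv'\<close> and \<open>u + v' \<in> JM\<close>, then, up to \<open>JM\<close>, all four elements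
  are annihilated by \<open>J\<^sup>3\<close>, and \<open>h\<close> kills such elements (\<open>h_kills_overlap_radical\<close>,
  \<open>cubic_coefficients\<close>).

  Lower bound. Multiplication by \<open>x\<close> is zero on \<open>k\<close>, hence stably zero on every \<open>\<Omega>\<^sup>nk\<close>, hence a ghost on every
  module (\<open>ghost_ux\<close>). On \<open>M = y\<^sup>2R\<close>, an iterated extension of three copies of \<open>k\<close>, the element \<open>y\<close> acts as
  zero, so that all traces on \<open>M\<close> vanish (\<open>traced_zero_on_multiples\<close>); but \<open>x\<^sup>2\<close> is not zero on \<open>M\<close>.
\<close>

section \<open>Linear maps between modules\<close>

text \<open>Scalars are restricted to a set \<open>S\<close>: the whole ring gives the module homomorphisms, a subfield the
  \<open>k\<close>-linear maps whose traces are taken below.\<close>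

definition linear_maps :: "'r set \<Rightarrow> ('r, 'm) module \<Rightarrow> ('r, 'n) module \<Rightarrow> ('m \<Rightarrow> 'n) set" where
  "linear_maps S M N = {f \<in> carrier M \<rightarrow> carrier N.
     (\<forall>u\<in>carrier M. \<forall>v\<in>carrier M. f (u \<oplus>\<^bsub>M\<^esub> v) = f u \<oplus>\<^bsub>N\<^esub> f v) \<and>
     (\<forall>a\<in>S. \<forall>u\<in>carrier M. f (a \<odot>\<^bsub>M\<^esub> u) = a \<odot>\<^bsub>N\<^esub> f u)}"

lemma lmod_hom_eq_linear_maps: "lmod_hom R M N = linear_maps (carrier R) M N"
  by (simp add: lmod_hom_def linear_maps_def)

lemma linear_maps_closed: "f \<in> linear_maps S M N \<Longrightarrow> u \<in> carrier M \<Longrightarrow> f u \<in> carrier N"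
  by (auto simp: linear_maps_def)

lemma linear_maps_add:
  "f \<in> linear_maps S M N \<Longrightarrow> u \<in> carrier M \<Longrightarrow> v \<in> carrier M \<Longrightarrow> f (u \<oplus>\<^bsub>M\<^esub> v) = f u \<oplus>\<^bsub>N\<^esub> f v"
  by (auto simp: linear_maps_def)

lemma linear_maps_smult:
  "f \<in> linear_maps S M N \<Longrightarrow> a \<in> S \<Longrightarrow> u \<in> carrier M \<Longrightarrow> f (a \<odot>\<^bsub>M\<^esub> u) = a \<odot>\<^bsub>N\<^esub> f u"
  by (auto simp: linear_maps_def)

lemma linear_mapsI:
  assumes "\<And>u. u \<in> carrier M \<Longrightarrow> f u \<in> carrier N"
    and "\<And>u v. u \<in> carrier M \<Longrightarrow> v \<in> carrier M \<Longrightarrow> f (u \<oplus>\<^bsub>M\<^esub> v) = f u \<oplus>\<^bsub>N\<^esub> f v"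
    and "\<And>a u. a \<in> S \<Longrightarrow> u \<in> carrier M \<Longrightarrow> f (a \<odot>\<^bsub>M\<^esub> u) = a \<odot>\<^bsub>N\<^esub> f u"
  shows "f \<in> linear_maps S M N"
  using assms by (auto simp: linear_maps_def)

lemma linear_maps_mono: "f \<in> linear_maps S M N \<Longrightarrow> S' \<subseteq> S \<Longrightarrow> f \<in> linear_maps S' M N"
  by (auto simp: linear_maps_def)

lemma linear_maps_comp:
  "f \<in> linear_maps S M N \<Longrightarrow> g \<in> linear_maps S N Q \<Longrightarrow> g \<circ> f \<in> linear_maps S M Q"
  by (rule linear_mapsI) (simp_all add: linear_maps_closed linear_maps_add linear_maps_smult)

lemmas hom_closed = linear_maps_closed[of _ "carrier R" for R :: "'r ring", folded lmod_hom_eq_linear_maps]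
lemmas hom_add = linear_maps_add[of _ "carrier R" for R :: "'r ring", folded lmod_hom_eq_linear_maps]
lemmas hom_smult = linear_maps_smult[of _ "carrier R" for R :: "'r ring", folded lmod_hom_eq_linear_maps]
lemmas homI = linear_mapsI[of _ _ _ "carrier R" for R :: "'r ring", folded lmod_hom_eq_linear_maps]
lemmas hom_comp = linear_maps_comp[of _ "carrier R" for R :: "'r ring", folded lmod_hom_eq_linear_maps]

lemma hom_id: "id \<in> lmod_hom R M M"
  by (rule homI) simp_all

text \<open>Module axioms as plain conditional rewrite rules, usable for several modules at a time.\<close>

context
  fixes R :: "'r ring" (structure) and M :: "('r, 'm) module" (structure)
  assumes M: "left_module R M"
begin

interpretation left_module R M by (rule M)

lemmas lm_abelian = M.abelian_group_axioms
lemmas lm_add_closed = M.a_closed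
lemmas lm_zero_closed = M.zero_closed
lemmas lm_smult_closed = smult_closed
lemmas lm_neg_closed = M.a_inv_closed
lemmas lm_minus_closed = M.minus_closed
lemmas lm_add_assoc = M.a_assoc
lemmas lm_add_comm = M.a_comm
lemmas lm_add_lcomm = M.a_lcomm
lemmas lm_add_zero = M.r_zero
lemmas lm_zero_add = M.l_zero
lemmas lm_smult_add = smult_r_distr
lemmas lm_add_smult = smult_l_distr
lemmas lm_mult_smult = smult_assoc1
lemmas lm_one_smult = smult_one
lemmas lm_add_neg = M.r_neg
lemmas lm_minus_def = M.minus_eq

lemma lm_smult_zero: "a \<in> carrier R \<Longrightarrow> a \<odot>\<^bsub>M\<^esub> \<zero>\<^bsub>M\<^esub> = \<zero>\<^bsub>M\<^esub>"
  using lm_smult_add[of a "\<zero>\<^bsub>M\<^esub>" "\<zero>\<^bsub>M\<^esub>"] M.add.r_cancel_one[of "a \<odot>\<^bsub>M\<^esub> \<zero>\<^bsub>M\<^esub>" "a \<odot>\<^bsub>M\<^esub> \<zero>\<^bsub>M\<^esub>"] by simp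

lemma lm_zero_smult: "u \<in> carrier M \<Longrightarrow> \<zero> \<odot>\<^bsub>M\<^esub> u = \<zero>\<^bsub>M\<^esub>"
  using lm_add_smult[of "\<zero>" "\<zero>" u] M.add.r_cancel_one[of "\<zero> \<odot>\<^bsub>M\<^esub> u" "\<zero> \<odot>\<^bsub>M\<^esub> u"] by simp

lemma lm_smult_neg: "a \<in> carrier R \<Longrightarrow> u \<in> carrier M \<Longrightarrow> a \<odot>\<^bsub>M\<^esub> (\<ominus>\<^bsub>M\<^esub> u) = \<ominus>\<^bsub>M\<^esub> (a \<odot>\<^bsub>M\<^esub> u)"
  using lm_smult_add[of a u "\<ominus>\<^bsub>M\<^esub> u"] lm_smult_zero
  by (metis M.add.inv_closed M.minus_equality M.r_neg M.a_comm smult_closed)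

lemma lm_neg_smult: "a \<in> carrier R \<Longrightarrow> u \<in> carrier M \<Longrightarrow> (\<ominus> a) \<odot>\<^bsub>M\<^esub> u = \<ominus>\<^bsub>M\<^esub> (a \<odot>\<^bsub>M\<^esub> u)"
  using lm_add_smult[of a "\<ominus> a" u] lm_zero_smult[of u]
  by (metis R.add.inv_closed M.minus_equality R.r_neg M.a_comm smult_closed)

lemma lm_smult_minus: "a \<in> carrier R \<Longrightarrow> u \<in> carrier M \<Longrightarrow> v \<in> carrier M \<Longrightarrow>
    a \<odot>\<^bsub>M\<^esub> (u \<ominus>\<^bsub>M\<^esub> v) = a \<odot>\<^bsub>M\<^esub> u \<ominus>\<^bsub>M\<^esub> a \<odot>\<^bsub>M\<^esub> v"
  by (simp add: M.minus_eq lm_smult_add lm_smult_neg)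

lemma lm_minus_eq_zero: "u \<in> carrier M \<Longrightarrow> v \<in> carrier M \<Longrightarrow> u \<ominus>\<^bsub>M\<^esub> v = \<zero>\<^bsub>M\<^esub> \<longleftrightarrow> u = v"
  by (metis M.minus_eq M.add.inv_closed M.minus_equality M.minus_minus M.r_neg)

lemma lm_minus_self: "u \<in> carrier M \<Longrightarrow> u \<ominus>\<^bsub>M\<^esub> u = \<zero>\<^bsub>M\<^esub>"
  by (simp add: lm_minus_eq_zero)

lemma lm_minus_zero: "u \<in> carrier M \<Longrightarrow> u \<ominus>\<^bsub>M\<^esub> \<zero>\<^bsub>M\<^esub> = u"
  by (simp add: M.minus_eq)

lemma lm_minus_add_cancel: "u \<in> carrier M \<Longrightarrow> v \<in> carrier M \<Longrightarrow> (u \<ominus>\<^bsub>M\<^esub> v) \<oplus>\<^bsub>M\<^esub> v = u"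
  by (simp add: M.minus_eq M.a_assoc M.l_neg)

lemma lm_add_minus_cancel: "u \<in> carrier M \<Longrightarrow> v \<in> carrier M \<Longrightarrow> (u \<oplus>\<^bsub>M\<^esub> v) \<ominus>\<^bsub>M\<^esub> v = u"
  by (simp add: M.minus_eq M.a_assoc M.r_neg)

lemma lm_minus_eq_iff: "u \<in> carrier M \<Longrightarrow> v \<in> carrier M \<Longrightarrow> w \<in> carrier M \<Longrightarrow>
    u \<ominus>\<^bsub>M\<^esub> v = w \<longleftrightarrow> u = w \<oplus>\<^bsub>M\<^esub> v"
  by (metis lm_minus_add_cancel lm_add_minus_cancel)

lemma lm_add_minus_add: "a \<in> carrier M \<Longrightarrow> b \<in> carrier M \<Longrightarrow> c \<in> carrier M \<Longrightarrow> d \<in> carrier M \<Longrightarrow>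
    (a \<oplus>\<^bsub>M\<^esub> b) \<ominus>\<^bsub>M\<^esub> (c \<oplus>\<^bsub>M\<^esub> d) = (a \<ominus>\<^bsub>M\<^esub> c) \<oplus>\<^bsub>M\<^esub> (b \<ominus>\<^bsub>M\<^esub> d)"
  by (simp add: M.minus_eq M.minus_add M.a_ac)

lemma lm_add_left_cancel: "u \<in> carrier M \<Longrightarrow> v \<in> carrier M \<Longrightarrow> w \<in> carrier M \<Longrightarrow>
    w \<oplus>\<^bsub>M\<^esub> u = w \<oplus>\<^bsub>M\<^esub> v \<longleftrightarrow> u = v"
  by simp

end

lemma lm_smult_lcomm:
  assumes "left_module R M" "cring R" "a \<in> carrier R" "b \<in> carrier R" "u \<in> carrier M"
  shows "a \<odot>\<^bsub>M\<^esub> (b \<odot>\<^bsub>M\<^esub> u) = b \<odot>\<^bsub>M\<^esub> (a \<odot>\<^bsub>M\<^esub> u)"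
  by (metis assms cring.cring_simprules(14) lm_mult_smult)

lemmas lm_rules = lm_add_closed lm_zero_closed lm_smult_closed lm_neg_closed lm_minus_closed
  lm_add_assoc lm_add_zero lm_zero_add lm_smult_add lm_smult_zero lm_zero_smult lm_one_smult
  lm_mult_smult lm_minus_self lm_minus_zero

lemma linear_maps_zero:
  assumes "f \<in> linear_maps S M N" "left_module R M" "left_module R N"
  shows "f \<zero>\<^bsub>M\<^esub> = \<zero>\<^bsub>N\<^esub>"
proof -
  have z: "\<zero>\<^bsub>M\<^esub> \<in> carrier M" by (simp add: lm_rules[OF assms(2)])
  have "f \<zero>\<^bsub>M\<^esub> \<oplus>\<^bsub>N\<^esub> f \<zero>\<^bsub>M\<^esub> = f \<zero>\<^bsub>M\<^esub> \<oplus>\<^bsub>N\<^esub> \<zero>\<^bsub>N\<^esub>"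
    using linear_maps_add[OF assms(1) z z]
    by (simp add: lm_rules[OF assms(2)] lm_rules[OF assms(3)] linear_maps_closed[OF assms(1)])
  then show ?thesis
    using lm_add_left_cancel[OF assms(3), of "f \<zero>\<^bsub>M\<^esub>" "\<zero>\<^bsub>N\<^esub>" "f \<zero>\<^bsub>M\<^esub>"]
    by (simp add: lm_rules[OF assms(2)] lm_rules[OF assms(3)] linear_maps_closed[OF assms(1)])
qed

lemma linear_maps_minus:
  assumes f: "f \<in> linear_maps S M N" and M: "left_module R M" and N: "left_module R N"
    and u: "u \<in> carrier M" and v: "v \<in> carrier M"
  shows "f (u \<ominus>\<^bsub>M\<^esub> v) = f u \<ominus>\<^bsub>N\<^esub> f v"
proof -
  have "f u = f ((u \<ominus>\<^bsub>M\<^esub> v) \<oplus>\<^bsub>M\<^esub> v)" by (simp add: lm_minus_add_cancel[OF M] u v)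
  also have "\<dots> = f (u \<ominus>\<^bsub>M\<^esub> v) \<oplus>\<^bsub>N\<^esub> f v"
    by (rule linear_maps_add[OF f]) (simp_all add: lm_rules[OF M] u v)
  finally show ?thesis
    by (metis lm_add_minus_cancel[OF N] lm_minus_closed[OF M] linear_maps_closed[OF f] u v)
qed

lemma linear_maps_neg:
  assumes f: "f \<in> linear_maps S M N" and M: "left_module R M" and N: "left_module R N"
    and u: "u \<in> carrier M"
  shows "f (\<ominus>\<^bsub>M\<^esub> u) = \<ominus>\<^bsub>N\<^esub> f u"
proof -
  have e: "\<ominus>\<^bsub>M\<^esub> u = \<zero>\<^bsub>M\<^esub> \<ominus>\<^bsub>M\<^esub> u" by (simp add: lm_minus_def[OF M] lm_zero_add[OF M] lm_neg_closed[OF M] u)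
  show ?thesis
    unfolding e
    by (simp add: linear_maps_minus[OF f M N] u lm_zero_closed[OF M] linear_maps_zero[OF f M N]
        lm_minus_def[OF N] lm_zero_add[OF N] lm_neg_closed[OF N] linear_maps_closed[OF f])
qed

lemmas hom_zero = linear_maps_zero[of _ "carrier R" for R :: "'r ring", folded lmod_hom_eq_linear_maps]
lemmas hom_minus = linear_maps_minus[of _ "carrier R" for R :: "'r ring", folded lmod_hom_eq_linear_maps]
lemma left_moduleI:
  fixes R (structure) and M (structure)
  assumes "ring R" "abelian_group M"
    "\<And>a u. \<lbrakk>a \<in> carrier R; u \<in> carrier M\<rbrakk> \<Longrightarrow> a \<odot>\<^bsub>M\<^esub> u \<in> carrier M"
    "\<And>a b u. \<lbrakk>a \<in> carrier R; b \<in> carrier R; u \<in> carrier M\<rbrakk> \<Longrightarrow> (a \<oplus> b) \<odot>\<^bsub>M\<^esub> u = a \<odot>\<^bsub>M\<^esub> u \<oplus>\<^bsub>M\<^esub> b \<odot>\<^bsub>M\<^esub> u"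
    "\<And>a u v. \<lbrakk>a \<in> carrier R; u \<in> carrier M; v \<in> carrier M\<rbrakk> \<Longrightarrow> a \<odot>\<^bsub>M\<^esub> (u \<oplus>\<^bsub>M\<^esub> v) = a \<odot>\<^bsub>M\<^esub> u \<oplus>\<^bsub>M\<^esub> a \<odot>\<^bsub>M\<^esub> v"
    "\<And>a b u. \<lbrakk>a \<in> carrier R; b \<in> carrier R; u \<in> carrier M\<rbrakk> \<Longrightarrow> (a \<otimes> b) \<odot>\<^bsub>M\<^esub> u = a \<odot>\<^bsub>M\<^esub> (b \<odot>\<^bsub>M\<^esub> u)"
    "\<And>u. u \<in> carrier M \<Longrightarrow> \<one> \<odot>\<^bsub>M\<^esub> u = u"
  shows "left_module R M"
  using assms by (simp add: left_module_def left_module_axioms_def)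

section \<open>Linear functions inside linear relations\<close>

definition linear_relation ::
    "'r set \<Rightarrow> ('r, 'v) module \<Rightarrow> ('r, 'w) module \<Rightarrow> ('v \<times> 'w) set \<Rightarrow> bool" where
  "linear_relation S V W \<Gamma> \<longleftrightarrow> \<Gamma> \<subseteq> carrier V \<times> carrier W \<and> (\<zero>\<^bsub>V\<^esub>, \<zero>\<^bsub>W\<^esub>) \<in> \<Gamma> \<and>
     (\<forall>v w v' w'. (v, w) \<in> \<Gamma> \<longrightarrow> (v', w') \<in> \<Gamma> \<longrightarrow> (v \<oplus>\<^bsub>V\<^esub> v', w \<oplus>\<^bsub>W\<^esub> w') \<in> \<Gamma>) \<and>
     (\<forall>a v w. a \<in> S \<longrightarrow> (v, w) \<in> \<Gamma> \<longrightarrow> (a \<odot>\<^bsub>V\<^esub> v, a \<odot>\<^bsub>W\<^esub> w) \<in> \<Gamma>)"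

lemma subfield_facts:
  fixes R (structure)
  assumes "ring R" "subfield k R"
  shows "k \<subseteq> carrier R" "\<zero> \<in> k" "\<one> \<in> k"
    "\<And>a. a \<in> k \<Longrightarrow> \<ominus> a \<in> k" "\<And>a b. a \<in> k \<Longrightarrow> b \<in> k \<Longrightarrow> a \<otimes> b \<in> k"
    "\<And>a b. a \<in> k \<Longrightarrow> b \<in> k \<Longrightarrow> a \<oplus> b \<in> k"
    "\<And>a. a \<in> k \<Longrightarrow> a \<noteq> \<zero> \<Longrightarrow> \<exists>b\<in>k. b \<otimes> a = \<one>"
proof -
  interpret ring R by fact
  note s = subringE[OF subfieldE(1)[OF assms(2)]]
  show "k \<subseteq> carrier R" "\<zero> \<in> k" "\<one> \<in> k"
    "\<And>a. a \<in> k \<Longrightarrow> \<ominus> a \<in> k" "\<And>a b. a \<in> k \<Longrightarrow> b \<in> k \<Longrightarrow> a \<otimes> b \<in> k"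
    "\<And>a b. a \<in> k \<Longrightarrow> b \<in> k \<Longrightarrow> a \<oplus> b \<in> k"
    using s by auto
  show "\<And>a. a \<in> k \<Longrightarrow> a \<noteq> \<zero> \<Longrightarrow> \<exists>b\<in>k. b \<otimes> a = \<one>"
    using subfield_m_inv[OF assms(2)] by blast
qed

lemma linear_relation_functional:
  fixes R (structure)
  assumes V: "left_module R V" and W: "left_module R W" and k: "ring R" "subfield k R"
    and \<Gamma>: "linear_relation k V W \<Gamma>" and f: "\<And>w. (\<zero>\<^bsub>V\<^esub>, w) \<in> \<Gamma> \<Longrightarrow> w = \<zero>\<^bsub>W\<^esub>"
    and "(v, w) \<in> \<Gamma>" "(v, w') \<in> \<Gamma>"
  shows "w = w'"
proof -
  note kf = subfield_facts[OF k]
  interpret R: ring R by fact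
  have c: "v \<in> carrier V" "w \<in> carrier W" "w' \<in> carrier W"
    using assms by (auto simp: linear_relation_def)
  have m1: "\<ominus> \<one> \<in> k" using kf by blast
  have "(v \<oplus>\<^bsub>V\<^esub> \<ominus> \<one> \<odot>\<^bsub>V\<^esub> v, w \<oplus>\<^bsub>W\<^esub> \<ominus> \<one> \<odot>\<^bsub>W\<^esub> w') \<in> \<Gamma>"
    using \<Gamma> assms(7,8) m1 unfolding linear_relation_def by blast
  then have "w \<oplus>\<^bsub>W\<^esub> \<ominus> \<one> \<odot>\<^bsub>W\<^esub> w' = \<zero>\<^bsub>W\<^esub>"
    using f by (simp add: c lm_neg_smult[OF V] lm_neg_smult[OF W] lm_rules[OF V] lm_rules[OF W]
        lm_add_neg[OF V])
  then show ?thesis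
    using lm_minus_eq_zero[OF W c(2,3)] lm_minus_def[OF W, of w w'] c
    by (simp add: lm_neg_smult[OF W] lm_rules[OF W])
qed

text \<open>By Zorn's lemma there is a maximal functional relation \<open>\<Delta>\<close> between \<open>\<Gamma>0\<close> and \<open>\<Gamma>\<close>. If some pair \<open>(m, n)\<close> of
  \<open>\<Gamma>\<close> had \<open>m\<close> outside the domain of \<open>\<Delta>\<close>, then \<open>\<Delta> + k(m, n)\<close> would still be functional, since
  \<open>d + am = 0\<close> with \<open>a \<noteq> 0\<close> puts \<open>m\<close> into the domain of \<open>\<Delta>\<close>.\<close>

lemma linear_relation_contains_function:
  fixes R (structure)
  assumes V: "left_module R V" and W: "left_module R W" and k: "ring R" "subfield k R"
    and \<Gamma>: "linear_relation k V W \<Gamma>" and \<Gamma>0: "linear_relation k V W \<Gamma>0"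
    and sub: "\<Gamma>0 \<subseteq> \<Gamma>" and f0: "\<And>w. (\<zero>\<^bsub>V\<^esub>, w) \<in> \<Gamma>0 \<Longrightarrow> w = \<zero>\<^bsub>W\<^esub>"
  shows "\<exists>\<Delta>. linear_relation k V W \<Delta> \<and> \<Gamma>0 \<subseteq> \<Delta> \<and> \<Delta> \<subseteq> \<Gamma> \<and>
    (\<forall>w. (\<zero>\<^bsub>V\<^esub>, w) \<in> \<Delta> \<longrightarrow> w = \<zero>\<^bsub>W\<^esub>) \<and> Domain \<Delta> = Domain \<Gamma>"
proof -
  note kf = subfield_facts[OF k]
  have kR: "\<And>a. a \<in> k \<Longrightarrow> a \<in> carrier R" using kf(1) by blast
  interpret R: ring R by fact
  define A where "A = {\<Delta>. linear_relation k V W \<Delta> \<and> \<Gamma>0 \<subseteq> \<Delta> \<and> \<Delta> \<subseteq> \<Gamma> \<and>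
    (\<forall>w. (\<zero>\<^bsub>V\<^esub>, w) \<in> \<Delta> \<longrightarrow> w = \<zero>\<^bsub>W\<^esub>)}"
  have "\<exists>\<Delta>\<in>A. \<forall>U\<in>A. \<Delta> \<subseteq> U \<longrightarrow> U = \<Delta>"
  proof (rule subset_Zorn_nonempty)
    show "A \<noteq> {}" using \<Gamma>0 sub f0 unfolding A_def by blast
  next
    fix \<C> assume ne: "\<C> \<noteq> {}" and ch: "subset.chain A \<C>"
    then have CA: "\<C> \<subseteq> A" and tot: "\<And>U Y. U \<in> \<C> \<Longrightarrow> Y \<in> \<C> \<Longrightarrow> U \<subseteq> Y \<or> Y \<subseteq> U"
      by (auto simp: subset.chain_def)
    have lin: "linear_relation k V W U" if "U \<in> \<C>" for U using CA that by (auto simp: A_def)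
    have "linear_relation k V W (\<Union>\<C>)"
      unfolding linear_relation_def
    proof (intro conjI allI impI)
      show "\<Union>\<C> \<subseteq> carrier V \<times> carrier W" using lin unfolding linear_relation_def by blast
      show "(\<zero>\<^bsub>V\<^esub>, \<zero>\<^bsub>W\<^esub>) \<in> \<Union>\<C>" using lin ne unfolding linear_relation_def by blast
      fix v w
      assume vw: "(v, w) \<in> \<Union>\<C>"
      then obtain U where U: "U \<in> \<C>" "(v, w) \<in> U" by blast
      { fix v' w' assume "(v', w') \<in> \<Union>\<C>"
        then obtain Y where Y: "Y \<in> \<C>" "(v', w') \<in> Y" by blast
        obtain Z where "Z \<in> \<C>" "(v, w) \<in> Z" "(v', w') \<in> Z"
          using tot[OF U(1) Y(1)] U Y by blast
        then show "(v \<oplus>\<^bsub>V\<^esub> v', w \<oplus>\<^bsub>W\<^esub> w') \<in> \<Union>\<C>"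
          using lin unfolding linear_relation_def by blast }
      { fix a assume "a \<in> k"
        then show "(a \<odot>\<^bsub>V\<^esub> v, a \<odot>\<^bsub>W\<^esub> w) \<in> \<Union>\<C>"
          using U lin unfolding linear_relation_def by blast }
    qed
    then show "\<Union>\<C> \<in> A" using CA ne unfolding A_def by blast
  qed
  then obtain \<Delta> where \<Delta>A: "\<Delta> \<in> A" and max: "\<And>U. U \<in> A \<Longrightarrow> \<Delta> \<subseteq> U \<Longrightarrow> U = \<Delta>" by blast
  then have \<Delta>: "linear_relation k V W \<Delta>" "\<Gamma>0 \<subseteq> \<Delta>" "\<Delta> \<subseteq> \<Gamma>"
    and f\<Delta>: "\<And>w. (\<zero>\<^bsub>V\<^esub>, w) \<in> \<Delta> \<Longrightarrow> w = \<zero>\<^bsub>W\<^esub>" by (auto simp: A_def)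
  have car: "v \<in> carrier V" "w \<in> carrier W" if "(v, w) \<in> \<Gamma>" for v w
    using that \<Gamma> by (auto simp: linear_relation_def)
  have car': "v \<in> carrier V" "w \<in> carrier W" if "(v, w) \<in> \<Delta>" for v w
    using that \<Delta> by (auto simp: linear_relation_def)
  have \<Delta>add: "(v \<oplus>\<^bsub>V\<^esub> v', w \<oplus>\<^bsub>W\<^esub> w') \<in> \<Delta>" if "(v, w) \<in> \<Delta>" "(v', w') \<in> \<Delta>" for v w v' w'
    using that \<Delta>(1) unfolding linear_relation_def by blast
  have \<Delta>smult: "(a \<odot>\<^bsub>V\<^esub> v, a \<odot>\<^bsub>W\<^esub> w) \<in> \<Delta>" if "(v, w) \<in> \<Delta>" "a \<in> k" for v w a
    using that \<Delta>(1) unfolding linear_relation_def by blast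
  have \<Gamma>add: "(v \<oplus>\<^bsub>V\<^esub> v', w \<oplus>\<^bsub>W\<^esub> w') \<in> \<Gamma>" if "(v, w) \<in> \<Gamma>" "(v', w') \<in> \<Gamma>" for v w v' w'
    using that \<Gamma>(1) unfolding linear_relation_def by blast
  have \<Gamma>smult: "(a \<odot>\<^bsub>V\<^esub> v, a \<odot>\<^bsub>W\<^esub> w) \<in> \<Gamma>" if "(v, w) \<in> \<Gamma>" "a \<in> k" for v w a
    using that \<Gamma>(1) unfolding linear_relation_def by blast
  have "m \<in> Domain \<Delta>" if mn: "(m, n) \<in> \<Gamma>" for m n
  proof (rule ccontr)
    assume nd: "m \<notin> Domain \<Delta>"
    note c = car[OF mn]
    define U where "U = {(d \<oplus>\<^bsub>V\<^esub> a \<odot>\<^bsub>V\<^esub> m, e \<oplus>\<^bsub>W\<^esub> a \<odot>\<^bsub>W\<^esub> n) | d e a. (d, e) \<in> \<Delta> \<and> a \<in> k}"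
    have "(d, e) \<in> U" if "(d, e) \<in> \<Delta>" for d e
    proof -
      have "(d \<oplus>\<^bsub>V\<^esub> \<zero> \<odot>\<^bsub>V\<^esub> m, e \<oplus>\<^bsub>W\<^esub> \<zero> \<odot>\<^bsub>W\<^esub> n) \<in> U" using that kf unfolding U_def by blast
      then show ?thesis by (simp add: car'[OF that] c lm_rules[OF V] lm_rules[OF W])
    qed
    then have sX: "\<Delta> \<subseteq> U" by auto
    have "linear_relation k V W U"
      unfolding linear_relation_def
    proof (intro conjI allI impI)
      show "U \<subseteq> carrier V \<times> carrier W"
        by (auto simp: U_def c kR lm_rules[OF V] lm_rules[OF W] dest: car')
      show "(\<zero>\<^bsub>V\<^esub>, \<zero>\<^bsub>W\<^esub>) \<in> U" using \<Delta>(1) sX unfolding linear_relation_def by blast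
      fix v w
      assume "(v, w) \<in> U"
      then obtain d e a where vw: "v = d \<oplus>\<^bsub>V\<^esub> a \<odot>\<^bsub>V\<^esub> m" "w = e \<oplus>\<^bsub>W\<^esub> a \<odot>\<^bsub>W\<^esub> n"
        and dea: "(d, e) \<in> \<Delta>" "a \<in> k" unfolding U_def by blast
      { fix v' w' assume "(v', w') \<in> U"
        then obtain d' e' a' where vw': "v' = d' \<oplus>\<^bsub>V\<^esub> a' \<odot>\<^bsub>V\<^esub> m" "w' = e' \<oplus>\<^bsub>W\<^esub> a' \<odot>\<^bsub>W\<^esub> n"
          and dea': "(d', e') \<in> \<Delta>" "a' \<in> k" unfolding U_def by blast
        have "v \<oplus>\<^bsub>V\<^esub> v' = (d \<oplus>\<^bsub>V\<^esub> d') \<oplus>\<^bsub>V\<^esub> (a \<oplus> a') \<odot>\<^bsub>V\<^esub> m"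
          by (simp add: vw vw' car'[OF dea(1)] car'[OF dea'(1)] c kR dea(2) dea'(2)
              lm_rules[OF V] lm_add_smult[OF V] lm_add_comm[OF V] lm_add_lcomm[OF V])
        moreover have "w \<oplus>\<^bsub>W\<^esub> w' = (e \<oplus>\<^bsub>W\<^esub> e') \<oplus>\<^bsub>W\<^esub> (a \<oplus> a') \<odot>\<^bsub>W\<^esub> n"
          by (simp add: vw vw' car'[OF dea(1)] car'[OF dea'(1)] c kR dea(2) dea'(2)
              lm_rules[OF W] lm_add_smult[OF W] lm_add_comm[OF W] lm_add_lcomm[OF W])
        ultimately show "(v \<oplus>\<^bsub>V\<^esub> v', w \<oplus>\<^bsub>W\<^esub> w') \<in> U"
          using \<Delta>add[OF dea(1) dea'(1)] kf(6)[OF dea(2) dea'(2)] unfolding U_def by blast }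
      { fix b assume b: "b \<in> k"
        have "b \<odot>\<^bsub>V\<^esub> v = b \<odot>\<^bsub>V\<^esub> d \<oplus>\<^bsub>V\<^esub> (b \<otimes> a) \<odot>\<^bsub>V\<^esub> m"
          by (simp add: vw car'[OF dea(1)] c kR dea(2) b lm_rules[OF V])
        moreover have "b \<odot>\<^bsub>W\<^esub> w = b \<odot>\<^bsub>W\<^esub> e \<oplus>\<^bsub>W\<^esub> (b \<otimes> a) \<odot>\<^bsub>W\<^esub> n"
          by (simp add: vw car'[OF dea(1)] c kR dea(2) b lm_rules[OF W])
        ultimately show "(b \<odot>\<^bsub>V\<^esub> v, b \<odot>\<^bsub>W\<^esub> w) \<in> U"
          using \<Delta>smult[OF dea(1) b] kf(5)[OF b dea(2)] unfolding U_def by blast }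
    qed
    moreover have "U \<subseteq> \<Gamma>"
    proof
      fix p assume "p \<in> U"
      then obtain d e a where "p = (d \<oplus>\<^bsub>V\<^esub> a \<odot>\<^bsub>V\<^esub> m, e \<oplus>\<^bsub>W\<^esub> a \<odot>\<^bsub>W\<^esub> n)" "(d, e) \<in> \<Delta>" "a \<in> k"
        unfolding U_def by blast
      then show "p \<in> \<Gamma>" using \<Gamma>add \<Gamma>smult mn \<Delta>(3) by auto
    qed
    moreover have "w = \<zero>\<^bsub>W\<^esub>" if zw: "(\<zero>\<^bsub>V\<^esub>, w) \<in> U" for w
    proof -
      obtain d e a where z': "\<zero>\<^bsub>V\<^esub> = d \<oplus>\<^bsub>V\<^esub> a \<odot>\<^bsub>V\<^esub> m" and w: "w = e \<oplus>\<^bsub>W\<^esub> a \<odot>\<^bsub>W\<^esub> n"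
        and dea: "(d, e) \<in> \<Delta>" "a \<in> k"
        using zw unfolding U_def by blast
      note z = z'[symmetric]
      show ?thesis
      proof (cases "a = \<zero>")
        case True
        then have "d = \<zero>\<^bsub>V\<^esub>" using z by (simp add: car'[OF dea(1)] c lm_rules[OF V])
        then have "e = \<zero>\<^bsub>W\<^esub>" using f\<Delta> dea(1) by blast
        then show ?thesis using w True by (simp add: c lm_rules[OF W])
      next
        case False
        then obtain b where b: "b \<in> k" "b \<otimes> a = \<one>" using kf(7) dea(2) by blast
        have "b \<odot>\<^bsub>V\<^esub> d \<oplus>\<^bsub>V\<^esub> m = b \<odot>\<^bsub>V\<^esub> (d \<oplus>\<^bsub>V\<^esub> a \<odot>\<^bsub>V\<^esub> m)"
          using b(2) by (simp add: car'[OF dea(1)] c kR dea(2) b lm_smult_add[OF V] lm_smult_closed[OF V]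
              lm_mult_smult[OF V, symmetric] lm_one_smult[OF V])
        also have "\<dots> = \<zero>\<^bsub>V\<^esub>" by (simp add: z lm_rules[OF V] kR b)
        finally have "m = \<ominus>\<^bsub>V\<^esub> (b \<odot>\<^bsub>V\<^esub> d)"
          using abelian_group.minus_equality[OF lm_abelian[OF V], of m "b \<odot>\<^bsub>V\<^esub> d"]
          by (simp add: c kR b car'[OF dea(1)] lm_rules[OF V] lm_add_comm[OF V])
        then have "m = (\<ominus> b) \<odot>\<^bsub>V\<^esub> d" by (simp add: lm_neg_smult[OF V] kR b car'[OF dea(1)])
        then have "m \<in> Domain \<Delta>" using \<Delta>smult[OF dea(1) kf(4)[OF b(1)]] by blast
        then show ?thesis using nd by blast
      qed
    qed
    ultimately have "U \<in> A" using sX \<Delta>(2) unfolding A_def by blast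
    then have "U = \<Delta>" using max sX by blast
    moreover have "(\<zero>\<^bsub>V\<^esub> \<oplus>\<^bsub>V\<^esub> \<one> \<odot>\<^bsub>V\<^esub> m, \<zero>\<^bsub>W\<^esub> \<oplus>\<^bsub>W\<^esub> \<one> \<odot>\<^bsub>W\<^esub> n) \<in> U"
      using \<Delta>(1) kf(3) unfolding U_def linear_relation_def by blast
    ultimately show False using nd by (auto simp: c lm_rules[OF V])
  qed
  then have "Domain \<Delta> = Domain \<Gamma>" using \<Delta>(3) by blast
  then show ?thesis using \<Delta> f\<Delta> by blast
qed

text \<open>Sections, retractions and extensions of linear maps are all instances. They live in infinite
  dimensions as well, where no bases are at hand.\<close>

lemma linear_selection:
  fixes R (structure)
  assumes V: "left_module R V" and W: "left_module R W" and k: "ring R" "subfield k R"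
    and \<Gamma>: "linear_relation k V W \<Gamma>" and \<Gamma>0: "linear_relation k V W \<Gamma>0"
    and sub: "\<Gamma>0 \<subseteq> \<Gamma>" and f0: "\<And>w. (\<zero>\<^bsub>V\<^esub>, w) \<in> \<Gamma>0 \<Longrightarrow> w = \<zero>\<^bsub>W\<^esub>"
  obtains f where "f \<in> linear_maps k V W" "\<And>v. v \<in> Domain \<Gamma> \<Longrightarrow> (v, f v) \<in> \<Gamma>"
    "\<And>v w. (v, w) \<in> \<Gamma>0 \<Longrightarrow> f v = w"
proof -
  obtain \<Delta> where \<Delta>: "linear_relation k V W \<Delta>" "\<Gamma>0 \<subseteq> \<Delta>" "\<Delta> \<subseteq> \<Gamma>" "Domain \<Delta> = Domain \<Gamma>"
    and f\<Delta>: "\<And>w. (\<zero>\<^bsub>V\<^esub>, w) \<in> \<Delta> \<Longrightarrow> w = \<zero>\<^bsub>W\<^esub>"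
    using linear_relation_contains_function[OF V W k \<Gamma> \<Gamma>0 sub f0] by auto
  have kR: "\<And>a. a \<in> k \<Longrightarrow> a \<in> carrier R" using subfield_facts(1)[OF k] by blast
  \<comment> \<open>The function is so far defined on the domain of \<open>\<Gamma>\<close>; choosing once more inside all of \<open>V \<times> W\<close> extends
    it to \<open>V\<close>.\<close>
  have full: "linear_relation k V W (carrier V \<times> carrier W)"
    by (auto simp: linear_relation_def lm_rules[OF V] lm_rules[OF W] kR)
  have "\<Delta> \<subseteq> carrier V \<times> carrier W" using \<Delta>(1) by (auto simp: linear_relation_def)
  then obtain F where F: "linear_relation k V W F" "\<Delta> \<subseteq> F" "Domain F = Domain (carrier V \<times> carrier W)"
    and fF: "\<And>w. (\<zero>\<^bsub>V\<^esub>, w) \<in> F \<Longrightarrow> w = \<zero>\<^bsub>W\<^esub>"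
    using linear_relation_contains_function[OF V W k full \<Delta>(1) _ f\<Delta>] by auto
  define f where "f v = (SOME w. (v, w) \<in> F)" for v
  have Dom: "Domain F = carrier V" using F(3) lm_zero_closed[OF W] by auto
  have fv: "(v, f v) \<in> F" if "v \<in> carrier V" for v
    using that Dom unfolding f_def by (metis DomainE someI_ex)
  have eq: "f v = w" if "(v, w) \<in> F" for v w
  proof -
    have "v \<in> carrier V" using that Dom by blast
    then show ?thesis using linear_relation_functional[OF V W k F(1) fF fv that] by blast
  qed
  show thesis
  proof (rule that)
    show "f \<in> linear_maps k V W"
    proof (rule linear_mapsI)
      show "f u \<in> carrier W" if "u \<in> carrier V" for u
        using fv[OF that] F(1) unfolding linear_relation_def by blast
      show "f (u \<oplus>\<^bsub>V\<^esub> v) = f u \<oplus>\<^bsub>W\<^esub> f v" if "u \<in> carrier V" "v \<in> carrier V" for u v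
        using fv[OF that(1)] fv[OF that(2)] F(1) eq unfolding linear_relation_def by blast
      show "f (a \<odot>\<^bsub>V\<^esub> u) = a \<odot>\<^bsub>W\<^esub> f u" if "a \<in> k" "u \<in> carrier V" for a u
        using fv[OF that(2)] that(1) F(1) eq unfolding linear_relation_def by blast
    qed
    show "(v, f v) \<in> \<Gamma>" if v: "v \<in> Domain \<Gamma>" for v
    proof -
      obtain w where "(v, w) \<in> \<Delta>" using v \<Delta>(4) by blast
      then show ?thesis using eq F(2) \<Delta>(3) by (metis in_mono)
    qed
    show "f v = w" if "(v, w) \<in> \<Gamma>0" for v w using that eq F(2) \<Delta>(2) by blast
  qed
qed

section \<open>Traces over a truncated polynomial algebra\<close>

definition regular_module :: "'r ring \<Rightarrow> ('r, 'r) module" where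
  "regular_module R = \<lparr> carrier = carrier R, monoid.mult = monoid.mult R, one = \<one>\<^bsub>R\<^esub>,
     ring.zero = \<zero>\<^bsub>R\<^esub>, ring.add = ring.add R, smult = monoid.mult R \<rparr>"

lemma regular_module_simps [simp]:
  "carrier (regular_module R) = carrier R" "\<zero>\<^bsub>regular_module R\<^esub> = \<zero>\<^bsub>R\<^esub>"
  "u \<oplus>\<^bsub>regular_module R\<^esub> v = u \<oplus>\<^bsub>R\<^esub> v" "a \<odot>\<^bsub>regular_module R\<^esub> u = a \<otimes>\<^bsub>R\<^esub> u"
  by (simp_all add: regular_module_def)

lemma left_module_regular:
  assumes "ring R" shows "left_module R (regular_module R)"
proof -
  interpret ring R by fact
  have "abelian_group (regular_module R)"
    by (rule abelian_groupI) (auto simp: a_ac intro!: bexI[of _ "\<ominus>\<^bsub>R\<^esub> _"] simp: l_neg)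
  then show ?thesis
    by (intro left_moduleI) (auto simp: ring_axioms l_distr r_distr m_assoc)
qed

text \<open>Modules made of pairs or of functions are brought into the universe \<open>'m\<close> along an injection \<open>j\<close>.\<close>

definition transport :: "('a \<Rightarrow> 'm) \<Rightarrow> ('r, 'a) module \<Rightarrow> ('r, 'm) module" where
  "transport j M = (let i = inv_into (carrier M) j in
    \<lparr> carrier = j ` carrier M, monoid.mult = (\<lambda>u v. u), one = j \<zero>\<^bsub>M\<^esub>,
      ring.zero = j \<zero>\<^bsub>M\<^esub>, ring.add = (\<lambda>u v. j (i u \<oplus>\<^bsub>M\<^esub> i v)), smult = (\<lambda>a u. j (a \<odot>\<^bsub>M\<^esub> i u)) \<rparr>)"

lemma transport_simps:
  "carrier (transport j M) = j ` carrier M" "\<zero>\<^bsub>transport j M\<^esub> = j \<zero>\<^bsub>M\<^esub>"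
  "u \<oplus>\<^bsub>transport j M\<^esub> v = j (inv_into (carrier M) j u \<oplus>\<^bsub>M\<^esub> inv_into (carrier M) j v)"
  "a \<odot>\<^bsub>transport j M\<^esub> u = j (a \<odot>\<^bsub>M\<^esub> inv_into (carrier M) j u)"
  by (simp_all add: transport_def Let_def)

lemma transport_isomorphic:
  assumes M: "left_module R M" and j: "inj_on j (carrier M)"
  shows "left_module R (transport j M)" "j \<in> lmod_hom R M (transport j M)"
    "inv_into (carrier M) j \<in> lmod_hom R (transport j M) M"
proof -
  interpret ring R using M by (simp add: left_module_def)
  have ag: "abelian_group (transport j M)"
  proof (rule abelian_groupI)
    fix u assume "u \<in> carrier (transport j M)"
    then obtain u' where u: "u' \<in> carrier M" "u = j u'" by (auto simp: transport_simps)
    show "\<exists>v\<in>carrier (transport j M). v \<oplus>\<^bsub>transport j M\<^esub> u = \<zero>\<^bsub>transport j M\<^esub>"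
      using u j by (intro bexI[of _ "j (\<ominus>\<^bsub>M\<^esub> u')"])
        (auto simp: transport_simps lm_rules[OF M] lm_add_comm[OF M] lm_add_neg[OF M])
  qed (use j in \<open>auto simp: transport_simps lm_rules[OF M] lm_add_comm[OF M] lm_add_lcomm[OF M]\<close>)
  show "left_module R (transport j M)"
    by (intro left_moduleI ring_axioms ag)
      (use j in \<open>auto simp: transport_simps lm_rules[OF M] lm_add_smult[OF M]\<close>)
  show "j \<in> lmod_hom R M (transport j M)"
    by (rule homI) (use j in \<open>auto simp: transport_simps lm_rules[OF M]\<close>)
  show "inv_into (carrier M) j \<in> lmod_hom R (transport j M) M"
    by (rule homI) (use j in \<open>auto simp: transport_simps lm_rules[OF M]\<close>)
qed

definition module_sum :: "('r, 'a) module \<Rightarrow> ('r, 'b) module \<Rightarrow> ('r, 'a \<times> 'b) module" where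
  "module_sum M N =
    \<lparr> carrier = carrier M \<times> carrier N, monoid.mult = (\<lambda>u v. u), one = (\<zero>\<^bsub>M\<^esub>, \<zero>\<^bsub>N\<^esub>),
      ring.zero = (\<zero>\<^bsub>M\<^esub>, \<zero>\<^bsub>N\<^esub>), ring.add = (\<lambda>u v. (fst u \<oplus>\<^bsub>M\<^esub> fst v, snd u \<oplus>\<^bsub>N\<^esub> snd v)),
      smult = (\<lambda>a u. (a \<odot>\<^bsub>M\<^esub> fst u, a \<odot>\<^bsub>N\<^esub> snd u)) \<rparr>"

lemma module_sum_simps [simp]:
  "carrier (module_sum M N) = carrier M \<times> carrier N" "\<zero>\<^bsub>module_sum M N\<^esub> = (\<zero>\<^bsub>M\<^esub>, \<zero>\<^bsub>N\<^esub>)"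
  "(u, u') \<oplus>\<^bsub>module_sum M N\<^esub> (v, v') = (u \<oplus>\<^bsub>M\<^esub> v, u' \<oplus>\<^bsub>N\<^esub> v')"
  "a \<odot>\<^bsub>module_sum M N\<^esub> (u, u') = (a \<odot>\<^bsub>M\<^esub> u, a \<odot>\<^bsub>N\<^esub> u')"
  by (simp_all add: module_sum_def)

lemma left_module_module_sum:
  assumes M: "left_module R M" and N: "left_module R N"
  shows "left_module R (module_sum M N)"
proof -
  interpret ring R using M by (simp add: left_module_def)
  have "abelian_group (module_sum M N)"
  proof (rule abelian_groupI)
    fix u assume "u \<in> carrier (module_sum M N)"
    then obtain a b where "u = (a, b)" "a \<in> carrier M" "b \<in> carrier N" by auto
    then show "\<exists>v\<in>carrier (module_sum M N). v \<oplus>\<^bsub>module_sum M N\<^esub> u = \<zero>\<^bsub>module_sum M N\<^esub>"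
      by (intro bexI[of _ "(\<ominus>\<^bsub>M\<^esub> a, \<ominus>\<^bsub>N\<^esub> b)"])
        (auto simp: lm_rules[OF M] lm_add_comm[OF M] lm_add_neg[OF M]
          lm_rules[OF N] lm_add_comm[OF N] lm_add_neg[OF N])
  qed (auto simp: lm_rules[OF M] lm_add_comm[OF M] lm_rules[OF N] lm_add_comm[OF N]
      lm_add_lcomm[OF M] lm_add_lcomm[OF N])
  then show ?thesis
    by (intro left_moduleI ring_axioms)
      (auto simp: lm_rules[OF M] lm_rules[OF N] lm_add_smult[OF M] lm_add_smult[OF N])
qed

text \<open>If \<open>z\<^sup>3 = 0\<close>, then \<open>z\<^sup>2L + zLz + Lz\<^sup>2\<close> commutes with \<open>z\<close>, for every linear \<open>L\<close>. It is a substitute for averaging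
  \<open>L\<close> over the powers of \<open>1 + z\<close>.\<close>

definition trace1 :: "('r, 'm) module \<Rightarrow> ('r, 'n) module \<Rightarrow> 'r \<Rightarrow> ('m \<Rightarrow> 'n) \<Rightarrow> 'm \<Rightarrow> 'n" where
  "trace1 M N z L u = z \<odot>\<^bsub>N\<^esub> (z \<odot>\<^bsub>N\<^esub> L u) \<oplus>\<^bsub>N\<^esub>
     (z \<odot>\<^bsub>N\<^esub> L (z \<odot>\<^bsub>M\<^esub> u) \<oplus>\<^bsub>N\<^esub> L (z \<odot>\<^bsub>M\<^esub> (z \<odot>\<^bsub>M\<^esub> u)))"

text \<open>The algebra \<open>k[x, y]/(x\<^sup>3, y\<^sup>3)\<close>. The form takes the coefficient of \<open>x\<^sup>2y\<^sup>2\<close>; together with generation by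
  \<open>x\<close> and \<open>y\<close> it replaces a basis.\<close>

locale truncated_algebra = cring R for R :: "'r ring" (structure) +
  fixes k :: "'r set" and x y :: 'r and form :: "'r \<Rightarrow> 'r"
  assumes k: "subfield k R"
    and x_closed: "x \<in> carrier R" and y_closed: "y \<in> carrier R"
    and x_cube: "x [^] (3::nat) = \<zero>" and y_cube: "y [^] (3::nat) = \<zero>"
    and generated: "\<And>S. \<lbrakk>k \<subseteq> S; S \<subseteq> carrier R; \<And>a b. a \<in> S \<Longrightarrow> b \<in> S \<Longrightarrow> a \<oplus> b \<in> S;
      \<And>a. a \<in> S \<Longrightarrow> x \<otimes> a \<in> S; \<And>a. a \<in> S \<Longrightarrow> y \<otimes> a \<in> S\<rbrakk> \<Longrightarrow> S = carrier R"
    and form_linear: "form \<in> linear_maps k (regular_module R) (regular_module R)"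
    and form_values: "\<And>a. a \<in> carrier R \<Longrightarrow> form a \<in> k"
    and form_monomial: "\<And>i j. i \<le> 2 \<Longrightarrow> j \<le> 2 \<Longrightarrow>
      form (x [^] (i::nat) \<otimes> y [^] (j::nat)) = (if i = 2 \<and> j = 2 then \<one> else \<zero>)"
begin

abbreviation mx :: "('r, 'm) module \<Rightarrow> 'm \<Rightarrow> 'm" where "mx M u \<equiv> x \<odot>\<^bsub>M\<^esub> u"
abbreviation my :: "('r, 'm) module \<Rightarrow> 'm \<Rightarrow> 'm" where "my M u \<equiv> y \<odot>\<^bsub>M\<^esub> u"

lemmas k_facts = subfield_facts[OF ring_axioms k]

lemma k_closed: "a \<in> k \<Longrightarrow> a \<in> carrier R" using k_facts(1) by blast

abbreviation "reg \<equiv> regular_module R"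

lemma lm_reg: "left_module R reg" by (rule left_module_regular) (rule ring_axioms)

lemma hom_linear: "f \<in> lmod_hom R M N \<Longrightarrow> f \<in> linear_maps k M N"
  using linear_maps_mono k_facts(1) unfolding lmod_hom_eq_linear_maps by blast

lemmas lcomm = lm_smult_lcomm[OF _ is_cring]

lemma cube_smult:
  assumes "left_module R M" "u \<in> carrier M"
  shows "mx M (mx M (mx M u)) = \<zero>\<^bsub>M\<^esub>" "my M (my M (my M u)) = \<zero>\<^bsub>M\<^esub>"
  using x_cube y_cube lm_mult_smult[OF assms(1) _ _ assms(2), symmetric]
    lm_zero_smult[OF assms(1) assms(2)]
  by (simp_all add: numeral_3_eq_3 x_closed y_closed m_assoc lm_smult_closed[OF assms(1)] assms(2)
      lm_mult_smult[OF assms(1), symmetric])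

lemma trace1_linear:
  assumes M: "left_module R M" and N: "left_module R N" and L: "L \<in> linear_maps k M N"
    and z: "z \<in> carrier R"
  shows "trace1 M N z L \<in> linear_maps k M N"
proof (rule linear_mapsI)
  note r = lm_rules[OF M] lm_rules[OF N] linear_maps_closed[OF L] linear_maps_add[OF L]
    linear_maps_smult[OF L] z k_closed lm_smult_lcomm[OF N is_cring] lm_add_comm[OF N] lm_add_lcomm[OF N]
  show "trace1 M N z L u \<in> carrier N" if "u \<in> carrier M" for u
    using that by (simp add: trace1_def r)
  show "trace1 M N z L (u \<oplus>\<^bsub>M\<^esub> v) = trace1 M N z L u \<oplus>\<^bsub>N\<^esub> trace1 M N z L v"
    if "u \<in> carrier M" "v \<in> carrier M" for u v
    using that by (simp add: trace1_def r)
  show "trace1 M N z L (a \<odot>\<^bsub>M\<^esub> u) = a \<odot>\<^bsub>N\<^esub> trace1 M N z L u" if "a \<in> k" "u \<in> carrier M" for a u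
  proof -
    have "z \<odot>\<^bsub>M\<^esub> (a \<odot>\<^bsub>M\<^esub> v) = a \<odot>\<^bsub>M\<^esub> (z \<odot>\<^bsub>M\<^esub> v)" if "v \<in> carrier M" for v
      using lcomm[OF M] that \<open>a \<in> k\<close> k_closed z by blast
    then show ?thesis using that by (simp add: trace1_def r)
  qed
qed

lemma trace1_commutes:
  assumes M: "left_module R M" and N: "left_module R N" and L: "L \<in> linear_maps k M N"
    and z: "z \<in> carrier R" and a: "a \<in> carrier R"
    and c: "\<And>u. u \<in> carrier M \<Longrightarrow> L (a \<odot>\<^bsub>M\<^esub> u) = a \<odot>\<^bsub>N\<^esub> L u" and u: "u \<in> carrier M"
  shows "trace1 M N z L (a \<odot>\<^bsub>M\<^esub> u) = a \<odot>\<^bsub>N\<^esub> trace1 M N z L u"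
proof -
  have "z \<odot>\<^bsub>M\<^esub> (a \<odot>\<^bsub>M\<^esub> v) = a \<odot>\<^bsub>M\<^esub> (z \<odot>\<^bsub>M\<^esub> v)" if "v \<in> carrier M" for v
    using lcomm[OF M] that a z by blast
  then show ?thesis using u
    by (simp add: trace1_def lm_rules[OF M] lm_rules[OF N] linear_maps_closed[OF L] c a z
        lm_smult_lcomm[OF N is_cring])
qed

lemma trace1_commutes_self:
  assumes M: "left_module R M" and N: "left_module R N" and L: "L \<in> linear_maps k M N"
    and z: "z = x \<or> z = y" and u: "u \<in> carrier M"
  shows "trace1 M N z L (z \<odot>\<^bsub>M\<^esub> u) = z \<odot>\<^bsub>N\<^esub> trace1 M N z L u"
  using z u
  by (auto simp: trace1_def lm_rules[OF M] lm_rules[OF N] linear_maps_closed[OF L]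
      linear_maps_zero[OF L M N] x_closed y_closed cube_smult[OF M] cube_smult[OF N])

lemma linear_hom:
  assumes M: "left_module R M" and N: "left_module R N" and L: "L \<in> linear_maps k M N"
    and cx: "\<And>u. u \<in> carrier M \<Longrightarrow> L (mx M u) = mx N (L u)"
    and cy: "\<And>u. u \<in> carrier M \<Longrightarrow> L (my M u) = my N (L u)"
  shows "L \<in> lmod_hom R M N"
proof -
  note r = lm_rules[OF M] lm_rules[OF N] linear_maps_closed[OF L] linear_maps_add[OF L] x_closed y_closed
  have "{a \<in> carrier R. \<forall>u\<in>carrier M. L (a \<odot>\<^bsub>M\<^esub> u) = a \<odot>\<^bsub>N\<^esub> L u} = carrier R"
    by (rule generated)
      (use linear_maps_smult[OF L] k_closed in \<open>auto simp: r lm_add_smult[OF M] lm_add_smult[OF N] cx cy\<close>)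
  then show ?thesis by (intro homI) (auto simp: r)
qed

text \<open>The sum of all \<open>x\<^sup>i y\<^sup>j L x\<^sup>2\<^sup>-\<^sup>i y\<^sup>2\<^sup>-\<^sup>j\<close>, the relative trace from \<open>k\<close> to \<open>R\<close> for the dual bases
  \<open>x\<^sup>iy\<^sup>j\<close> and \<open>x\<^sup>2\<^sup>-\<^sup>iy\<^sup>2\<^sup>-\<^sup>j\<close>.\<close>

definition Tr :: "('r, 'm) module \<Rightarrow> ('r, 'n) module \<Rightarrow> ('m \<Rightarrow> 'n) \<Rightarrow> 'm \<Rightarrow> 'n" where
  "Tr M N L = trace1 M N x (trace1 M N y L)"

lemma Tr_hom:
  assumes M: "left_module R M" and N: "left_module R N" and L: "L \<in> linear_maps k M N"
  shows "Tr M N L \<in> lmod_hom R M N"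
proof -
  have G: "trace1 M N y L \<in> linear_maps k M N" by (rule trace1_linear[OF M N L y_closed])
  show ?thesis unfolding Tr_def
    by (rule linear_hom[OF M N])
      (simp_all add: trace1_linear[OF M N G x_closed] trace1_commutes_self[OF M N G]
        trace1_commutes[OF M N G x_closed y_closed] trace1_commutes_self[OF M N L])
qed

lemma Tr_comp_left:
  assumes M: "left_module R M" and N: "left_module R N" and L: "L \<in> linear_maps k M N"
    and g: "g \<in> lmod_hom R N Q" and u: "u \<in> carrier M"
  shows "g (Tr M N L u) = Tr M Q (g \<circ> L) u"
  using u by (simp add: Tr_def trace1_def lm_smult_closed[OF M] lm_smult_closed[OF N]
      lm_add_closed[OF N] linear_maps_closed[OF L] x_closed y_closed hom_add[OF g] hom_smult[OF g])

lemma Tr_comp_right: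
  assumes M: "left_module R M" and g: "g \<in> lmod_hom R M N" and u: "u \<in> carrier M"
  shows "Tr N Q L (g u) = Tr M Q (L \<circ> g) u"
  using u by (simp add: Tr_def trace1_def lm_rules[OF M] x_closed y_closed hom_smult[OF g, symmetric])

text \<open>This will turn out to be stable vanishing (\<open>stably_zero_iff_traced\<close>), in a form that can be computed
  with elementwise.\<close>

definition traced :: "('r, 'm) module \<Rightarrow> ('r, 'n) module \<Rightarrow> ('m \<Rightarrow> 'n) \<Rightarrow> bool" where
  "traced M N f \<longleftrightarrow> (\<exists>L\<in>linear_maps k M N. \<forall>u\<in>carrier M. f u = Tr M N L u)"

lemma traced_cong: "traced M N f \<Longrightarrow> (\<And>u. u \<in> carrier M \<Longrightarrow> g u = f u) \<Longrightarrow> traced M N g"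
  unfolding traced_def by metis

lemma traced_comp_left:
  assumes "left_module R M" "left_module R N" "traced M N f" "g \<in> lmod_hom R N Q"
  shows "traced M Q (g \<circ> f)"
proof -
  from assms(3) obtain L where L: "L \<in> linear_maps k M N" "\<And>u. u \<in> carrier M \<Longrightarrow> f u = Tr M N L u"
    unfolding traced_def by blast
  have "g \<circ> L \<in> linear_maps k M Q" using linear_maps_comp[OF L(1) hom_linear[OF assms(4)]] .
  moreover have "\<forall>u\<in>carrier M. (g \<circ> f) u = Tr M Q (g \<circ> L) u"
    by (simp add: L(2) Tr_comp_left[OF assms(1,2) L(1) assms(4)])
  ultimately show ?thesis unfolding traced_def by blast
qed

lemma traced_comp_right:
  assumes "left_module R M" "traced N Q f" "g \<in> lmod_hom R M N"
  shows "traced M Q (f \<circ> g)"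
proof -
  from assms(2) obtain L where L: "L \<in> linear_maps k N Q" "\<And>u. u \<in> carrier N \<Longrightarrow> f u = Tr N Q L u"
    unfolding traced_def by blast
  have "L \<circ> g \<in> linear_maps k M Q" using linear_maps_comp[OF hom_linear[OF assms(3)] L(1)] .
  moreover have "\<forall>u\<in>carrier M. (f \<circ> g) u = Tr M Q (L \<circ> g) u"
    by (simp add: L(2) Tr_comp_right[OF assms(1,3)] hom_closed[OF assms(3)])
  ultimately show ?thesis unfolding traced_def by blast
qed

lemma traced_add:
  assumes M: "left_module R M" and N: "left_module R N" and f: "traced M N f" and g: "traced M N g"
  shows "traced M N (\<lambda>u. f u \<oplus>\<^bsub>N\<^esub> g u)"
proof -
  from f obtain L where L: "L \<in> linear_maps k M N" "\<And>u. u \<in> carrier M \<Longrightarrow> f u = Tr M N L u"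
    unfolding traced_def by blast
  from g obtain L' where L': "L' \<in> linear_maps k M N" "\<And>u. u \<in> carrier M \<Longrightarrow> g u = Tr M N L' u"
    unfolding traced_def by blast
  note r = lm_rules[OF M] lm_rules[OF N] linear_maps_closed[OF L(1)] linear_maps_closed[OF L'(1)]
    linear_maps_add[OF L(1)] linear_maps_add[OF L'(1)] linear_maps_smult[OF L(1)] linear_maps_smult[OF L'(1)]
    lm_add_comm[OF N] lm_add_lcomm[OF N] x_closed y_closed k_closed
  have "(\<lambda>u. L u \<oplus>\<^bsub>N\<^esub> L' u) \<in> linear_maps k M N"
    by (rule linear_mapsI) (simp_all add: r)
  moreover have "\<forall>u\<in>carrier M. f u \<oplus>\<^bsub>N\<^esub> g u = Tr M N (\<lambda>u. L u \<oplus>\<^bsub>N\<^esub> L' u) u"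
    by (simp add: L(2) L'(2) Tr_def trace1_def r)
  ultimately show ?thesis unfolding traced_def by blast
qed

lemma traced_zero:
  assumes M: "left_module R M" and N: "left_module R N"
  shows "traced M N (\<lambda>u. \<zero>\<^bsub>N\<^esub>)"
proof -
  have "(\<lambda>u. \<zero>\<^bsub>N\<^esub>) \<in> linear_maps k M N" by (rule linear_mapsI) (simp_all add: lm_rules[OF N] k_closed)
  moreover have "\<forall>u\<in>carrier M. \<zero>\<^bsub>N\<^esub> = Tr M N (\<lambda>u. \<zero>\<^bsub>N\<^esub>) u"
    by (simp add: Tr_def trace1_def lm_rules[OF N] x_closed y_closed)
  ultimately show ?thesis unfolding traced_def by blast
qed

lemma form_values9:
  shows "form \<one> = \<zero>" "form x = \<zero>" "form y = \<zero>" "form (x \<otimes> x) = \<zero>" "form (x \<otimes> y) = \<zero>"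
    "form (y \<otimes> y) = \<zero>" "form (x \<otimes> (x \<otimes> y)) = \<zero>" "form (x \<otimes> (y \<otimes> y)) = \<zero>"
    "form (x \<otimes> (x \<otimes> (y \<otimes> y))) = \<one>"
  using form_monomial[of 0 0] form_monomial[of 1 0] form_monomial[of 2 0] form_monomial[of 0 1]
      form_monomial[of 1 1] form_monomial[of 2 1] form_monomial[of 0 2] form_monomial[of 1 2]
      form_monomial[of 2 2]
  by (simp_all add: numeral_2_eq_2 m_assoc x_closed y_closed)

text \<open>A trace is \<open>R\<close>-linear and thus determined by its value at 1, where the form leaves the summand with
  \<open>i = j = 0\<close> only. This is the expansion of \<open>s\<close> in the dual bases.\<close>

lemma Tr_form:
  assumes s: "s \<in> carrier R"
  shows "Tr reg reg form s = s"
proof -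
  note lr = lm_reg
  have h: "Tr reg reg form \<in> lmod_hom R reg reg" by (rule Tr_hom[OF lr lr form_linear])
  have "Tr reg reg form \<one> = \<one>"
    by (simp add: Tr_def trace1_def x_closed y_closed m_lcomm[of y x] m_comm[of y x] form_values9)
  then show ?thesis using hom_smult[OF h, of s \<one>] s by simp
qed

lemma traced_id_regular: "traced reg reg id"
  unfolding traced_def
  by (rule bexI[OF _ form_linear]) (simp add: Tr_form)

lemma traced_id_module_sum:
  assumes M: "left_module R M" and N: "left_module R N" and f: "traced M M id" and g: "traced N N id"
  shows "traced (module_sum M N) (module_sum M N) id"
proof -
  let ?D = "module_sum M N"
  have D: "left_module R ?D" by (rule left_module_module_sum[OF M N])
  have h: "fst \<in> lmod_hom R ?D M" "snd \<in> lmod_hom R ?D N"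
    "(\<lambda>u. (u, \<zero>\<^bsub>N\<^esub>)) \<in> lmod_hom R M ?D" "(\<lambda>u. (\<zero>\<^bsub>M\<^esub>, u)) \<in> lmod_hom R N ?D"
    by (rule homI; auto simp: lm_rules[OF M] lm_rules[OF N])+
  have "traced ?D ?D (\<lambda>u. ((\<lambda>u. (u, \<zero>\<^bsub>N\<^esub>)) \<circ> (id \<circ> fst)) u \<oplus>\<^bsub>?D\<^esub> ((\<lambda>u. (\<zero>\<^bsub>M\<^esub>, u)) \<circ> (id \<circ> snd)) u)"
    by (intro traced_add traced_comp_left[OF D M] traced_comp_left[OF D N] D h
        traced_comp_right[OF D f h(1)] traced_comp_right[OF D g h(2)])
  then show ?thesis
    by (rule traced_cong) (auto simp: lm_rules[OF M] lm_rules[OF N])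
qed

lemma traced_id_transport:
  assumes M: "left_module R M" and f: "traced M M id" and j: "inj_on j (carrier M)"
  shows "traced (transport j M) (transport j M) id"
proof -
  note t = transport_isomorphic[OF M j]
  have "traced (transport j M) (transport j M) (j \<circ> (id \<circ> inv_into (carrier M) j))"
    by (rule traced_comp_left[OF t(1) M traced_comp_right[OF t(1) f t(3)] t(2)])
  then show ?thesis
    by (rule traced_cong) (auto simp: transport_simps j)
qed

lemma linear_section:
  assumes M: "left_module R M" and N: "left_module R N" and p: "p \<in> linear_maps k M N"
  obtains s where "s \<in> linear_maps k N M" "\<And>v. v \<in> p ` carrier M \<Longrightarrow> p (s v) = v"
proof -
  let ?G = "{(p u, u) | u. u \<in> carrier M}" and ?Z = "{(\<zero>\<^bsub>N\<^esub>, \<zero>\<^bsub>M\<^esub>)}"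
  have G: "linear_relation k N M ?G"
    using linear_maps_zero[OF p M N, symmetric]
    by (auto simp: linear_relation_def linear_maps_closed[OF p] linear_maps_add[OF p, symmetric]
        linear_maps_smult[OF p, symmetric] lm_rules[OF M] k_closed)
  have Z: "linear_relation k N M ?Z"
    by (auto simp: linear_relation_def lm_rules[OF M] lm_rules[OF N] k_closed)
  have sub: "?Z \<subseteq> ?G" using linear_maps_zero[OF p M N, symmetric] lm_zero_closed[OF M] by auto
  obtain s where s: "s \<in> linear_maps k N M" "\<And>v. v \<in> Domain ?G \<Longrightarrow> (v, s v) \<in> ?G"
    by (rule linear_selection[OF N M ring_axioms k G Z sub]) auto
  have "p (s v) = v" if v: "v \<in> p ` carrier M" for v
  proof -
    have "v \<in> Domain ?G" using v by auto
    from s(2)[OF this] show ?thesis by auto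
  qed
  with s(1) show thesis using that by blast
qed

lemma linear_retraction:
  assumes M: "left_module R M" and N: "left_module R N" and i: "i \<in> linear_maps k M N"
    and inj: "inj_on i (carrier M)"
  obtains r where "r \<in> linear_maps k N M" "\<And>u. u \<in> carrier M \<Longrightarrow> r (i u) = u"
proof -
  obtain r where r: "r \<in> linear_maps k N M" "\<And>v. v \<in> i ` carrier M \<Longrightarrow> i (r v) = v"
    using linear_section[OF M N i] by blast
  have "r (i u) = u" if "u \<in> carrier M" for u
    using inj r(2)[of "i u"] that linear_maps_closed[OF r(1)] linear_maps_closed[OF i]
    by (meson imageI inj_onD)
  then show thesis using that r(1) by blast
qed

text \<open>One half of Higman's criterion: lift \<open>f\<close> through \<open>p\<close> by a \<open>k\<close>-linear section, which linear algebra
  provides, and take the trace of the result with \<open>L\<close> inserted.\<close>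

lemma traced_id_projective:
  assumes P: "left_module R P" and t: "traced P P id"
  shows "projective R P"
  unfolding projective_def
proof (intro conjI allI impI)
  show "left_module R P" by fact
  fix M N p f
  assume M: "left_module R M" and N: "left_module R N" and p: "p \<in> lmod_hom R M N"
    and surj: "p ` carrier M = carrier N" and f: "f \<in> lmod_hom R P N"
  obtain s where s: "s \<in> linear_maps k N M" "\<And>v. v \<in> p ` carrier M \<Longrightarrow> p (s v) = v"
    using linear_section[OF M N hom_linear[OF p]] by blast
  obtain L where L: "L \<in> linear_maps k P P" "\<And>u. u \<in> carrier P \<Longrightarrow> u = Tr P P L u"
    using t unfolding traced_def by auto
  have sfL: "s \<circ> (f \<circ> L) \<in> linear_maps k P M"
    by (rule linear_maps_comp[OF linear_maps_comp[OF L(1) hom_linear[OF f]] s(1)])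
  show "\<exists>h\<in>lmod_hom R P M. \<forall>u\<in>carrier P. p (h u) = f u"
  proof (intro bexI ballI)
    show "Tr P M (s \<circ> (f \<circ> L)) \<in> lmod_hom R P M" by (rule Tr_hom[OF P M sfL])
    fix u assume u: "u \<in> carrier P"
    have e: "p (s (f (L v))) = f (L v)" if "v \<in> carrier P" for v
      using s(2) surj hom_closed[OF f] linear_maps_closed[OF L(1)] that by simp
    have "p (Tr P M (s \<circ> (f \<circ> L)) u) = Tr P N (p \<circ> (s \<circ> (f \<circ> L))) u"
      by (rule Tr_comp_left[OF P M sfL p u])
    also have "\<dots> = Tr P N (f \<circ> L) u"
      using u by (simp add: Tr_def trace1_def e lm_rules[OF P] x_closed y_closed)
    also have "\<dots> = f (Tr P P L u)" by (rule Tr_comp_left[OF P P L(1) f u, symmetric])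
    finally show "p (Tr P M (s \<circ> (f \<circ> L)) u) = f u" using L(2)[OF u] by simp
  qed
qed

end

section \<open>Quotients and coinduced modules\<close>

lemma infinite_pairs_injection:
  assumes "infinite (UNIV :: 'm set)"
  obtains pr :: "'m \<times> 'm \<Rightarrow> 'm" where "inj pr"
proof -
  have "|UNIV \<times> UNIV :: ('m \<times> 'm) set| \<le>o |UNIV :: 'm set|"
    using card_of_Times_same_infinite[OF assms] by (rule ordIso_imp_ordLeq)
  then show thesis using that unfolding card_of_ordLeq[symmetric] by auto
qed

lemma infinite_tuples_injection:
  assumes inf: "infinite (UNIV :: 'm set)" and I: "finite I"
  shows "\<exists>e :: ('i \<Rightarrow> 'm) \<Rightarrow> 'm. inj_on e (extensional I)"
  using I
proof (induction I rule: finite_induct)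
  case empty
  then show ?case by (auto simp: inj_on_def)
next
  case (insert i I)
  then obtain e :: "('i \<Rightarrow> 'm) \<Rightarrow> 'm" where e: "inj_on e (extensional I)" by blast
  obtain pr :: "'m \<times> 'm \<Rightarrow> 'm" where pr: "inj pr" using infinite_pairs_injection[OF inf] .
  have "inj_on (\<lambda>f. pr (f i, e (restrict f I))) (extensional (insert i I))"
  proof (rule inj_onI)
    fix f g assume f: "f \<in> extensional (insert i I)" and g: "g \<in> extensional (insert i I)"
      and "pr (f i, e (restrict f I)) = pr (g i, e (restrict g I))"
    then have i: "f i = g i" and "e (restrict f I) = e (restrict g I)"
      using pr by (auto dest: injD)
    then have r: "restrict f I = restrict g I" using e by (auto dest: inj_onD)
    have "f j = g j" if "j \<in> I" for j using fun_cong[OF r, of j] that by simp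
    then show "f = g" using i f g by (intro extensionalityI[OF f g]) auto
  qed
  then show ?case by blast
qed

text \<open>Cosets are replaced by chosen representatives, which keeps the quotient in the type of \<open>M\<close>.\<close>

lemma quotient_module:
  fixes M :: "('r, 'm) module"
  assumes M: "left_module R M" and S: "S \<subseteq> carrier M" "\<zero>\<^bsub>M\<^esub> \<in> S"
    and S_add: "\<And>u v. u \<in> S \<Longrightarrow> v \<in> S \<Longrightarrow> u \<oplus>\<^bsub>M\<^esub> v \<in> S"
    and S_smult: "\<And>a u. a \<in> carrier R \<Longrightarrow> u \<in> S \<Longrightarrow> a \<odot>\<^bsub>M\<^esub> u \<in> S"
  obtains Q :: "('r, 'm) module" and q where "left_module R Q" "q \<in> lmod_hom R M Q"
    "q ` carrier M = carrier Q" "\<And>u. u \<in> carrier M \<Longrightarrow> q u = \<zero>\<^bsub>Q\<^esub> \<longleftrightarrow> u \<in> S"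
proof -
  interpret R: ring R using M by (simp add: left_module_def)
  have S_neg: "\<ominus>\<^bsub>M\<^esub> u \<in> S" if "u \<in> S" for u
    using S_smult[of "\<ominus>\<^bsub>R\<^esub> \<one>\<^bsub>R\<^esub>" u] that S(1)
    by (simp add: lm_neg_smult[OF M] lm_one_smult[OF M] subset_iff)
  note r = lm_rules[OF M]
  define q where "q u = (SOME v. v \<in> carrier M \<and> u \<ominus>\<^bsub>M\<^esub> v \<in> S)" for u
  have q: "q u \<in> carrier M" "u \<ominus>\<^bsub>M\<^esub> q u \<in> S" if "u \<in> carrier M" for u
    using someI[of "\<lambda>v. v \<in> carrier M \<and> u \<ominus>\<^bsub>M\<^esub> v \<in> S" u] that S(2)
    by (auto simp: q_def r)
  have trans: "u \<ominus>\<^bsub>M\<^esub> w \<in> S" if "u \<ominus>\<^bsub>M\<^esub> v \<in> S" "v \<ominus>\<^bsub>M\<^esub> w \<in> S"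
    "u \<in> carrier M" "v \<in> carrier M" "w \<in> carrier M" for u v w
  proof -
    have "u \<ominus>\<^bsub>M\<^esub> w = (u \<ominus>\<^bsub>M\<^esub> v) \<oplus>\<^bsub>M\<^esub> (v \<ominus>\<^bsub>M\<^esub> w)"
      using that(3-5) by (simp add: lm_minus_eq_iff[OF M] r lm_minus_add_cancel[OF M])
    then show ?thesis using S_add that by simp
  qed
  have sym: "v \<ominus>\<^bsub>M\<^esub> u \<in> S" if "u \<ominus>\<^bsub>M\<^esub> v \<in> S" "u \<in> carrier M" "v \<in> carrier M" for u v
  proof -
    have "v \<ominus>\<^bsub>M\<^esub> u = \<ominus>\<^bsub>M\<^esub> (u \<ominus>\<^bsub>M\<^esub> v)"
      using that by (simp add: lm_minus_def[OF M] r abelian_group.minus_add[OF lm_abelian[OF M]]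
        abelian_group.minus_minus[OF lm_abelian[OF M]] lm_add_comm[OF M])
    then show ?thesis using S_neg that by simp
  qed
  have q_eq: "q u = q v \<longleftrightarrow> u \<ominus>\<^bsub>M\<^esub> v \<in> S" if u: "u \<in> carrier M" and v: "v \<in> carrier M" for u v
  proof
    assume "q u = q v"
    then show "u \<ominus>\<^bsub>M\<^esub> v \<in> S" using trans[OF q(2)[OF u] _ u q(1)[OF u] v] sym[OF q(2)[OF v] v q(1)[OF v]] by simp
  next
    assume uv: "u \<ominus>\<^bsub>M\<^esub> v \<in> S"
    have "(\<lambda>w. w \<in> carrier M \<and> u \<ominus>\<^bsub>M\<^esub> w \<in> S) = (\<lambda>w. w \<in> carrier M \<and> v \<ominus>\<^bsub>M\<^esub> w \<in> S)"
      using trans[OF uv _ u v] trans[OF sym[OF uv u v] _ v u] by blast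
    then show "q u = q v" by (simp add: q_def)
  qed
  have qq: "q (q u) = q u" if "u \<in> carrier M" for u
    using q_eq[OF q(1)[OF that] that] sym[OF q(2)[OF that] that q(1)[OF that]] by simp
  have q_add: "q (q u \<oplus>\<^bsub>M\<^esub> v) = q (u \<oplus>\<^bsub>M\<^esub> v)" if u: "u \<in> carrier M" and v: "v \<in> carrier M" for u v
  proof -
    have "(q u \<oplus>\<^bsub>M\<^esub> v) \<ominus>\<^bsub>M\<^esub> (u \<oplus>\<^bsub>M\<^esub> v) = q u \<ominus>\<^bsub>M\<^esub> u"
      using u v q(1)[OF u] by (simp add: lm_add_minus_add[OF M] r)
    then show ?thesis using q_eq[of "q u \<oplus>\<^bsub>M\<^esub> v" "u \<oplus>\<^bsub>M\<^esub> v"] u v q(1)[OF u]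
        sym[OF q(2)[OF u] u q(1)[OF u]] by (simp add: r)
  qed
  have q_add': "q (v \<oplus>\<^bsub>M\<^esub> q u) = q (v \<oplus>\<^bsub>M\<^esub> u)" if "u \<in> carrier M" "v \<in> carrier M" for u v
    using q_add[OF that] that q(1) by (simp add: lm_add_comm[OF M])
  have q_add'': "q (v \<oplus>\<^bsub>M\<^esub> (w \<oplus>\<^bsub>M\<^esub> q u)) = q (v \<oplus>\<^bsub>M\<^esub> (w \<oplus>\<^bsub>M\<^esub> u))"
    if "u \<in> carrier M" "v \<in> carrier M" "w \<in> carrier M" for u v w
    using q_add'[of u "v \<oplus>\<^bsub>M\<^esub> w"] that q(1) by (simp add: r)
  have q_smult: "q (a \<odot>\<^bsub>M\<^esub> q u) = q (a \<odot>\<^bsub>M\<^esub> u)" if u: "u \<in> carrier M" and a: "a \<in> carrier R" for u a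
    using q_eq[of "a \<odot>\<^bsub>M\<^esub> q u" "a \<odot>\<^bsub>M\<^esub> u"] u a q(1)[OF u] S_smult[OF a sym[OF q(2)[OF u] u q(1)[OF u]]]
    by (simp add: r lm_smult_minus[OF M])
  have q_smult_add: "q (a \<odot>\<^bsub>M\<^esub> q u \<oplus>\<^bsub>M\<^esub> b \<odot>\<^bsub>M\<^esub> q u) = q (a \<odot>\<^bsub>M\<^esub> u \<oplus>\<^bsub>M\<^esub> b \<odot>\<^bsub>M\<^esub> u)"
    if "u \<in> carrier M" "a \<in> carrier R" "b \<in> carrier R" for u a b
    using q_smult[of u "a \<oplus>\<^bsub>R\<^esub> b"] that q(1) by (simp add: lm_add_smult[OF M])
  have q_smult_smult: "q (a \<odot>\<^bsub>M\<^esub> (b \<odot>\<^bsub>M\<^esub> q u)) = q (a \<odot>\<^bsub>M\<^esub> (b \<odot>\<^bsub>M\<^esub> u))"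
    if "u \<in> carrier M" "a \<in> carrier R" "b \<in> carrier R" for u a b
    using q_smult[of u "a \<otimes>\<^bsub>R\<^esub> b"] that q(1) by (simp add: r)
  define Q :: "('r, 'm) module" where "Q = \<lparr> carrier = q ` carrier M, monoid.mult = (\<lambda>u v. u), one = q \<zero>\<^bsub>M\<^esub>,
      ring.zero = q \<zero>\<^bsub>M\<^esub>, ring.add = (\<lambda>u v. q (u \<oplus>\<^bsub>M\<^esub> v)), smult = (\<lambda>a u. q (a \<odot>\<^bsub>M\<^esub> u)) \<rparr>"
  have Q: "carrier Q = q ` carrier M" "\<zero>\<^bsub>Q\<^esub> = q \<zero>\<^bsub>M\<^esub>" "u \<oplus>\<^bsub>Q\<^esub> v = q (u \<oplus>\<^bsub>M\<^esub> v)"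
    "a \<odot>\<^bsub>Q\<^esub> u = q (a \<odot>\<^bsub>M\<^esub> u)" for u v a
    by (simp_all add: Q_def)
  have ag: "abelian_group Q"
  proof (rule abelian_groupI)
    fix u assume "u \<in> carrier Q"
    then obtain u' where u: "u' \<in> carrier M" "u = q u'" by (auto simp: Q)
    show "\<exists>v\<in>carrier Q. v \<oplus>\<^bsub>Q\<^esub> u = \<zero>\<^bsub>Q\<^esub>"
      by (rule bexI[of _ "q (\<ominus>\<^bsub>M\<^esub> u')"])
        (simp_all add: Q u q q_add q_add' r lm_add_comm[OF M] lm_add_neg[OF M])
  qed (auto simp: Q q q_add q_add' q_add'' r lm_add_comm[OF M] lm_add_lcomm[OF M] qq)
  show thesis
  proof (rule that[of Q q])
    show "left_module R Q"
      by (intro left_moduleI R.ring_axioms ag)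
        (auto simp: Q q q_add q_add' q_smult q_smult_add q_smult_smult r lm_add_smult[OF M] qq)
    show "q \<in> lmod_hom R M Q" by (rule homI) (simp_all add: Q q_add q_add' q_smult q r)
    show "q ` carrier M = carrier Q" by (simp add: Q)
    show "q u = \<zero>\<^bsub>Q\<^esub> \<longleftrightarrow> u \<in> S" if "u \<in> carrier M" for u
      using q_eq[of u "\<zero>\<^bsub>M\<^esub>"] that by (simp add: Q r)
  qed
qed

lemma factor_through_surjection:
  assumes P: "left_module R P" and L: "left_module R L" and N: "left_module R N"
    and q: "q \<in> lmod_hom R P L" "q ` carrier P = carrier L"
    and f: "f \<in> lmod_hom R P N" and ker: "\<And>u. u \<in> carrier P \<Longrightarrow> q u = \<zero>\<^bsub>L\<^esub> \<Longrightarrow> f u = \<zero>\<^bsub>N\<^esub>"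
  obtains t where "t \<in> lmod_hom R L N" "\<And>u. u \<in> carrier P \<Longrightarrow> t (q u) = f u"
proof -
  define t where "t v = f (SOME u. u \<in> carrier P \<and> q u = v)" for v
  have tq: "t (q u) = f u" if u: "u \<in> carrier P" for u
  proof -
    define w where "w = (SOME w. w \<in> carrier P \<and> q w = q u)"
    have w: "w \<in> carrier P" "q w = q u"
      using someI[of "\<lambda>w. w \<in> carrier P \<and> q w = q u" u] u by (auto simp: w_def)
    have "q (w \<ominus>\<^bsub>P\<^esub> u) = \<zero>\<^bsub>L\<^esub>"
      by (simp add: hom_minus[OF q(1) P L w(1) u] w lm_minus_self[OF L] hom_closed[OF q(1)] u)
    then have "f w \<ominus>\<^bsub>N\<^esub> f u = \<zero>\<^bsub>N\<^esub>"
      using ker[of "w \<ominus>\<^bsub>P\<^esub> u"] w u by (simp add: hom_minus[OF f P N w(1) u] lm_rules[OF P])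
    then have "f w = f u" using lm_minus_eq_zero[OF N] hom_closed[OF f] w(1) u by blast
    then show ?thesis by (simp add: t_def w_def)
  qed
  have "t \<in> lmod_hom R L N"
  proof (rule homI)
    fix v assume "v \<in> carrier L"
    then obtain u where u: "u \<in> carrier P" "v = q u" using q(2) by blast
    then show "t v \<in> carrier N" by (simp add: tq hom_closed[OF f])
    show "t (a \<odot>\<^bsub>L\<^esub> v) = a \<odot>\<^bsub>N\<^esub> t v" if "a \<in> carrier R" for a
      using u that tq[of "a \<odot>\<^bsub>P\<^esub> u"]
      by (simp add: hom_smult[OF q(1)] tq lm_rules[OF P] hom_smult[OF f])
    fix w assume "w \<in> carrier L"
    then obtain w' where w: "w' \<in> carrier P" "w = q w'" using q(2) by blast
    show "t (v \<oplus>\<^bsub>L\<^esub> w) = t v \<oplus>\<^bsub>N\<^esub> t w"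
      using u w tq[of "u \<oplus>\<^bsub>P\<^esub> w'"]
      by (simp add: hom_add[OF q(1)] tq lm_rules[OF P] hom_add[OF f])
  qed
  with tq show thesis using that by blast
qed

lemma left_module_submodule:
  assumes M: "left_module R M" and S: "S \<subseteq> carrier M" "\<zero>\<^bsub>M\<^esub> \<in> S"
    and S_add: "\<And>u v. u \<in> S \<Longrightarrow> v \<in> S \<Longrightarrow> u \<oplus>\<^bsub>M\<^esub> v \<in> S"
    and S_smult: "\<And>a u. a \<in> carrier R \<Longrightarrow> u \<in> S \<Longrightarrow> a \<odot>\<^bsub>M\<^esub> u \<in> S"
  shows "left_module R (M\<lparr>carrier := S\<rparr>)"
proof -
  interpret R: ring R using M by (simp add: left_module_def)
  have S_neg: "\<ominus>\<^bsub>M\<^esub> u \<in> S" if "u \<in> S" for u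
    using S_smult[of "\<ominus>\<^bsub>R\<^esub> \<one>\<^bsub>R\<^esub>" u] that S(1)
    by (simp add: lm_neg_smult[OF M] lm_one_smult[OF M] subset_iff)
  have c: "u \<in> carrier M" if "u \<in> S" for u using that S(1) by blast
  have "abelian_group (M\<lparr>carrier := S\<rparr>)"
  proof (rule abelian_groupI)
    show "\<exists>v\<in>carrier (M\<lparr>carrier := S\<rparr>). v \<oplus>\<^bsub>M\<lparr>carrier := S\<rparr>\<^esub> u = \<zero>\<^bsub>M\<lparr>carrier := S\<rparr>\<^esub>"
      if "u \<in> carrier (M\<lparr>carrier := S\<rparr>)" for u
      using that by (intro bexI[of _ "\<ominus>\<^bsub>M\<^esub> u"]) (simp_all add: S_neg c lm_rules[OF M] lm_add_comm[OF M] lm_add_neg[OF M])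
  qed (auto simp: S S_add c lm_rules[OF M] lm_add_comm[OF M] lm_add_lcomm[OF M])
  then show ?thesis
    by (intro left_moduleI R.ring_axioms) (auto simp: S_smult c lm_rules[OF M] lm_add_smult[OF M])
qed

context truncated_algebra
begin

text \<open>The module of \<open>k\<close>-linear maps from \<open>R\<close> to \<open>M\<close>, with \<open>R\<close> acting on the argument. Every trace with values
  in \<open>M\<close> factors through it.\<close>

definition coinduced :: "('r, 'm) module \<Rightarrow> ('r, 'r \<Rightarrow> 'm) module" where
  "coinduced M = \<lparr> carrier = extensional (carrier R) \<inter> linear_maps k reg M,
     monoid.mult = (\<lambda>u v. u), one = (\<lambda>s\<in>carrier R. \<zero>\<^bsub>M\<^esub>),
     ring.zero = (\<lambda>s\<in>carrier R. \<zero>\<^bsub>M\<^esub>), ring.add = (\<lambda>u v. \<lambda>s\<in>carrier R. u s \<oplus>\<^bsub>M\<^esub> v s),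
     smult = (\<lambda>a u. \<lambda>s\<in>carrier R. u (s \<otimes> a)) \<rparr>"

lemma coinduced_simps:
  "carrier (coinduced M) = extensional (carrier R) \<inter> linear_maps k reg M"
  "\<zero>\<^bsub>coinduced M\<^esub> = (\<lambda>s\<in>carrier R. \<zero>\<^bsub>M\<^esub>)"
  "u \<oplus>\<^bsub>coinduced M\<^esub> v = (\<lambda>s\<in>carrier R. u s \<oplus>\<^bsub>M\<^esub> v s)"
  "a \<odot>\<^bsub>coinduced M\<^esub> u = (\<lambda>s\<in>carrier R. u (s \<otimes> a))"
  by (simp_all add: coinduced_def)

lemma coinduced_eqI:
  assumes "u \<in> carrier (coinduced M)" "v \<in> carrier (coinduced M)"
    "\<And>s. s \<in> carrier R \<Longrightarrow> u s = v s"
  shows "u = v"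
  using assms by (intro extensionalityI[of u "carrier R" v]) (auto simp: coinduced_simps)

lemma left_module_coinduced:
  assumes M: "left_module R M"
  shows "left_module R (coinduced M)"
proof -
  let ?F = "coinduced M"
  note r = lm_rules[OF M] k_closed lm_add_comm[OF M] lm_add_lcomm[OF M]
  have L: "u \<in> linear_maps k reg M" if "u \<in> carrier ?F" for u using that by (simp add: coinduced_simps)
  have c: "u s \<in> carrier M" if "u \<in> carrier ?F" "s \<in> carrier R" for u s
    using linear_maps_closed[OF L[OF that(1)]] that(2) by simp
  have a: "u (s \<oplus> t) = u s \<oplus>\<^bsub>M\<^esub> u t" if "u \<in> carrier ?F" "s \<in> carrier R" "t \<in> carrier R" for u s t
    using linear_maps_add[OF L[OF that(1)], of s t] that(2,3) by simp
  have sm: "u (b \<otimes> s) = b \<odot>\<^bsub>M\<^esub> u s" if "u \<in> carrier ?F" "s \<in> carrier R" "b \<in> k" for u s b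
    using linear_maps_smult[OF L[OF that(1)] that(3), of s] that(2) by simp
  have sm': "u (b \<otimes> s \<otimes> t) = b \<odot>\<^bsub>M\<^esub> u (s \<otimes> t)" if "u \<in> carrier ?F" "s \<in> carrier R" "t \<in> carrier R" "b \<in> k" for u s b t
    using sm[OF that(1) m_closed[OF that(2,3)] that(4)] that k_closed by (simp add: m_assoc)
  have add: "u \<oplus>\<^bsub>?F\<^esub> v \<in> carrier ?F" if "u \<in> carrier ?F" "v \<in> carrier ?F" for u v
    using that by (auto simp: coinduced_simps(1,3) r c a sm intro!: linear_mapsI)
  have smult: "b \<odot>\<^bsub>?F\<^esub> u \<in> carrier ?F" if "u \<in> carrier ?F" "b \<in> carrier R" for u b
    using that by (auto simp: coinduced_simps(1,4) r c a sm' l_distr intro!: linear_mapsI)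
  have zero: "\<zero>\<^bsub>?F\<^esub> \<in> carrier ?F"
    by (auto simp: coinduced_simps r intro!: linear_mapsI)
  have ag: "abelian_group ?F"
  proof (rule abelian_groupI)
    fix u assume u: "u \<in> carrier ?F"
    show "\<exists>v\<in>carrier ?F. v \<oplus>\<^bsub>?F\<^esub> u = \<zero>\<^bsub>?F\<^esub>"
    proof (rule bexI[of _ "(\<ominus> \<one>) \<odot>\<^bsub>?F\<^esub> u"])
      have m: "u (\<ominus> s) = \<ominus>\<^bsub>M\<^esub> (u s)" if "s \<in> carrier R" for s
        using sm[OF u that k_facts(4)[OF k_facts(3)]] that
        by (simp add: l_minus lm_neg_smult[OF M] lm_one_smult[OF M] c u)
      show "(\<ominus> \<one>) \<odot>\<^bsub>?F\<^esub> u \<oplus>\<^bsub>?F\<^esub> u = \<zero>\<^bsub>?F\<^esub>"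
        by (rule coinduced_eqI[where M = M])
          (simp_all add: add smult u zero, simp add: coinduced_simps(2-4) r_minus m c u lm_add_neg[OF M] r)
    qed (simp add: smult u)
    show "\<zero>\<^bsub>?F\<^esub> \<oplus>\<^bsub>?F\<^esub> u = u"
      by (rule coinduced_eqI[where M = M]) (simp_all add: add zero u, simp add: coinduced_simps(2-4) c u r)
    fix v assume v: "v \<in> carrier ?F"
    show "u \<oplus>\<^bsub>?F\<^esub> v = v \<oplus>\<^bsub>?F\<^esub> u"
      by (rule coinduced_eqI[where M = M]) (simp_all add: add v u, simp add: coinduced_simps(2-4) c u v r)
    fix w assume w: "w \<in> carrier ?F"
    show "(u \<oplus>\<^bsub>?F\<^esub> v) \<oplus>\<^bsub>?F\<^esub> w = u \<oplus>\<^bsub>?F\<^esub> (v \<oplus>\<^bsub>?F\<^esub> w)"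
      by (rule coinduced_eqI[where M = M]) (simp_all add: add v u w, simp add: coinduced_simps(2-4) c u v w r)
  qed (simp_all add: add zero)
  show ?thesis
  proof (intro left_moduleI ring_axioms ag)
    fix b u assume b: "b \<in> carrier R" and u: "u \<in> carrier ?F"
    show "b \<odot>\<^bsub>?F\<^esub> u \<in> carrier ?F" by (rule smult[OF u b])
    { fix d assume d: "d \<in> carrier R"
      show "(b \<oplus> d) \<odot>\<^bsub>?F\<^esub> u = b \<odot>\<^bsub>?F\<^esub> u \<oplus>\<^bsub>?F\<^esub> d \<odot>\<^bsub>?F\<^esub> u"
        by (rule coinduced_eqI[where M = M])
          (simp_all add: add smult u b d, simp add: coinduced_simps(2-4) c a u b d r_distr)
      show "(b \<otimes> d) \<odot>\<^bsub>?F\<^esub> u = b \<odot>\<^bsub>?F\<^esub> (d \<odot>\<^bsub>?F\<^esub> u)"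
        by (rule coinduced_eqI[where M = M])
          (simp_all add: add smult u b d, simp add: coinduced_simps(2-4) c a u b d m_ac) }
    fix v assume v: "v \<in> carrier ?F"
    show "b \<odot>\<^bsub>?F\<^esub> (u \<oplus>\<^bsub>?F\<^esub> v) = b \<odot>\<^bsub>?F\<^esub> u \<oplus>\<^bsub>?F\<^esub> b \<odot>\<^bsub>?F\<^esub> v"
      by (rule coinduced_eqI[where M = M])
        (simp_all add: add smult u v b, simp add: coinduced_simps(2-4) c a u v b)
  next
    fix u assume u: "u \<in> carrier ?F"
    show "\<one> \<odot>\<^bsub>?F\<^esub> u = u"
      by (rule coinduced_eqI[where M = M]) (simp_all add: smult u, simp add: coinduced_simps(2-4) u)
  qed
qed

lemma scalar_hom:
  assumes M: "left_module R M" and u: "u \<in> carrier M"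
  shows "(\<lambda>s. s \<odot>\<^bsub>M\<^esub> u) \<in> lmod_hom R reg M"
  by (rule homI) (simp_all add: lm_rules[OF M] u lm_add_smult[OF M])

definition coind_in :: "('r, 'm) module \<Rightarrow> ('m \<Rightarrow> 'n) \<Rightarrow> 'm \<Rightarrow> 'r \<Rightarrow> 'n" where
  "coind_in M L u = (\<lambda>s\<in>carrier R. L (s \<odot>\<^bsub>M\<^esub> u))"

definition coind_out :: "('r, 'n) module \<Rightarrow> ('r \<Rightarrow> 'n) \<Rightarrow> 'n" where
  "coind_out N \<phi> = Tr reg N \<phi> \<one>"

lemma coind_in_hom:
  assumes M: "left_module R M" and N: "left_module R N" and L: "L \<in> linear_maps k M N"
  shows "coind_in M L \<in> lmod_hom R M (coinduced N)"
proof -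
  have car: "coind_in M L u \<in> carrier (coinduced N)" if u: "u \<in> carrier M" for u
  proof -
    have "L \<circ> (\<lambda>s. s \<odot>\<^bsub>M\<^esub> u) \<in> linear_maps k reg N"
      by (rule linear_maps_comp[OF hom_linear[OF scalar_hom[OF M u]] L])
    then have "coind_in M L u \<in> linear_maps k reg N"
      by (auto simp: linear_maps_def coind_in_def Pi_iff k_closed)
    then show ?thesis by (simp add: coinduced_simps coind_in_def)
  qed
  note F = left_module_coinduced[OF N]
  show ?thesis
  proof (rule homI)
    show "coind_in M L (u \<oplus>\<^bsub>M\<^esub> v) = coind_in M L u \<oplus>\<^bsub>coinduced N\<^esub> coind_in M L v"
      if "u \<in> carrier M" "v \<in> carrier M" for u v
      by (rule coinduced_eqI[where M = N])
        (simp_all add: car that lm_rules[OF M] lm_rules[OF F],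
          simp add: coinduced_simps coind_in_def lm_rules[OF M] that linear_maps_add[OF L])
    show "coind_in M L (a \<odot>\<^bsub>M\<^esub> u) = a \<odot>\<^bsub>coinduced N\<^esub> coind_in M L u"
      if "a \<in> carrier R" "u \<in> carrier M" for a u
      by (rule coinduced_eqI[where M = N])
        (simp_all add: car that lm_rules[OF M] lm_rules[OF F],
          simp add: coinduced_simps coind_in_def lm_rules[OF M] that)
  qed (rule car)
qed

lemma Tr_cong: "left_module R M \<Longrightarrow> u \<in> carrier M \<Longrightarrow> (\<And>v. v \<in> carrier M \<Longrightarrow> L v = L' v) \<Longrightarrow>
    Tr M N L u = Tr M N L' u"
  by (simp add: Tr_def trace1_def lm_smult_closed x_closed y_closed)

lemma coind_out_hom:
  assumes N: "left_module R N"
  shows "coind_out N \<in> lmod_hom R (coinduced N) N"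
proof (rule homI)
  fix u assume "u \<in> carrier (coinduced N)"
  then have L: "u \<in> linear_maps k reg N" by (simp add: coinduced_simps)
  note T = Tr_hom[OF lm_reg N L]
  show "coind_out N u \<in> carrier N" using hom_closed[OF T, of \<one>] by (simp add: coind_out_def)
  { fix a assume a: "a \<in> carrier R"
    have h: "(\<lambda>s. s \<otimes> a) \<in> lmod_hom R reg reg" using scalar_hom[OF lm_reg, of a] a by simp
    have "coind_out N (a \<odot>\<^bsub>coinduced N\<^esub> u) = Tr reg N (u \<circ> (\<lambda>s. s \<otimes> a)) \<one>"
      unfolding coind_out_def by (rule Tr_cong[OF lm_reg]) (simp_all add: coinduced_simps)
    also have "\<dots> = Tr reg N u (\<one> \<otimes> a)" by (rule Tr_comp_right[OF lm_reg h, symmetric]) simp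
    also have "\<dots> = Tr reg N u (a \<otimes> \<one>)" using a by simp
    also have "\<dots> = a \<odot>\<^bsub>N\<^esub> Tr reg N u \<one>" using hom_smult[OF T a, of \<one>] by simp
    finally show "coind_out N (a \<odot>\<^bsub>coinduced N\<^esub> u) = a \<odot>\<^bsub>N\<^esub> coind_out N u" by (simp add: coind_out_def) }
  fix v assume "v \<in> carrier (coinduced N)"
  then have L': "v \<in> linear_maps k reg N" by (simp add: coinduced_simps)
  have c: "u s \<in> carrier N" "v s \<in> carrier N" if "s \<in> carrier R" for s
    using linear_maps_closed[OF L] linear_maps_closed[OF L'] that by simp_all
  show "coind_out N (u \<oplus>\<^bsub>coinduced N\<^esub> v) = coind_out N u \<oplus>\<^bsub>N\<^esub> coind_out N v"
    by (simp add: coind_out_def Tr_def trace1_def coinduced_simps x_closed y_closed c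
        lm_rules[OF N] lm_add_comm[OF N] lm_add_lcomm[OF N])
qed

text \<open>The factorization of a trace through the coinduced module of its target.\<close>

lemma coind_out_in:
  assumes M: "left_module R M" and u: "u \<in> carrier M"
  shows "coind_out N (coind_in M L u) = Tr M N L u"
proof -
  have "coind_out N (coind_in M L u) = Tr reg N (L \<circ> (\<lambda>s. s \<odot>\<^bsub>M\<^esub> u)) \<one>"
    unfolding coind_out_def by (rule Tr_cong[OF lm_reg]) (simp_all add: coind_in_def)
  also have "\<dots> = Tr M N L (\<one> \<odot>\<^bsub>M\<^esub> u)" by (rule Tr_comp_right[OF lm_reg scalar_hom[OF M u], symmetric]) simp
  finally show ?thesis by (simp add: lm_rules[OF M] u)
qed

lemma coind_out_surj:
  assumes N: "left_module R N"
  shows "coind_out N ` carrier (coinduced N) = carrier N"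
proof
  show "coind_out N ` carrier (coinduced N) \<subseteq> carrier N" using hom_closed[OF coind_out_hom[OF N]] by blast
  show "carrier N \<subseteq> coind_out N ` carrier (coinduced N)"
  proof
    fix u assume u: "u \<in> carrier N"
    let ?g = "\<lambda>s. s \<odot>\<^bsub>N\<^esub> u"
    note g = scalar_hom[OF N u]
    have c: "?g \<circ> form \<in> linear_maps k reg N" by (rule linear_maps_comp[OF form_linear hom_linear[OF g]])
    let ?\<phi> = "restrict (?g \<circ> form) (carrier R)"
    have "?\<phi> \<in> carrier (coinduced N)"
      using c by (auto simp: coinduced_simps linear_maps_def Pi_iff k_closed)
    moreover have "coind_out N ?\<phi> = u"
    proof -
      have "coind_out N ?\<phi> = Tr reg N (?g \<circ> form) \<one>"
        unfolding coind_out_def by (rule Tr_cong[OF lm_reg]) simp_all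
      also have "\<dots> = ?g (Tr reg reg form \<one>)" by (rule Tr_comp_left[OF lm_reg lm_reg form_linear g, symmetric]) simp
      also have "\<dots> = u" by (simp add: Tr_form lm_rules[OF N] u)
      finally show ?thesis .
    qed
    ultimately show "u \<in> coind_out N ` carrier (coinduced N)" by (metis image_eqI)
  qed
qed

text \<open>The witness is \<open>\<phi> \<mapsto> form(_) \<phi>(1)\<close>. Its trace is \<open>R\<close>-linear, and an \<open>R\<close>-linear endomorphism of a coinduced
  module that preserves the value at 1 is the identity, because the value at \<open>s\<close> is the value at 1
  after acting with \<open>s\<close>.\<close>

lemma traced_id_coinduced:
  assumes N: "left_module R N"
  shows "traced (coinduced N) (coinduced N) id"
proof -
  let ?F = "coinduced N"
  note F = left_module_coinduced[OF N]
  define L where "L \<phi> = (\<lambda>s\<in>carrier R. form s \<odot>\<^bsub>N\<^esub> \<phi> \<one>)" for \<phi> :: "'r \<Rightarrow> 'a"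
  have lin: "\<phi> \<in> linear_maps k reg N" if "\<phi> \<in> carrier ?F" for \<phi> using that by (simp add: coinduced_simps)
  have c: "\<phi> s \<in> carrier N" if "\<phi> \<in> carrier ?F" "s \<in> carrier R" for \<phi> s
    using linear_maps_closed[OF lin[OF that(1)]] that(2) by simp
  have fc: "form s \<in> carrier R" if "s \<in> carrier R" for s using form_values[OF that] k_closed by blast
  have Lc: "L \<phi> \<in> carrier ?F" if "\<phi> \<in> carrier ?F" for \<phi>
  proof -
    have "(\<lambda>s. s \<odot>\<^bsub>N\<^esub> \<phi> \<one>) \<circ> form \<in> linear_maps k reg N"
      by (rule linear_maps_comp[OF form_linear hom_linear[OF scalar_hom[OF N]]]) (simp add: c that)
    then show ?thesis by (auto simp: L_def coinduced_simps linear_maps_def Pi_iff k_closed)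
  qed
  have L: "L \<in> linear_maps k ?F ?F"
  proof (rule linear_mapsI)
    fix \<phi> assume p: "\<phi> \<in> carrier ?F"
    show "L \<phi> \<in> carrier ?F" by (rule Lc[OF p])
    { fix \<psi> assume q: "\<psi> \<in> carrier ?F"
      show "L (\<phi> \<oplus>\<^bsub>?F\<^esub> \<psi>) = L \<phi> \<oplus>\<^bsub>?F\<^esub> L \<psi>"
        by (rule coinduced_eqI[where M = N]) (simp_all add: Lc lm_rules[OF F] p q,
            simp add: L_def coinduced_simps(2-4) c p q fc lm_rules[OF N]) }
    fix a assume a: "a \<in> k"
    have e: "\<phi> a = a \<odot>\<^bsub>N\<^esub> \<phi> \<one>" using linear_maps_smult[OF lin[OF p] a, of \<one>] k_closed[OF a] by simp
    have f: "form (s \<otimes> a) = a \<otimes> form s" if "s \<in> carrier R" for s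
      using linear_maps_smult[OF form_linear a, of s] that k_closed[OF a] by (simp add: m_comm)
    show "L (a \<odot>\<^bsub>?F\<^esub> \<phi>) = a \<odot>\<^bsub>?F\<^esub> L \<phi>"
      by (rule coinduced_eqI[where M = N]) (simp_all add: Lc lm_rules[OF F] p k_closed a,
          simp add: L_def coinduced_simps(2-4) c p e f fc lm_rules[OF N] k_closed a lm_smult_lcomm[OF N is_cring])
  qed
  have at_one: "Tr ?F ?F L \<phi> \<one> = \<phi> \<one>" if p: "\<phi> \<in> carrier ?F" for \<phi>
  proof -
    let ?x = "mx ?F" and ?y = "my ?F"
    have add1: "(u \<oplus>\<^bsub>?F\<^esub> v) s = u s \<oplus>\<^bsub>N\<^esub> v s" if "s \<in> carrier R" for u v s
      using that by (simp add: coinduced_simps)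
    have smult1: "(a \<odot>\<^bsub>?F\<^esub> u) s = u (s \<otimes> a)" if "s \<in> carrier R" for u a s
      using that by (simp add: coinduced_simps)
    have L1: "L u s = form s \<odot>\<^bsub>N\<^esub> u \<one>" if "s \<in> carrier R" for u s
      using that by (simp add: L_def)
    show ?thesis
      by (simp add: Tr_def trace1_def add1 smult1 L1 x_closed y_closed m_assoc m_lcomm[of y x]
          m_comm[of y x] form_values9 c[OF p] lm_rules[OF N])
  qed
  have "id \<phi> = Tr ?F ?F L \<phi>" if p: "\<phi> \<in> carrier ?F" for \<phi>
  proof (rule coinduced_eqI[where M = N])
    note T = Tr_hom[OF F F L]
    show "id \<phi> \<in> carrier ?F" "Tr ?F ?F L \<phi> \<in> carrier ?F" using p hom_closed[OF T] by simp_all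
    fix s assume s: "s \<in> carrier R"
    have "Tr ?F ?F L \<phi> s = (s \<odot>\<^bsub>?F\<^esub> Tr ?F ?F L \<phi>) \<one>" using s by (simp add: coinduced_simps)
    also have "\<dots> = Tr ?F ?F L (s \<odot>\<^bsub>?F\<^esub> \<phi>) \<one>" by (simp add: hom_smult[OF T s p])
    also have "\<dots> = (s \<odot>\<^bsub>?F\<^esub> \<phi>) \<one>" by (rule at_one) (simp add: lm_rules[OF F] s p)
    also have "\<dots> = \<phi> s" using s by (simp add: coinduced_simps)
    finally show "id \<phi> s = Tr ?F ?F L \<phi> s" by simp
  qed
  then show ?thesis unfolding traced_def using L by blast
qed

end

section \<open>Stable vanishing, syzygies and thick subcategories\<close>

lemma hom_diff:
  assumes M: "left_module R M" and N: "left_module R N" and f: "f \<in> lmod_hom R M N" and g: "g \<in> lmod_hom R M N"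
  shows "(\<lambda>u. f u \<ominus>\<^bsub>N\<^esub> g u) \<in> lmod_hom R M N"
  by (rule homI) (simp_all add: hom_closed[OF f] hom_closed[OF g] lm_minus_closed[OF N] hom_add[OF f] hom_add[OF g]
      lm_add_minus_add[OF N] hom_smult[OF f] hom_smult[OF g] lm_smult_minus[OF N])

lemma factor_through_injection:
  assumes A: "left_module R A" and L: "left_module R L" and P: "left_module R P"
    and i: "i \<in> lmod_hom R L P" "inj_on i (carrier L)"
    and g: "g \<in> lmod_hom R A P" and im: "\<And>u. u \<in> carrier A \<Longrightarrow> g u \<in> i ` carrier L"
  obtains s where "s \<in> lmod_hom R A L" "\<And>u. u \<in> carrier A \<Longrightarrow> i (s u) = g u"
proof -
  define s where "s u = inv_into (carrier L) i (g u)" for u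
  have i_s: "i (s u) = g u" and sL: "s u \<in> carrier L" if "u \<in> carrier A" for u
    using im[OF that] by (simp_all add: s_def f_inv_into_f inv_into_into)
  have eq: "u = v" if "i u = i v" "u \<in> carrier L" "v \<in> carrier L" for u v
    using that i(2) by (auto dest: inj_onD)
  have "s \<in> lmod_hom R A L"
  proof (rule homI)
    show "s (u \<oplus>\<^bsub>A\<^esub> v) = s u \<oplus>\<^bsub>L\<^esub> s v" if "u \<in> carrier A" "v \<in> carrier A" for u v
      by (rule eq) (simp_all add: that i_s sL lm_rules[OF A] lm_rules[OF L] hom_add[OF i(1)] hom_add[OF g])
    show "s (a \<odot>\<^bsub>A\<^esub> u) = a \<odot>\<^bsub>L\<^esub> s u" if "a \<in> carrier R" "u \<in> carrier A" for a u
      by (rule eq) (simp_all add: that i_s sL lm_rules[OF A] lm_rules[OF L] hom_smult[OF i(1)] hom_smult[OF g])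
  qed (rule sL)
  then show thesis using i_s that by blast
qed

lemma hom_image_add:
  assumes "left_module R A" "f \<in> lmod_hom R A B" "u \<in> f ` carrier A" "v \<in> f ` carrier A"
  shows "u \<oplus>\<^bsub>B\<^esub> v \<in> f ` carrier A"
proof -
  obtain a b where "a \<in> carrier A" "b \<in> carrier A" "u = f a" "v = f b" using assms(3,4) by blast
  then show ?thesis using hom_add[OF assms(2), of a b, symmetric] lm_add_closed[OF assms(1)] by simp
qed

lemma hom_image_smult:
  assumes "left_module R A" "f \<in> lmod_hom R A B" "c \<in> carrier R" "u \<in> f ` carrier A"
  shows "c \<odot>\<^bsub>B\<^esub> u \<in> f ` carrier A"
proof -
  obtain a where "a \<in> carrier A" "u = f a" using assms(4) by blast
  then show ?thesis using hom_smult[OF assms(2,3), of a, symmetric] lm_smult_closed[OF assms(1,3)] by simp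
qed

lemma thick_left_modules: "thick_subcategory R {M. left_module R M}"
  by (auto simp: thick_subcategory_def triangulated_subcategory_def is_Omega_def Omega_seq_def
      short_exact_def distinguished_triangle_def)

context truncated_algebra
begin

lemma smult_hom:
  assumes M: "left_module R M" and a: "a \<in> carrier R"
  shows "(\<lambda>u. a \<odot>\<^bsub>M\<^esub> u) \<in> lmod_hom R M M"
  by (rule homI) (simp_all add: lm_rules[OF M] a lcomm[OF M])

text \<open>The nine monomials span \<open>R\<close>. Agreement on monomials is inherited by \<open>f(x _)\<close> and \<open>f(y _)\<close>, so that the
  elements on which any two such maps agree satisfy the induction principle of the algebra.\<close>

lemma linear_maps_regular_eqI:
  assumes M: "left_module R M" and f: "f \<in> linear_maps k reg M" and g: "g \<in> linear_maps k reg M"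
    and eq: "\<And>i j. i < 3 \<Longrightarrow> j < 3 \<Longrightarrow> f (x [^] (i::nat) \<otimes> y [^] (j::nat)) = g (x [^] i \<otimes> y [^] j)"
    and s: "s \<in> carrier R"
  shows "f s = g s"
proof -
  define ag where "ag f g \<longleftrightarrow> (\<forall>i j. f (x [^] (i::nat) \<otimes> y [^] (j::nat)) = g (x [^] i \<otimes> y [^] j))"
    for f g :: "'r \<Rightarrow> 'a"
  let ?S = "{s \<in> carrier R. \<forall>f\<in>linear_maps k reg M. \<forall>g\<in>linear_maps k reg M. ag f g \<longrightarrow> f s = g s}"
  have mult: "(\<lambda>s. f (z \<otimes> s)) \<in> linear_maps k reg M" if "f \<in> linear_maps k reg M" "z \<in> carrier R" for f z
    using linear_maps_comp[OF hom_linear[OF smult_hom[OF lm_reg that(2)]] that(1)] by (simp add: comp_def)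
  have agx: "ag (\<lambda>s. f (x \<otimes> s)) (\<lambda>s. g (x \<otimes> s))" if "ag f g" for f g
    unfolding ag_def
  proof (intro allI)
    fix i j :: nat
    have "x \<otimes> (x [^] i \<otimes> y [^] j) = x [^] Suc i \<otimes> y [^] j"
      using x_closed y_closed by (simp add: m_ac)
    then show "f (x \<otimes> (x [^] i \<otimes> y [^] j)) = g (x \<otimes> (x [^] i \<otimes> y [^] j))"
      using that unfolding ag_def by metis
  qed
  have agy: "ag (\<lambda>s. f (y \<otimes> s)) (\<lambda>s. g (y \<otimes> s))" if "ag f g" for f g
    unfolding ag_def
  proof (intro allI)
    fix i j :: nat
    have "y \<otimes> (x [^] i \<otimes> y [^] j) = x [^] i \<otimes> y [^] Suc j"
      using x_closed y_closed by (simp add: m_ac)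
    then show "f (y \<otimes> (x [^] i \<otimes> y [^] j)) = g (y \<otimes> (x [^] i \<otimes> y [^] j))"
      using that unfolding ag_def by metis
  qed
  have "?S = carrier R"
  proof (rule generated)
    show "k \<subseteq> ?S"
    proof
      fix c assume c: "c \<in> k"
      have 1: "f c = c \<odot>\<^bsub>M\<^esub> f \<one>" if "f \<in> linear_maps k reg M" for f
        using linear_maps_smult[OF that c, of \<one>] k_closed[OF c] by simp
      have 2: "f \<one> = g \<one>" if "ag f g" for f g
        using that[unfolded ag_def, rule_format, of 0 0] by simp
      have "f c = g c" if "f \<in> linear_maps k reg M" "g \<in> linear_maps k reg M" "ag f g" for f g
        using 1[OF that(1)] 1[OF that(2)] 2[OF that(3)] by simp
      then show "c \<in> ?S" using k_closed[OF c] by blast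
    qed
    show "a \<oplus> b \<in> ?S" if ab: "a \<in> ?S" "b \<in> ?S" for a b
    proof -
      have "f (a \<oplus> b) = f a \<oplus>\<^bsub>M\<^esub> f b" if "f \<in> linear_maps k reg M" for f
        using linear_maps_add[OF that, of a b] ab by simp
      note add = this
      have "f (a \<oplus> b) = g (a \<oplus> b)"
        if "f \<in> linear_maps k reg M" "g \<in> linear_maps k reg M" "ag f g" for f g
      proof -
        have "f a = g a" "f b = g b" using ab that by blast+
        then show ?thesis by (simp add: add that(1,2))
      qed
      then show ?thesis using ab a_closed by blast
    qed
    show "x \<otimes> a \<in> ?S" if a: "a \<in> ?S" for a using a agx mult[OF _ x_closed] x_closed by blast
    show "y \<otimes> a \<in> ?S" if a: "a \<in> ?S" for a using a agy mult[OF _ y_closed] y_closed by blast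
  qed blast
  moreover have "ag f g"
    unfolding ag_def
  proof (intro allI)
    fix i j :: nat
    have z: "z [^] n = \<zero>" if "z [^] (3::nat) = \<zero>" "z \<in> carrier R" "\<not> n < 3" for z and n :: nat
      using nat_pow_mult[OF that(2), of 3 "n - 3"] that by simp
    have zero: "f \<zero> = g \<zero>" using linear_maps_zero[OF f lm_reg M] linear_maps_zero[OF g lm_reg M] by simp
    show "f (x [^] i \<otimes> y [^] j) = g (x [^] i \<otimes> y [^] j)"
    proof (cases "i < 3 \<and> j < 3")
      case False
      then have "x [^] i \<otimes> y [^] j = \<zero>"
        using z[OF x_cube x_closed, of i] z[OF y_cube y_closed, of j] x_closed y_closed
        by (metis l_null r_null nat_pow_closed)
      then show ?thesis using zero by simp
    qed (use eq in blast)
  qed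
  ultimately show ?thesis using f g s by blast
qed

text \<open>An element of the coinduced module is determined by nine elements of \<open>M\<close>, and nine-tuples fit into
  an infinite universe.\<close>

lemma coinduced_embeds:
  fixes M :: "('r, 'm) module"
  assumes M: "left_module R M" and inf: "infinite (UNIV :: 'm set)"
  obtains j :: "('r \<Rightarrow> 'm) \<Rightarrow> 'm" where "inj_on j (carrier (coinduced M))"
proof -
  let ?I = "{..<3::nat} \<times> {..<3::nat}"
  obtain e :: "(nat \<times> nat \<Rightarrow> 'm) \<Rightarrow> 'm" where e: "inj_on e (extensional ?I)"
    using infinite_tuples_injection[OF inf, of ?I] by auto
  let ?v = "\<lambda>f. restrict (\<lambda>(i, j). f (x [^] i \<otimes> y [^] j)) ?I"
  have "inj_on (e \<circ> ?v) (carrier (coinduced M))"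
  proof (rule inj_onI)
    fix f g assume f: "f \<in> carrier (coinduced M)" and g: "g \<in> carrier (coinduced M)"
      and "(e \<circ> ?v) f = (e \<circ> ?v) g"
    then have v: "?v f = ?v g" using e by (auto dest: inj_onD)
    have "f (x [^] i \<otimes> y [^] j) = g (x [^] i \<otimes> y [^] j)" if "i < 3" "j < 3" for i j :: nat
      using fun_cong[OF v, of "(i, j)"] that by simp
    then have "f s = g s" if "s \<in> carrier R" for s
      using linear_maps_regular_eqI[OF M, of f g s] f g that by (simp add: coinduced_simps)
    then show "f = g" by (rule coinduced_eqI[OF f g])
  qed
  then show thesis using that by blast
qed

lemma coinduced_copy:
  fixes N :: "('r, 'm) module"
  assumes N: "left_module R N" and inf: "infinite (UNIV :: 'm set)"
  obtains I :: "('r, 'm) module" and i p where "left_module R I" "traced I I id" "projective R I"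
    "i \<in> lmod_hom R (coinduced N) I" "inj_on i (carrier (coinduced N))"
    "p \<in> lmod_hom R I N" "p ` carrier I = carrier N"
    "\<And>u. u \<in> carrier (coinduced N) \<Longrightarrow> p (i u) = coind_out N u"
proof -
  obtain j :: "('r \<Rightarrow> 'm) \<Rightarrow> 'm" where j: "inj_on j (carrier (coinduced N))"
    using coinduced_embeds[OF N inf] by blast
  note F = left_module_coinduced[OF N]
  note t = transport_isomorphic[OF F j]
  let ?I = "transport j (coinduced N)" and ?v = "inv_into (carrier (coinduced N)) j"
  have tr: "traced ?I ?I id" by (rule traced_id_transport[OF F traced_id_coinduced[OF N] j])
  show thesis
  proof (rule that[of ?I j "coind_out N \<circ> ?v"])
    show "coind_out N \<circ> ?v \<in> lmod_hom R ?I N" by (rule hom_comp[OF t(3) coind_out_hom[OF N]])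
    have "?v ` carrier ?I = carrier (coinduced N)" by (simp add: transport_simps inv_into_image_cancel[OF j])
    then show "(coind_out N \<circ> ?v) ` carrier ?I = carrier N"
      unfolding image_comp[symmetric] by (simp add: coind_out_surj[OF N])
  qed (use t tr j in \<open>simp_all add: traced_id_projective inv_into_f_f\<close>)
qed

text \<open>The other half of Higman's criterion: a projective module is a retract of a coinduced one.\<close>

lemma projective_traced:
  fixes P :: "('r, 'm) module"
  assumes P: "projective R P" and inf: "infinite (UNIV :: 'm set)"
  shows "traced P P id"
proof -
  have lP: "left_module R P" using P by (simp add: projective_def)
  obtain I :: "('r, 'm) module" and p where I: "left_module R I" "traced I I id"
    and p: "p \<in> lmod_hom R I P" "p ` carrier I = carrier P"
    using coinduced_copy[OF lP inf] by metis
  obtain h where h: "h \<in> lmod_hom R P I" "\<forall>u\<in>carrier P. p (h u) = id u"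
    using P I(1) lP p hom_id[of R P] unfolding projective_def by blast
  have "traced P P (p \<circ> (id \<circ> h))"
    by (rule traced_comp_left[OF lP I(1) traced_comp_right[OF lP I(2) h(1)] p(1)])
  then show ?thesis by (rule traced_cong) (simp add: h(2))
qed

lemma stably_zero_iff_traced:
  fixes M N :: "('r, 'm) module"
  assumes M: "left_module R M" and N: "left_module R N" and inf: "infinite (UNIV :: 'm set)"
  shows "stably_zero R M N f \<longleftrightarrow> traced M N f"
proof
  assume "stably_zero R M N f"
  then obtain P :: "('r, 'm) module" and a b where P: "projective R P" and a: "a \<in> lmod_hom R M P"
    and b: "b \<in> lmod_hom R P N" and f: "\<forall>u\<in>carrier M. f u = b (a u)"
    unfolding stably_zero_def by blast
  have lP: "left_module R P" using P by (simp add: projective_def)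
  have "traced M N (b \<circ> (id \<circ> a))"
    by (rule traced_comp_left[OF M lP traced_comp_right[OF M projective_traced[OF P inf] a] b])
  then show "traced M N f" by (rule traced_cong) (simp add: f)
next
  assume "traced M N f"
  then obtain L where L: "L \<in> linear_maps k M N" and f: "\<And>u. u \<in> carrier M \<Longrightarrow> f u = Tr M N L u"
    unfolding traced_def by blast
  obtain I :: "('r, 'm) module" and i p where I: "projective R I"
    and i: "i \<in> lmod_hom R (coinduced N) I" and p: "p \<in> lmod_hom R I N"
    and pi: "\<And>u. u \<in> carrier (coinduced N) \<Longrightarrow> p (i u) = coind_out N u"
    using coinduced_copy[OF N inf] by metis
  note c = coind_in_hom[OF M N L]
  have "\<forall>u\<in>carrier M. f u = p ((i \<circ> coind_in M L) u)"
    by (simp add: f pi hom_closed[OF c] coind_out_in[OF M])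
  then show "stably_zero R M N f" using I p hom_comp[OF c i] unfolding stably_zero_def by blast
qed

lemma traced_lift:
  assumes M: "left_module R M" and N: "left_module R N" and P: "left_module R P"
    and f: "traced M N f" and p: "p \<in> lmod_hom R P N" "p ` carrier P = carrier N"
  obtains h where "h \<in> lmod_hom R M P" "\<And>u. u \<in> carrier M \<Longrightarrow> p (h u) = f u"
proof -
  obtain L where L: "L \<in> linear_maps k M N" "\<And>u. u \<in> carrier M \<Longrightarrow> f u = Tr M N L u"
    using f unfolding traced_def by blast
  obtain s where s: "s \<in> linear_maps k N P" "\<And>v. v \<in> p ` carrier P \<Longrightarrow> p (s v) = v"
    using linear_section[OF P N hom_linear[OF p(1)]] by blast
  have sL: "s \<circ> L \<in> linear_maps k M P" by (rule linear_maps_comp[OF L(1) s(1)])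
  show thesis
  proof (rule that)
    show "Tr M P (s \<circ> L) \<in> lmod_hom R M P" by (rule Tr_hom[OF M P sL])
    fix u assume u: "u \<in> carrier M"
    have "p (Tr M P (s \<circ> L) u) = Tr M N (p \<circ> (s \<circ> L)) u" by (rule Tr_comp_left[OF M P sL p(1) u])
    also have "\<dots> = Tr M N L u"
      by (rule Tr_cong[OF M u]) (use s(2) p(2) linear_maps_closed[OF L(1)] in simp)
    finally show "p (Tr M P (s \<circ> L) u) = f u" by (simp add: L(2)[OF u])
  qed
qed

lemma traced_extension:
  assumes A: "left_module R A" and B: "left_module R B" and Q: "left_module R Q"
    and i: "i \<in> lmod_hom R A B" "inj_on i (carrier A)" and f: "traced A Q f"
  obtains h where "h \<in> lmod_hom R B Q" "\<And>u. u \<in> carrier A \<Longrightarrow> h (i u) = f u"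
proof -
  obtain L where L: "L \<in> linear_maps k A Q" "\<And>u. u \<in> carrier A \<Longrightarrow> f u = Tr A Q L u"
    using f unfolding traced_def by blast
  obtain r where r: "r \<in> linear_maps k B A" "\<And>u. u \<in> carrier A \<Longrightarrow> r (i u) = u"
    using linear_retraction[OF A B hom_linear[OF i(1)] i(2)] by blast
  show thesis
  proof (rule that)
    show "Tr B Q (L \<circ> r) \<in> lmod_hom R B Q" by (rule Tr_hom[OF B Q linear_maps_comp[OF r(1) L(1)]])
    fix u assume u: "u \<in> carrier A"
    have "Tr B Q (L \<circ> r) (i u) = Tr A Q (L \<circ> r \<circ> i) u" by (rule Tr_comp_right[OF A i(1) u])
    also have "\<dots> = Tr A Q L u" by (rule Tr_cong[OF A u]) (simp add: r(2))
    finally show "Tr B Q (L \<circ> r) (i u) = f u" by (simp add: L(2)[OF u])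
  qed
qed

text \<open>If \<open>a\<close> is a trace at one end of \<open>0 \<rightarrow> L \<rightarrow> P \<rightarrow> M \<rightarrow> 0\<close>, it lifts to \<open>M \<rightarrow> P\<close>, respectively extends to
  \<open>P \<rightarrow> L\<close>. Subtracting the resulting endomorphism of \<open>P\<close> from multiplication by \<open>a\<close> leaves a map that
  factors through the other end and induces \<open>a\<close> there; so \<open>a\<close> factors through \<open>P\<close> at that end.\<close>

lemma traced_smult_Omega:
  fixes M L P :: "('r, 'm) module"
  assumes O: "Omega_seq R L P M i p" and a: "a \<in> carrier R" and inf: "infinite (UNIV :: 'm set)"
  shows "traced M M (\<lambda>u. a \<odot>\<^bsub>M\<^esub> u) \<longleftrightarrow> traced L L (\<lambda>u. a \<odot>\<^bsub>L\<^esub> u)"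
proof -
  have L: "left_module R L" and P: "left_module R P" and M: "left_module R M"
    and i: "i \<in> lmod_hom R L P" "inj_on i (carrier L)"
    and p: "p \<in> lmod_hom R P M" "p ` carrier P = carrier M"
    and ex: "i ` carrier L = {u \<in> carrier P. p u = \<zero>\<^bsub>M\<^esub>}" and pr: "projective R P"
    using O unfolding Omega_seq_def short_exact_def by blast+
  note tP = projective_traced[OF pr inf]
  have pi: "p (i u) = \<zero>\<^bsub>M\<^esub>" if "u \<in> carrier L" for u using ex that by blast
  show ?thesis
  proof
    assume t: "traced M M (\<lambda>u. a \<odot>\<^bsub>M\<^esub> u)"
    obtain h where h: "h \<in> lmod_hom R M P" "\<And>u. u \<in> carrier M \<Longrightarrow> p (h u) = a \<odot>\<^bsub>M\<^esub> u"
      using traced_lift[OF M M P t p] by blast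
    let ?g = "\<lambda>u. a \<odot>\<^bsub>P\<^esub> u \<ominus>\<^bsub>P\<^esub> (h \<circ> p) u"
    have g: "?g \<in> lmod_hom R P P" by (rule hom_diff[OF P P smult_hom[OF P a] hom_comp[OF p(1) h(1)]])
    have "?g u \<in> i ` carrier L" if u: "u \<in> carrier P" for u
      using u by (simp add: ex lm_rules[OF P] a hom_closed[OF h(1)] hom_closed[OF p(1)]
          hom_minus[OF p(1) P M] hom_smult[OF p(1)] h(2) lm_rules[OF M])
    then obtain s where s: "s \<in> lmod_hom R P L" "\<And>u. u \<in> carrier P \<Longrightarrow> i (s u) = ?g u"
      using factor_through_injection[OF P L P i g] by blast
    have "s (i u) = a \<odot>\<^bsub>L\<^esub> u" if u: "u \<in> carrier L" for u
    proof (rule inj_onD[OF i(2)])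
      show "i (s (i u)) = i (a \<odot>\<^bsub>L\<^esub> u)"
        using u by (simp add: s(2) hom_closed[OF i(1)] pi hom_zero[OF h(1) M P] hom_smult[OF i(1)] a lm_rules[OF P])
    qed (use u in \<open>simp_all add: hom_closed[OF s(1)] hom_closed[OF i(1)] lm_rules[OF L] a\<close>)
    moreover have "traced L L (s \<circ> (id \<circ> i))"
      by (rule traced_comp_left[OF L P traced_comp_right[OF L tP i(1)] s(1)])
    ultimately show "traced L L (\<lambda>u. a \<odot>\<^bsub>L\<^esub> u)" by (auto elim: traced_cong)
  next
    assume t: "traced L L (\<lambda>u. a \<odot>\<^bsub>L\<^esub> u)"
    obtain h where h: "h \<in> lmod_hom R P L" "\<And>u. u \<in> carrier L \<Longrightarrow> h (i u) = a \<odot>\<^bsub>L\<^esub> u"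
      using traced_extension[OF L P L i t] by blast
    let ?g = "\<lambda>u. a \<odot>\<^bsub>P\<^esub> u \<ominus>\<^bsub>P\<^esub> (i \<circ> h) u"
    have g: "?g \<in> lmod_hom R P P" by (rule hom_diff[OF P P smult_hom[OF P a] hom_comp[OF h(1) i(1)]])
    have "?g u = \<zero>\<^bsub>P\<^esub>" if u: "u \<in> carrier P" "p u = \<zero>\<^bsub>M\<^esub>" for u
    proof -
      obtain v where v: "v \<in> carrier L" "u = i v" using ex u by blast
      then show ?thesis using u(1) by (simp add: h(2) hom_smult[OF i(1)] a lm_rules[OF P])
    qed
    then obtain s where s: "s \<in> lmod_hom R M P" "\<And>u. u \<in> carrier P \<Longrightarrow> s (p u) = ?g u"
      using factor_through_surjection[OF P M P p g] by blast
    have "p (s v) = a \<odot>\<^bsub>M\<^esub> v" if v: "v \<in> carrier M" for v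
    proof -
      obtain u where u: "u \<in> carrier P" "v = p u" using p(2) v by blast
      then show ?thesis
        by (simp add: s(2) hom_minus[OF p(1) P M] lm_rules[OF P] a hom_closed[OF i(1)] hom_closed[OF h(1)]
            pi hom_smult[OF p(1)] lm_rules[OF M] hom_closed[OF p(1)])
    qed
    moreover have "traced M M (p \<circ> (id \<circ> s))"
      by (rule traced_comp_left[OF M P traced_comp_right[OF M tP s(1)] p(1)])
    ultimately show "traced M M (\<lambda>u. a \<odot>\<^bsub>M\<^esub> u)" by (auto elim: traced_cong)
  qed
qed

lemma traced_smult_Omega_nat:
  fixes M L :: "('r, 'm) module"
  assumes a: "a \<in> carrier R" and inf: "infinite (UNIV :: 'm set)" and O: "is_Omega_nat R n M L"
  shows "traced M M (\<lambda>u. a \<odot>\<^bsub>M\<^esub> u) \<longleftrightarrow> traced L L (\<lambda>u. a \<odot>\<^bsub>L\<^esub> u)"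
  using O
proof (induction n arbitrary: L)
  case (Suc n)
  then obtain L' where "is_Omega_nat R n M L'" "is_Omega R L' L" by auto
  then show ?case using Suc.IH traced_smult_Omega[OF _ a inf] unfolding is_Omega_def by blast
qed simp

lemma stably_eq_refl:
  fixes M N :: "('r, 'm) module"
  assumes M: "left_module R M" and N: "left_module R N" and f: "f \<in> lmod_hom R M N"
    and inf: "infinite (UNIV :: 'm set)" and g: "\<And>u. u \<in> carrier M \<Longrightarrow> g u = f u"
  shows "stably_eq R M N g f"
  unfolding stably_eq_def stably_zero_iff_traced[OF M N inf]
  by (rule traced_cong[OF traced_zero[OF M N]]) (simp add: g lm_minus_self[OF N] hom_closed[OF f])

lemma stable_iso_map_id:
  fixes M :: "('r, 'm) module"
  assumes M: "left_module R M" and inf: "infinite (UNIV :: 'm set)"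
  shows "stable_iso_map R M M id"
  unfolding stable_iso_map_def
  by (intro conjI bexI[OF _ hom_id] hom_id stably_eq_refl[OF M M hom_id inf]) simp_all

lemma Omega_seq_exists:
  fixes A :: "('r, 'm) module"
  assumes A: "left_module R A" and inf: "infinite (UNIV :: 'm set)"
  obtains I S i q where "Omega_seq R A I S i q"
proof -
  obtain I :: "('r, 'm) module" and j p where I: "left_module R I" "projective R I"
    and j: "j \<in> lmod_hom R (coinduced A) I" "inj_on j (carrier (coinduced A))"
    by (rule coinduced_copy[OF A inf]) blast
  have lin: "id \<in> linear_maps k A A" by (rule hom_linear[OF hom_id])
  note c = coind_in_hom[OF A A lin]
  let ?i = "j \<circ> coind_in A id"
  have i: "?i \<in> lmod_hom R A I" by (rule hom_comp[OF c j(1)])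
  have inj: "inj_on ?i (carrier A)"
  proof (rule inj_onI)
    fix u v assume u: "u \<in> carrier A" and v: "v \<in> carrier A" and "?i u = ?i v"
    then have "coind_in A id u = coind_in A id v" using j(2) hom_closed[OF c] by (auto dest: inj_onD)
    then show "u = v" using u v by (auto simp: coind_in_def fun_eq_iff restrict_def lm_rules[OF A] dest!: spec[of _ \<one>])
  qed
  let ?S = "?i ` carrier A"
  have S: "?S \<subseteq> carrier I" "\<zero>\<^bsub>I\<^esub> \<in> ?S"
    using hom_closed[OF i] hom_zero[OF i A I(1), symmetric] lm_zero_closed[OF A] by blast+
  have S_add: "u \<oplus>\<^bsub>I\<^esub> v \<in> ?S" if "u \<in> ?S" "v \<in> ?S" for u v
    by (rule hom_image_add[OF A i that])
  have S_smult: "a \<odot>\<^bsub>I\<^esub> u \<in> ?S" if "a \<in> carrier R" "u \<in> ?S" for a u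
    by (rule hom_image_smult[OF A i that])
  obtain Q :: "('r, 'm) module" and q where "left_module R Q" "q \<in> lmod_hom R I Q" "q ` carrier I = carrier Q"
    "\<And>u. u \<in> carrier I \<Longrightarrow> q u = \<zero>\<^bsub>Q\<^esub> \<longleftrightarrow> u \<in> ?S"
    using quotient_module[OF I(1) S S_add S_smult] by metis
  then have "Omega_seq R A I Q ?i q"
    unfolding Omega_seq_def short_exact_def using A I i inj S(1) by blast
  then show thesis using that by blast
qed

text \<open>Embedding \<open>A\<close> into a projective module turns the sequence into a standard triangle, and this is
  distinguished by way of identity maps.\<close>

lemma thick_extension:
  fixes A B C :: "('r, 'm) module"
  assumes thick: "thick_subcategory R \<C>" and ex: "short_exact R A B C f g"
    and AC: "A \<in> \<C>" "C \<in> \<C>" and inf: "infinite (UNIV :: 'm set)"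
  shows "B \<in> \<C>"
proof -
  have A: "left_module R A" and B: "left_module R B" and C: "left_module R C"
    and f: "f \<in> lmod_hom R A B" "inj_on f (carrier A)"
    and g: "g \<in> lmod_hom R B C" "g ` carrier B = carrier C"
    and fg: "f ` carrier A = {u \<in> carrier B. g u = \<zero>\<^bsub>C\<^esub>}"
    using ex unfolding short_exact_def by blast+
  obtain I S i q where O: "Omega_seq R A I S i q" using Omega_seq_exists[OF A inf] by blast
  then have I: "left_module R I" and S: "left_module R S" and pr: "projective R I"
    and i: "i \<in> lmod_hom R A I" and q: "q \<in> lmod_hom R I S"
    and iq: "i ` carrier A = {u \<in> carrier I. q u = \<zero>\<^bsub>S\<^esub>}"
    unfolding Omega_seq_def short_exact_def by blast+
  have "traced A I (id \<circ> i)" by (rule traced_comp_right[OF A projective_traced[OF pr inf] i])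
  then obtain u where u: "u \<in> lmod_hom R B I" "\<And>a. a \<in> carrier A \<Longrightarrow> u (f a) = i a"
    using traced_extension[OF A B I f] by auto
  have "(q \<circ> u) b = \<zero>\<^bsub>S\<^esub>" if "b \<in> carrier B" "g b = \<zero>\<^bsub>C\<^esub>" for b
  proof -
    obtain a where "a \<in> carrier A" "b = f a" using fg \<open>b \<in> carrier B\<close> \<open>g b = \<zero>\<^bsub>C\<^esub>\<close> by blast
    then show ?thesis using u(2) iq by auto
  qed
  then obtain h where h: "h \<in> lmod_hom R C S" "\<And>b. b \<in> carrier B \<Longrightarrow> h (g b) = (q \<circ> u) b"
    using factor_through_surjection[OF B C S g hom_comp[OF u(1) q]] by blast
  have st: "standard_triangle R A B C I S i q f g h"
    unfolding standard_triangle_def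
    by (intro conjI ex O h(1) bexI[OF _ u(1)]) (simp_all add: u(2) h(2))
  have su: "suspends_to R A I S i q A I S i q id id"
    unfolding suspends_to_def by (intro conjI O hom_id bexI[OF _ hom_id]) simp_all
  have "distinguished_triangle R A B C I S i q f g h"
    unfolding distinguished_triangle_def
  proof (intro conjI B C O f(1) g(1) h(1))
    have "stably_eq R A B (id \<circ> f) (f \<circ> id)" "stably_eq R B C (id \<circ> g) (g \<circ> id)"
      "stably_eq R C S (id \<circ> h) (h \<circ> id)"
      using stably_eq_refl[OF A B f(1) inf, of f] stably_eq_refl[OF B C g(1) inf, of g]
        stably_eq_refl[OF C S h(1) inf, of h] by simp_all
    with st su stable_iso_map_id[OF A inf] stable_iso_map_id[OF B inf] stable_iso_map_id[OF C inf]
    show "\<exists>A' B' C' I' S' i' q' f' g' h' a b c s.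
       standard_triangle R A' B' C' I' S' i' q' f' g' h' \<and>
       stable_iso_map R A A' a \<and> stable_iso_map R B B' b \<and> stable_iso_map R C C' c \<and>
       suspends_to R A I S i q A' I' S' i' q' a s \<and>
       stably_eq R A B' (b \<circ> f) (f' \<circ> a) \<and> stably_eq R B C' (c \<circ> g) (g' \<circ> b) \<and>
       stably_eq R C S' (s \<circ> h) (h' \<circ> c)"
      by blast
  qed
  then show ?thesis
    using thick AC unfolding thick_subcategory_def triangulated_subcategory_def by blast
qed

end

section \<open>Composites of three ghosts\<close>

context truncated_algebra
begin

text \<open>The values that a stably zero map can take on the generators of \<open>k\<close>, of \<open>\<Omega>\<^sup>-\<^sup>1k\<close> and, as a pair, of
  \<open>\<Omega>\<^sup>-\<^sup>2k\<close>.\<close>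

definition "top_part N = {mx N (mx N (my N (my N a))) | a. a \<in> carrier N}"
definition "radical N = {mx N a \<oplus>\<^bsub>N\<^esub> my N b | a b. a \<in> carrier N \<and> b \<in> carrier N}"
definition "syzygy_pairs N = {(mx N (mx N a) \<oplus>\<^bsub>N\<^esub> my N b, mx N b \<oplus>\<^bsub>N\<^esub> my N (my N c)) | a b c.
  a \<in> carrier N \<and> b \<in> carrier N \<and> c \<in> carrier N}"

text \<open>Elements killed by \<open>x\<close> and \<open>y\<close>, elements killed by \<open>x\<^sup>2y\<^sup>2\<close>, and pairs with \<open>xu = yv\<close> are the maps into \<open>M\<close>
  from \<open>k\<close>, \<open>\<Omega>\<^sup>-\<^sup>1k\<close> and \<open>\<Omega>\<^sup>-\<^sup>2k\<close>.\<close>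

definition ghostly :: "('r, 'm) module \<Rightarrow> ('r, 'n) module \<Rightarrow> ('m \<Rightarrow> 'n) \<Rightarrow> bool" where
  "ghostly M N f \<longleftrightarrow> f \<in> lmod_hom R M N \<and>
    (\<forall>u\<in>carrier M. mx M u = \<zero>\<^bsub>M\<^esub> \<longrightarrow> my M u = \<zero>\<^bsub>M\<^esub> \<longrightarrow> f u \<in> top_part N) \<and>
    (\<forall>u\<in>carrier M. mx M (mx M (my M (my M u))) = \<zero>\<^bsub>M\<^esub> \<longrightarrow> f u \<in> radical N) \<and>
    (\<forall>u\<in>carrier M. \<forall>v\<in>carrier M. mx M u = my M v \<longrightarrow> (f u, f v) \<in> syzygy_pairs N)"

lemma ghostlyD:
  assumes "ghostly M N f"
  shows "f \<in> lmod_hom R M N"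
    "\<And>u. u \<in> carrier M \<Longrightarrow> mx M u = \<zero>\<^bsub>M\<^esub> \<Longrightarrow> my M u = \<zero>\<^bsub>M\<^esub> \<Longrightarrow> f u \<in> top_part N"
    "\<And>u. u \<in> carrier M \<Longrightarrow> mx M (mx M (my M (my M u))) = \<zero>\<^bsub>M\<^esub> \<Longrightarrow> f u \<in> radical N"
    "\<And>u v. u \<in> carrier M \<Longrightarrow> v \<in> carrier M \<Longrightarrow> mx M u = my M v \<Longrightarrow> (f u, f v) \<in> syzygy_pairs N"
  using assms unfolding ghostly_def by blast+

text \<open>Equivalently, no element of \<open>M\<close> generates a free submodule.\<close>

definition socle_free :: "('r, 'm) module \<Rightarrow> bool" where
  "socle_free M \<longleftrightarrow> (\<forall>u\<in>carrier M. mx M (mx M (my M (my M u))) = \<zero>\<^bsub>M\<^esub>)"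

lemma socle_freeD:
  assumes M: "left_module R M" and s: "socle_free M" and u: "u \<in> carrier M"
  shows "mx M (mx M (my M (my M u))) = \<zero>\<^bsub>M\<^esub>"
  using s u by (simp add: socle_free_def)

lemma ghostly_kills_simple:
  assumes f: "ghostly M N f" and N: "left_module R N" "socle_free N" and u: "u \<in> carrier M"
    "mx M u = \<zero>\<^bsub>M\<^esub>" "my M u = \<zero>\<^bsub>M\<^esub>"
  shows "f u = \<zero>\<^bsub>N\<^esub>"
  using ghostlyD(2)[OF f u] by (auto simp: top_part_def socle_freeD[OF N])

lemma ghostly_into_radical:
  assumes f: "ghostly M N f" and M: "left_module R M" "socle_free M" and u: "u \<in> carrier M"
  obtains a b where "a \<in> carrier N" "b \<in> carrier N" "f u = mx N a \<oplus>\<^bsub>N\<^esub> my N b"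
  using ghostlyD(3)[OF f u socle_freeD[OF M u]] that unfolding radical_def by blast

lemma ghostly_relation:
  assumes f: "ghostly M N f" and uv: "u \<in> carrier M" "v \<in> carrier M" "mx M u = my M v"
  obtains a b c where "a \<in> carrier N" "b \<in> carrier N" "c \<in> carrier N"
    "f u = mx N (mx N a) \<oplus>\<^bsub>N\<^esub> my N b" "f v = mx N b \<oplus>\<^bsub>N\<^esub> my N (my N c)"
  using ghostlyD(4)[OF f uv] that unfolding syzygy_pairs_def by blast

end

text \<open>The composite \<open>h\<close> of three ghosts, for which a trace is to be found.\<close>

locale three_ghosts = truncated_algebra R k x y form
  for R :: "'r ring" (structure) and k x y form +
  fixes M0 :: "('r, 'a) module" and M1 :: "('r, 'b) module" and M2 :: "('r, 'c) module"
    and M3 :: "('r, 'd) module" and f1 f2 f3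
  assumes M0: "left_module R M0" and M1: "left_module R M1" and M2: "left_module R M2" and M3: "left_module R M3"
    and s0: "socle_free M0" and s1: "socle_free M1" and s2: "socle_free M2" and s3: "socle_free M3"
    and f1: "ghostly M0 M1 f1" and f2: "ghostly M1 M2 f2" and f3: "ghostly M2 M3 f3"
begin

definition "g = f3 \<circ> f2"
definition "h = f3 \<circ> (f2 \<circ> f1)"

lemma f_homs: "f1 \<in> lmod_hom R M0 M1" "f2 \<in> lmod_hom R M1 M2" "f3 \<in> lmod_hom R M2 M3"
  using f1 f2 f3 by (simp_all add: ghostlyD(1))

lemma g_hom: "g \<in> lmod_hom R M1 M3" unfolding g_def by (rule hom_comp[OF f_homs(2,3)])
lemma h_hom: "h \<in> lmod_hom R M0 M3" unfolding h_def by (rule hom_comp[OF hom_comp[OF f_homs(1,2)] f_homs(3)])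
lemma h_eq: "h u = g (f1 u)" by (simp add: g_def h_def)

lemma yx0: "u \<in> carrier M0 \<Longrightarrow> my M0 (mx M0 u) = mx M0 (my M0 u)"
  using lcomm[OF M0] x_closed y_closed by blast
lemma yx3: "u \<in> carrier M3 \<Longrightarrow> my M3 (mx M3 u) = mx M3 (my M3 u)"
  using lcomm[OF M3] x_closed y_closed by blast

lemmas simps0 = lm_rules[OF M0] x_closed y_closed yx0 cube_smult[OF M0] socle_freeD[OF M0 s0]
lemmas simps3 = lm_rules[OF M3] x_closed y_closed yx3 cube_smult[OF M3] socle_freeD[OF M3 s3]
lemmas ac0 = lm_add_comm[OF M0] lm_add_lcomm[OF M0]
lemmas ac3 = lm_add_comm[OF M3] lm_add_lcomm[OF M3]

lemma g_quadratic:
  assumes u: "u \<in> carrier M1"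
  obtains a b c where "a \<in> carrier M3" "b \<in> carrier M3" "c \<in> carrier M3"
    "g u = mx M3 (mx M3 a) \<oplus>\<^bsub>M3\<^esub> (mx M3 (my M3 b) \<oplus>\<^bsub>M3\<^esub> my M3 (my M3 c))"
proof -
  obtain p q where pq: "p \<in> carrier M2" "q \<in> carrier M2" "f2 u = mx M2 p \<oplus>\<^bsub>M2\<^esub> my M2 q"
    using ghostly_into_radical[OF f2 M1 s1 u] by metis
  obtain a b where ab: "a \<in> carrier M3" "b \<in> carrier M3" "f3 p = mx M3 a \<oplus>\<^bsub>M3\<^esub> my M3 b"
    using ghostly_into_radical[OF f3 M2 s2 pq(1)] by metis
  obtain c d where cd: "c \<in> carrier M3" "d \<in> carrier M3" "f3 q = mx M3 c \<oplus>\<^bsub>M3\<^esub> my M3 d"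
    using ghostly_into_radical[OF f3 M2 s2 pq(2)] by metis
  show thesis
  proof (rule that[of a "b \<oplus>\<^bsub>M3\<^esub> c" d])
    show "g u = mx M3 (mx M3 a) \<oplus>\<^bsub>M3\<^esub> (mx M3 (my M3 (b \<oplus>\<^bsub>M3\<^esub> c)) \<oplus>\<^bsub>M3\<^esub> my M3 (my M3 d))"
      by (simp add: g_def pq ab cd hom_add[OF f_homs(3)] hom_smult[OF f_homs(3)] lm_smult_closed[OF M2]
          simps3 ac3)
  qed (use ab cd in \<open>simp_all add: simps3\<close>)
qed

lemma h_cubic:
  assumes u: "u \<in> carrier M0"
  obtains a b where "a \<in> carrier M3" "b \<in> carrier M3"
    "h u = mx M3 (mx M3 (my M3 b)) \<oplus>\<^bsub>M3\<^esub> mx M3 (my M3 (my M3 a))"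
proof -
  obtain p q where pq: "p \<in> carrier M1" "q \<in> carrier M1" "f1 u = mx M1 p \<oplus>\<^bsub>M1\<^esub> my M1 q"
    using ghostly_into_radical[OF f1 M0 s0 u] by metis
  obtain a b c where p: "a \<in> carrier M3" "b \<in> carrier M3" "c \<in> carrier M3"
    "g p = mx M3 (mx M3 a) \<oplus>\<^bsub>M3\<^esub> (mx M3 (my M3 b) \<oplus>\<^bsub>M3\<^esub> my M3 (my M3 c))"
    using g_quadratic[OF pq(1)] by blast
  obtain a' b' c' where q: "a' \<in> carrier M3" "b' \<in> carrier M3" "c' \<in> carrier M3"
    "g q = mx M3 (mx M3 a') \<oplus>\<^bsub>M3\<^esub> (mx M3 (my M3 b') \<oplus>\<^bsub>M3\<^esub> my M3 (my M3 c'))"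
    using g_quadratic[OF pq(2)] by blast
  show thesis
  proof (rule that[of "c \<oplus>\<^bsub>M3\<^esub> b'" "b \<oplus>\<^bsub>M3\<^esub> a'"])
    show "h u = mx M3 (mx M3 (my M3 (b \<oplus>\<^bsub>M3\<^esub> a'))) \<oplus>\<^bsub>M3\<^esub> mx M3 (my M3 (my M3 (c \<oplus>\<^bsub>M3\<^esub> b')))"
      by (simp add: h_eq pq p q hom_add[OF g_hom] hom_smult[OF g_hom] lm_smult_closed[OF M1] simps3 ac3)
  qed (use p q in \<open>simp_all add: simps3\<close>)
qed

text \<open>The elements annihilated by \<open>J\<^sup>n\<^sup>+\<^sup>1\<close> are sent by a ghost to elements annihilated by \<open>J\<^sup>n\<close>, as a ghost
  kills those annihilated by \<open>J\<close>.\<close>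

lemma h_kills_third_socle:
  assumes u: "u \<in> carrier M0" and k1: "mx M0 (mx M0 (my M0 u)) = \<zero>\<^bsub>M0\<^esub>"
    and k2: "mx M0 (my M0 (my M0 u)) = \<zero>\<^bsub>M0\<^esub>"
  shows "h u = \<zero>\<^bsub>M3\<^esub>"
proof -
  note c1 = hom_closed[OF f_homs(1)] and c2 = hom_closed[OF f_homs(2)]
  note m1 = hom_smult[OF f_homs(1), symmetric] and m2 = hom_smult[OF f_homs(2), symmetric]
  have "f1 (mx M0 (mx M0 u)) = \<zero>\<^bsub>M1\<^esub>" "f1 (mx M0 (my M0 u)) = \<zero>\<^bsub>M1\<^esub>"
    "f1 (my M0 (my M0 u)) = \<zero>\<^bsub>M1\<^esub>"
    by (rule ghostly_kills_simple[OF f1 M1 s1]; simp add: simps0 u k1 k2)+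
  note e1 = this
  have "f2 (f1 (mx M0 u)) = \<zero>\<^bsub>M2\<^esub>" "f2 (f1 (my M0 u)) = \<zero>\<^bsub>M2\<^esub>"
    by (rule ghostly_kills_simple[OF f2 M2 s2]; simp add: simps0 u c1 m1 e1)+
  note e2 = this
  have "f3 (f2 (f1 u)) = \<zero>\<^bsub>M3\<^esub>"
    by (rule ghostly_kills_simple[OF f3 M3 s3]; simp add: x_closed y_closed u c1 c2 m1 m2 e2)
  then show ?thesis by (simp add: h_def)
qed

lemma h_kills_radical:
  assumes u: "u \<in> carrier M0" and v: "v \<in> carrier M0"
  shows "h (mx M0 u \<oplus>\<^bsub>M0\<^esub> my M0 v) = \<zero>\<^bsub>M3\<^esub>"
  by (rule h_kills_third_socle) (simp_all add: simps0 u v)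

text \<open>For \<open>f1 u = x\<^sup>2p + yw\<close> and \<open>f1 v = xw + y\<^sup>2q\<close>, the terms \<open>x\<^sup>2 g(p)\<close> and \<open>y\<^sup>2 g(q)\<close> vanish, because \<open>g\<close> has values
  in \<open>J\<^sup>2 M3\<close> and \<open>J\<^sup>4 M3 = 0\<close>. So \<open>h u\<close> and \<open>h v\<close> are \<open>y\<close> and \<open>x\<close> times the same quadratic value
  \<open>g(w) = x\<^sup>2a + xyb + y\<^sup>2c\<close>.\<close>

lemma h_relation:
  assumes u: "u \<in> carrier M0" and v: "v \<in> carrier M0" and uv: "mx M0 u = my M0 v"
  obtains a b c where "a \<in> carrier M3" "b \<in> carrier M3" "c \<in> carrier M3"
    "h u = mx M3 (mx M3 (my M3 a)) \<oplus>\<^bsub>M3\<^esub> mx M3 (my M3 (my M3 b))"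
    "h v = mx M3 (mx M3 (my M3 b)) \<oplus>\<^bsub>M3\<^esub> mx M3 (my M3 (my M3 c))"
proof -
  obtain p w q where pwq: "p \<in> carrier M1" "w \<in> carrier M1" "q \<in> carrier M1"
    "f1 u = mx M1 (mx M1 p) \<oplus>\<^bsub>M1\<^esub> my M1 w" "f1 v = mx M1 w \<oplus>\<^bsub>M1\<^esub> my M1 (my M1 q)"
    using ghostly_relation[OF f1 u v uv] by metis
  obtain a b c where w: "a \<in> carrier M3" "b \<in> carrier M3" "c \<in> carrier M3"
    "g w = mx M3 (mx M3 a) \<oplus>\<^bsub>M3\<^esub> (mx M3 (my M3 b) \<oplus>\<^bsub>M3\<^esub> my M3 (my M3 c))"
    using g_quadratic[OF pwq(2)] by blast
  have zero: "mx M3 (mx M3 (g t)) = \<zero>\<^bsub>M3\<^esub>" "my M3 (my M3 (g t)) = \<zero>\<^bsub>M3\<^esub>" if "t \<in> carrier M1" for t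
  proof -
    obtain a b c where t: "a \<in> carrier M3" "b \<in> carrier M3" "c \<in> carrier M3"
      "g t = mx M3 (mx M3 a) \<oplus>\<^bsub>M3\<^esub> (mx M3 (my M3 b) \<oplus>\<^bsub>M3\<^esub> my M3 (my M3 c))"
      using g_quadratic[OF \<open>t \<in> carrier M1\<close>] by blast
    show "mx M3 (mx M3 (g t)) = \<zero>\<^bsub>M3\<^esub>" "my M3 (my M3 (g t)) = \<zero>\<^bsub>M3\<^esub>"
      by (simp_all add: t simps3)
  qed
  show thesis
    by (rule that[of a b c])
      (simp_all add: w(1-3), simp_all add: h_eq pwq hom_add[OF g_hom] hom_smult[OF g_hom]
        lm_smult_closed[OF M1] x_closed y_closed zero, simp_all add: w simps3)
qed

text \<open>All four elements are annihilated by \<open>J\<^sup>3\<close>. For instance \<open>yu = -yv' = -xv\<close> gives \<open>x\<^sup>2yu = -x\<^sup>3v = 0\<close>, and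
  \<open>xy\<^sup>2u = y\<^sup>2(yu') = 0\<close>.\<close>

lemma h_kills_overlap:
  assumes c: "u \<in> carrier M0" "u' \<in> carrier M0" "v \<in> carrier M0" "v' \<in> carrier M0"
    and rel: "mx M0 u = my M0 u'" "mx M0 v = my M0 v'"
    and sum: "u \<oplus>\<^bsub>M0\<^esub> v' = \<zero>\<^bsub>M0\<^esub>"
  shows "h u = \<zero>\<^bsub>M3\<^esub> \<and> h u' = \<zero>\<^bsub>M3\<^esub> \<and> h v = \<zero>\<^bsub>M3\<^esub> \<and> h v' = \<zero>\<^bsub>M3\<^esub>"
proof -
  let ?x = "mx M0" and ?y = "my M0"
  have xyyu: "?x (?y (?y u)) = \<zero>\<^bsub>M0\<^esub>"
  proof -
    have "?x (?y (?y u)) = ?y (?y (?x u))" by (simp add: simps0 c)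
    then show ?thesis by (simp add: rel simps0 c)
  qed
  have yv': "?y u \<oplus>\<^bsub>M0\<^esub> ?x v = \<zero>\<^bsub>M0\<^esub>"
    using arg_cong[OF sum, of ?y] by (simp add: simps0 c rel(2))
  have xxyu: "?x (?x (?y u)) = \<zero>\<^bsub>M0\<^esub>"
    using arg_cong[OF yv', of "\<lambda>u. ?x (?x u)"] by (simp add: simps0 c)
  have xyyv': "?x (?y (?y v')) = \<zero>\<^bsub>M0\<^esub>"
    using arg_cong[OF sum, of "\<lambda>u. ?x (?y (?y u))"] by (simp add: simps0 c xyyu)
  have hu: "h u = \<zero>\<^bsub>M3\<^esub>" by (rule h_kills_third_socle[OF c(1) xxyu xyyu])
  have hu': "h u' = \<zero>\<^bsub>M3\<^esub>"
  proof (rule h_kills_third_socle[OF c(2)])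
    show "?x (?x (?y u')) = \<zero>\<^bsub>M0\<^esub>" by (simp add: rel(1)[symmetric] simps0 c)
    show "?x (?y (?y u')) = \<zero>\<^bsub>M0\<^esub>"
      using arg_cong[OF rel(1), of "\<lambda>u. ?x (?y u)"] by (simp add: simps0 c xxyu)
  qed
  have hv: "h v = \<zero>\<^bsub>M3\<^esub>"
  proof (rule h_kills_third_socle[OF c(3)])
    show "?x (?x (?y v)) = \<zero>\<^bsub>M0\<^esub>"
      using arg_cong[OF rel(2), of "\<lambda>u. ?x (?y u)"] by (simp add: simps0 c xyyv')
    show "?x (?y (?y v)) = \<zero>\<^bsub>M0\<^esub>"
      using arg_cong[OF rel(2), of "\<lambda>u. ?y (?y u)"] by (simp add: simps0 c)
  qed
  have "h u \<oplus>\<^bsub>M3\<^esub> h v' = \<zero>\<^bsub>M3\<^esub>"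
    using arg_cong[OF sum, of h] by (simp add: hom_add[OF h_hom] c hom_zero[OF h_hom M0 M3])
  then show ?thesis using hu hu' hv by (simp add: hom_closed[OF h_hom] c simps3)
qed

text \<open>The radical part is absorbed into the relations: with \<open>(u, u')\<close> also \<open>(u + yq, u' + xq)\<close> is a relation,
  and \<open>h\<close> does not see the difference.\<close>

lemma h_kills_overlap_radical:
  assumes c: "u \<in> carrier M0" "u' \<in> carrier M0" "v \<in> carrier M0" "v' \<in> carrier M0"
      "p \<in> carrier M0" "q \<in> carrier M0"
    and rel: "mx M0 u = my M0 u'" "mx M0 v = my M0 v'"
    and sum: "(u \<oplus>\<^bsub>M0\<^esub> v') \<oplus>\<^bsub>M0\<^esub> (mx M0 p \<oplus>\<^bsub>M0\<^esub> my M0 q) = \<zero>\<^bsub>M0\<^esub>"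
  shows "h u = \<zero>\<^bsub>M3\<^esub> \<and> h u' = \<zero>\<^bsub>M3\<^esub> \<and> h v = \<zero>\<^bsub>M3\<^esub> \<and> h v' = \<zero>\<^bsub>M3\<^esub>"
proof -
  let ?x = "mx M0" and ?y = "my M0"
  have hx: "h (?x t) = \<zero>\<^bsub>M3\<^esub>" and hy: "h (?y t) = \<zero>\<^bsub>M3\<^esub>" if "t \<in> carrier M0" for t
    using h_kills_radical[OF that, of "\<zero>\<^bsub>M0\<^esub>"] h_kills_radical[OF _ that, of "\<zero>\<^bsub>M0\<^esub>"] that
    by (simp_all add: simps0)
  have "h (u \<oplus>\<^bsub>M0\<^esub> ?y q) = \<zero>\<^bsub>M3\<^esub> \<and> h (u' \<oplus>\<^bsub>M0\<^esub> ?x q) = \<zero>\<^bsub>M3\<^esub> \<and>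
    h (v \<oplus>\<^bsub>M0\<^esub> ?y p) = \<zero>\<^bsub>M3\<^esub> \<and> h (v' \<oplus>\<^bsub>M0\<^esub> ?x p) = \<zero>\<^bsub>M3\<^esub>"
    by (rule h_kills_overlap) (use sum in \<open>simp_all add: simps0 c rel ac0\<close>)
  then show ?thesis
    by (simp add: hom_add[OF h_hom] c hx hy simps0 simps3 hom_closed[OF h_hom])
qed

definition "cubic b a = mx M3 (mx M3 (my M3 b)) \<oplus>\<^bsub>M3\<^esub> mx M3 (my M3 (my M3 a))"

lemma cubic_add: "a \<in> carrier M3 \<Longrightarrow> b \<in> carrier M3 \<Longrightarrow> a' \<in> carrier M3 \<Longrightarrow> b' \<in> carrier M3 \<Longrightarrow>
    cubic (b \<oplus>\<^bsub>M3\<^esub> b') (a \<oplus>\<^bsub>M3\<^esub> a') = cubic b a \<oplus>\<^bsub>M3\<^esub> cubic b' a'"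
  by (simp add: cubic_def simps3 ac3)

lemma cubic_smult:
  assumes "a \<in> carrier M3" "b \<in> carrier M3" "c \<in> carrier R"
  shows "cubic (c \<odot>\<^bsub>M3\<^esub> b) (c \<odot>\<^bsub>M3\<^esub> a) = c \<odot>\<^bsub>M3\<^esub> cubic b a"
proof -
  have "mx M3 (c \<odot>\<^bsub>M3\<^esub> u) = c \<odot>\<^bsub>M3\<^esub> (mx M3 u)" "my M3 (c \<odot>\<^bsub>M3\<^esub> u) = c \<odot>\<^bsub>M3\<^esub> (my M3 u)"
    if "u \<in> carrier M3" for u
    using lcomm[OF M3] x_closed y_closed that assms(3) by blast+
  then show ?thesis using assms by (simp add: cubic_def simps3)
qed

lemma cubic_zero: "cubic \<zero>\<^bsub>M3\<^esub> \<zero>\<^bsub>M3\<^esub> = \<zero>\<^bsub>M3\<^esub>"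
  by (simp add: cubic_def simps3)

lemma sc0: "c \<in> carrier R \<Longrightarrow> u \<in> carrier M0 \<Longrightarrow> mx M0 (c \<odot>\<^bsub>M0\<^esub> u) = c \<odot>\<^bsub>M0\<^esub> (mx M0 u)"
  "c \<in> carrier R \<Longrightarrow> u \<in> carrier M0 \<Longrightarrow> my M0 (c \<odot>\<^bsub>M0\<^esub> u) = c \<odot>\<^bsub>M0\<^esub> (my M0 u)"
  using lcomm[OF M0] x_closed y_closed by blast+

abbreviation "W2 \<equiv> module_sum M3 M3"
abbreviation "W3 \<equiv> module_sum M3 W2"

lemmas lmW = left_module_module_sum[OF M3 M3] left_module_module_sum[OF M3 left_module_module_sum[OF M3 M3]] left_module_module_sum[OF M0 M0]

definition "Rel = {(u, v). u \<in> carrier M0 \<and> v \<in> carrier M0 \<and> mx M0 u = my M0 v}"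

lemma RelD: "(u, v) \<in> Rel \<Longrightarrow> u \<in> carrier M0" "(u, v) \<in> Rel \<Longrightarrow> v \<in> carrier M0"
  "(u, v) \<in> Rel \<Longrightarrow> mx M0 u = my M0 v"
  by (auto simp: Rel_def)

lemma Rel_add: "(u, v) \<in> Rel \<Longrightarrow> (u', v') \<in> Rel \<Longrightarrow> (u \<oplus>\<^bsub>M0\<^esub> u', v \<oplus>\<^bsub>M0\<^esub> v') \<in> Rel"
  by (simp add: Rel_def simps0)

lemma Rel_smult: "(u, v) \<in> Rel \<Longrightarrow> c \<in> carrier R \<Longrightarrow> (c \<odot>\<^bsub>M0\<^esub> u, c \<odot>\<^bsub>M0\<^esub> v) \<in> Rel"
  by (simp add: Rel_def simps0 sc0)

lemma Rel_zero: "(\<zero>\<^bsub>M0\<^esub>, \<zero>\<^bsub>M0\<^esub>) \<in> Rel" by (simp add: Rel_def simps0)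

lemmas h_simps = hom_closed[OF h_hom] hom_add[OF h_hom] hom_smult[OF h_hom] hom_zero[OF h_hom M0 M3]

text \<open>The coefficients of \<open>h_relation\<close>, chosen linearly and equal to zero on the relations that \<open>h\<close> kills.
  The latter is what makes them compatible on overlapping relations.\<close>

lemma relation_coefficients:
  obtains A B C where "A \<in> linear_maps k (module_sum M0 M0) M3" "B \<in> linear_maps k (module_sum M0 M0) M3"
    "C \<in> linear_maps k (module_sum M0 M0) M3"
    "\<And>u v. (u, v) \<in> Rel \<Longrightarrow> h u = cubic (A (u, v)) (B (u, v)) \<and> h v = cubic (B (u, v)) (C (u, v))"
    "\<And>u v. (u, v) \<in> Rel \<Longrightarrow> h u = \<zero>\<^bsub>M3\<^esub> \<Longrightarrow> h v = \<zero>\<^bsub>M3\<^esub> \<Longrightarrow>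
       A (u, v) = \<zero>\<^bsub>M3\<^esub> \<and> B (u, v) = \<zero>\<^bsub>M3\<^esub> \<and> C (u, v) = \<zero>\<^bsub>M3\<^esub>"
proof -
  let ?D = "module_sum M0 M0"
  define \<Gamma> where "\<Gamma> = {((u, v), (a, b, c)). (u, v) \<in> Rel \<and> a \<in> carrier M3 \<and> b \<in> carrier M3 \<and> c \<in> carrier M3 \<and>
    h u = cubic a b \<and> h v = cubic b c}"
  define \<Gamma>0 where "\<Gamma>0 = {((u, v), (a, b, c)). (u, v) \<in> Rel \<and> h u = \<zero>\<^bsub>M3\<^esub> \<and> h v = \<zero>\<^bsub>M3\<^esub> \<and>
    a = \<zero>\<^bsub>M3\<^esub> \<and> b = \<zero>\<^bsub>M3\<^esub> \<and> c = \<zero>\<^bsub>M3\<^esub>}"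
  have G: "linear_relation k ?D W3 \<Gamma>"
    unfolding linear_relation_def \<Gamma>_def
    by (auto simp: Rel_zero Rel_add Rel_smult cubic_zero cubic_add cubic_smult simps3 h_simps k_closed
        dest: RelD)
      (simp_all add: h_simps RelD cubic_add cubic_smult k_closed)
  have G0: "linear_relation k ?D W3 \<Gamma>0"
    unfolding linear_relation_def \<Gamma>0_def
    by (auto simp: Rel_zero Rel_add Rel_smult simps3 h_simps k_closed dest: RelD)
      (simp_all add: h_simps RelD simps3 k_closed)
  have sub: "\<Gamma>0 \<subseteq> \<Gamma>" unfolding \<Gamma>_def \<Gamma>0_def by (auto simp: cubic_zero simps3)
  obtain f where f: "f \<in> linear_maps k ?D W3" "\<And>w. w \<in> Domain \<Gamma> \<Longrightarrow> (w, f w) \<in> \<Gamma>"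
    "\<And>w t. (w, t) \<in> \<Gamma>0 \<Longrightarrow> f w = t"
    by (rule linear_selection[OF lmW(3,2) ring_axioms k G G0 sub]) (auto simp: \<Gamma>0_def)
  have proj: "fst \<in> linear_maps k W3 M3" "fst \<circ> snd \<in> linear_maps k W3 M3" "snd \<circ> snd \<in> linear_maps k W3 M3"
    by (rule linear_mapsI; auto)+
  show thesis
  proof (rule that[of "fst \<circ> f" "(fst \<circ> snd) \<circ> f" "(snd \<circ> snd) \<circ> f"])
    fix u v assume uv: "(u, v) \<in> Rel"
    obtain a b c where "a \<in> carrier M3" "b \<in> carrier M3" "c \<in> carrier M3" "h u = cubic a b" "h v = cubic b c"
      using h_relation[OF RelD[OF uv]] unfolding cubic_def by blast
    then have "((u, v), (a, b, c)) \<in> \<Gamma>" using uv by (simp add: \<Gamma>_def)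
    then have "((u, v), f (u, v)) \<in> \<Gamma>" using f(2) by blast
    then show "h u = cubic ((fst \<circ> f) (u, v)) (((fst \<circ> snd) \<circ> f) (u, v)) \<and>
      h v = cubic (((fst \<circ> snd) \<circ> f) (u, v)) (((snd \<circ> snd) \<circ> f) (u, v))"
      unfolding \<Gamma>_def by auto
    show "(fst \<circ> f) (u, v) = \<zero>\<^bsub>M3\<^esub> \<and> ((fst \<circ> snd) \<circ> f) (u, v) = \<zero>\<^bsub>M3\<^esub> \<and> ((snd \<circ> snd) \<circ> f) (u, v) = \<zero>\<^bsub>M3\<^esub>"
      if "h u = \<zero>\<^bsub>M3\<^esub>" "h v = \<zero>\<^bsub>M3\<^esub>"
      using f(3)[of "(u, v)" "(\<zero>\<^bsub>M3\<^esub>, \<zero>\<^bsub>M3\<^esub>, \<zero>\<^bsub>M3\<^esub>)"] uv that by (simp add: \<Gamma>0_def)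
  qed (intro linear_maps_comp[OF f(1)] proj)+
qed

text \<open>On \<open>u + v' + xp + yq\<close>, where \<open>(u, u')\<close> and \<open>(v, v')\<close> are relations, let \<open>\<alpha>\<close> be \<open>B(u, u') + C(v, v')\<close> and let
  \<open>\<beta>\<close> be \<open>A(u, u') + B(v, v')\<close>; this is what \<open>\<alpha> u = B(u, u') = \<beta> u'\<close> asks for. If the element is zero, then \<open>h\<close>
  kills both relations and \<open>A\<close>, \<open>B\<close>, \<open>C\<close> vanish on them, so \<open>\<alpha>\<close> and \<open>\<beta>\<close> are well defined. They extend to
  all of \<open>M0\<close> because every value of \<open>h\<close> is cubic.\<close>

lemma cubic_coefficients:
  obtains \<alpha> \<beta> where "\<alpha> \<in> linear_maps k M0 M3" "\<beta> \<in> linear_maps k M0 M3"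
    "\<And>u. u \<in> carrier M0 \<Longrightarrow> h u = cubic (\<beta> u) (\<alpha> u)"
    "\<And>u v. (u, v) \<in> Rel \<Longrightarrow> \<alpha> u = \<beta> v"
    "\<And>u v. u \<in> carrier M0 \<Longrightarrow> v \<in> carrier M0 \<Longrightarrow> \<alpha> (mx M0 u \<oplus>\<^bsub>M0\<^esub> my M0 v) = \<zero>\<^bsub>M3\<^esub>"
    "\<And>u v. u \<in> carrier M0 \<Longrightarrow> v \<in> carrier M0 \<Longrightarrow> \<beta> (mx M0 u \<oplus>\<^bsub>M0\<^esub> my M0 v) = \<zero>\<^bsub>M3\<^esub>"
proof -
  let ?D = "module_sum M0 M0"
  obtain A B C where ABC: "A \<in> linear_maps k ?D M3" "B \<in> linear_maps k ?D M3" "C \<in> linear_maps k ?D M3"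
    and hAB: "\<And>u v. (u, v) \<in> Rel \<Longrightarrow> h u = cubic (A (u, v)) (B (u, v)) \<and> h v = cubic (B (u, v)) (C (u, v))"
    and van: "\<And>u v. (u, v) \<in> Rel \<Longrightarrow> h u = \<zero>\<^bsub>M3\<^esub> \<Longrightarrow> h v = \<zero>\<^bsub>M3\<^esub> \<Longrightarrow>
       A (u, v) = \<zero>\<^bsub>M3\<^esub> \<and> B (u, v) = \<zero>\<^bsub>M3\<^esub> \<and> C (u, v) = \<zero>\<^bsub>M3\<^esub>"
    by (rule relation_coefficients, rule that)
  have cl: "A (u, v) \<in> carrier M3" "B (u, v) \<in> carrier M3" "C (u, v) \<in> carrier M3" if "(u, v) \<in> Rel" for u v
    using linear_maps_closed[OF ABC(1)] linear_maps_closed[OF ABC(2)] linear_maps_closed[OF ABC(3)] RelD[OF that]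
    by simp_all
  have ad: "L (u \<oplus>\<^bsub>M0\<^esub> u', v \<oplus>\<^bsub>M0\<^esub> v') = L (u, v) \<oplus>\<^bsub>M3\<^esub> L (u', v')"
    if "L \<in> linear_maps k ?D M3" "(u, v) \<in> Rel" "(u', v') \<in> Rel" for L u v u' v'
    using linear_maps_add[OF that(1), of "(u, v)" "(u', v')"] that(2,3) by (simp add: RelD)
  have sm: "L (c \<odot>\<^bsub>M0\<^esub> u, c \<odot>\<^bsub>M0\<^esub> v) = c \<odot>\<^bsub>M3\<^esub> L (u, v)"
    if "L \<in> linear_maps k ?D M3" "(u, v) \<in> Rel" "c \<in> k" for L u v c
    using linear_maps_smult[OF that(1,3), of "(u, v)"] that(2) by (simp add: RelD)
  \<comment> \<open>The values \<open>(a, b)\<close> stand for \<open>(\<alpha> u, \<beta> u)\<close>.\<close>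
  define \<Gamma> where "\<Gamma> = {(u, (a, b)). u \<in> carrier M0 \<and> a \<in> carrier M3 \<and> b \<in> carrier M3 \<and> h u = cubic b a}"
  define \<Gamma>0 where "\<Gamma>0 = {((u \<oplus>\<^bsub>M0\<^esub> v') \<oplus>\<^bsub>M0\<^esub> (mx M0 p \<oplus>\<^bsub>M0\<^esub> my M0 q),
      (B (u, u') \<oplus>\<^bsub>M3\<^esub> C (v, v'), A (u, u') \<oplus>\<^bsub>M3\<^esub> B (v, v'))) | u u' v v' p q.
      (u, u') \<in> Rel \<and> (v, v') \<in> Rel \<and> p \<in> carrier M0 \<and> q \<in> carrier M0}"
  have \<Gamma>0I: "(w, (a, b)) \<in> \<Gamma>0" if "w = (u \<oplus>\<^bsub>M0\<^esub> v') \<oplus>\<^bsub>M0\<^esub> (mx M0 p \<oplus>\<^bsub>M0\<^esub> my M0 q)"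
    "a = B (u, u') \<oplus>\<^bsub>M3\<^esub> C (v, v')" "b = A (u, u') \<oplus>\<^bsub>M3\<^esub> B (v, v')"
    "(u, u') \<in> Rel" "(v, v') \<in> Rel" "p \<in> carrier M0" "q \<in> carrier M0" for w a b u u' v v' p q
    using that unfolding \<Gamma>0_def by blast
  have z: "A (\<zero>\<^bsub>M0\<^esub>, \<zero>\<^bsub>M0\<^esub>) = \<zero>\<^bsub>M3\<^esub>" "B (\<zero>\<^bsub>M0\<^esub>, \<zero>\<^bsub>M0\<^esub>) = \<zero>\<^bsub>M3\<^esub>" "C (\<zero>\<^bsub>M0\<^esub>, \<zero>\<^bsub>M0\<^esub>) = \<zero>\<^bsub>M3\<^esub>"
    using van[OF Rel_zero] h_simps(4) by simp_all
  have G: "linear_relation k M0 W2 \<Gamma>"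
    unfolding linear_relation_def \<Gamma>_def
    by (auto simp: cubic_zero cubic_add cubic_smult simps0 simps3 h_simps k_closed)
  have sub: "\<Gamma>0 \<subseteq> \<Gamma>"
  proof
    fix t assume "t \<in> \<Gamma>0"
    then obtain u u' v v' p q where t: "t = ((u \<oplus>\<^bsub>M0\<^esub> v') \<oplus>\<^bsub>M0\<^esub> (mx M0 p \<oplus>\<^bsub>M0\<^esub> my M0 q),
      (B (u, u') \<oplus>\<^bsub>M3\<^esub> C (v, v'), A (u, u') \<oplus>\<^bsub>M3\<^esub> B (v, v')))"
      "(u, u') \<in> Rel" "(v, v') \<in> Rel" "p \<in> carrier M0" "q \<in> carrier M0" unfolding \<Gamma>0_def by blast
    note c = RelD[OF t(2)] RelD[OF t(3)] t(4,5)
    have "h ((u \<oplus>\<^bsub>M0\<^esub> v') \<oplus>\<^bsub>M0\<^esub> (mx M0 p \<oplus>\<^bsub>M0\<^esub> my M0 q)) = h u \<oplus>\<^bsub>M3\<^esub> h v'"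
      using c h_kills_radical[OF t(4,5)]
      by (simp only: h_simps lm_add_closed[OF M0] lm_smult_closed[OF M0] lm_add_zero[OF M3] lm_add_closed[OF M3]
          x_closed y_closed)
    also have "\<dots> = cubic (A (u, u') \<oplus>\<^bsub>M3\<^esub> B (v, v')) (B (u, u') \<oplus>\<^bsub>M3\<^esub> C (v, v'))"
      using hAB[OF t(2)] hAB[OF t(3)] cl[OF t(2)] cl[OF t(3)] by (simp add: cubic_add)
    finally show "t \<in> \<Gamma>"
      unfolding t(1) \<Gamma>_def using c cl[OF t(2)] cl[OF t(3)] by (simp add: lm_add_closed[OF M0] lm_add_closed[OF M3] simps0(3) x_closed y_closed)
  qed
  have G0: "linear_relation k M0 W2 \<Gamma>0"
    unfolding linear_relation_def
  proof (intro conjI allI impI)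
    show "\<Gamma>0 \<subseteq> carrier M0 \<times> carrier W2" using sub unfolding \<Gamma>_def by auto
    show "(\<zero>\<^bsub>M0\<^esub>, \<zero>\<^bsub>W2\<^esub>) \<in> \<Gamma>0"
      using \<Gamma>0I[OF _ _ _ Rel_zero Rel_zero lm_zero_closed[OF M0] lm_zero_closed[OF M0]]
      by (simp add: simps0 simps3 z)
    fix w t assume "(w, t) \<in> \<Gamma>0"
    then obtain u u' v v' p q where t: "w = (u \<oplus>\<^bsub>M0\<^esub> v') \<oplus>\<^bsub>M0\<^esub> (mx M0 p \<oplus>\<^bsub>M0\<^esub> my M0 q)"
      "t = (B (u, u') \<oplus>\<^bsub>M3\<^esub> C (v, v'), A (u, u') \<oplus>\<^bsub>M3\<^esub> B (v, v'))"
      "(u, u') \<in> Rel" "(v, v') \<in> Rel" "p \<in> carrier M0" "q \<in> carrier M0" unfolding \<Gamma>0_def by blast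
    note c = RelD(1,2)[OF t(3)] RelD(1,2)[OF t(4)] t(5,6) cl[OF t(3)] cl[OF t(4)]
    { fix w' t' assume "(w', t') \<in> \<Gamma>0"
      then obtain u1 u1' v1 v1' p1 q1 where t1: "w' = (u1 \<oplus>\<^bsub>M0\<^esub> v1') \<oplus>\<^bsub>M0\<^esub> (mx M0 p1 \<oplus>\<^bsub>M0\<^esub> my M0 q1)"
        "t' = (B (u1, u1') \<oplus>\<^bsub>M3\<^esub> C (v1, v1'), A (u1, u1') \<oplus>\<^bsub>M3\<^esub> B (v1, v1'))"
        "(u1, u1') \<in> Rel" "(v1, v1') \<in> Rel" "p1 \<in> carrier M0" "q1 \<in> carrier M0" unfolding \<Gamma>0_def by blast
      note c1 = RelD(1,2)[OF t1(3)] RelD(1,2)[OF t1(4)] t1(5,6) cl[OF t1(3)] cl[OF t1(4)]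
      show "(w \<oplus>\<^bsub>M0\<^esub> w', t \<oplus>\<^bsub>W2\<^esub> t') \<in> \<Gamma>0"
        unfolding t(2) t1(2) module_sum_simps
      proof (rule \<Gamma>0I[OF _ _ _ Rel_add[OF t(3) t1(3)] Rel_add[OF t(4) t1(4)]
            lm_add_closed[OF M0 t(5) t1(5)] lm_add_closed[OF M0 t(6) t1(6)]])
        show "w \<oplus>\<^bsub>M0\<^esub> w' = ((u \<oplus>\<^bsub>M0\<^esub> u1) \<oplus>\<^bsub>M0\<^esub> (v' \<oplus>\<^bsub>M0\<^esub> v1')) \<oplus>\<^bsub>M0\<^esub>
            (mx M0 (p \<oplus>\<^bsub>M0\<^esub> p1) \<oplus>\<^bsub>M0\<^esub> my M0 (q \<oplus>\<^bsub>M0\<^esub> q1))"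
          by (simp add: t(1) t1(1) c c1 simps0 ac0)
      qed (simp_all add: c c1 ad[OF ABC(1)] ad[OF ABC(2)] ad[OF ABC(3)] t(3,4) t1(3,4)
          lm_add_closed[OF M3] lm_add_assoc[OF M3] ac3) }
    { fix d assume d: "d \<in> k"
      show "(d \<odot>\<^bsub>M0\<^esub> w, d \<odot>\<^bsub>W2\<^esub> t) \<in> \<Gamma>0"
        unfolding t(2) module_sum_simps
      proof (rule \<Gamma>0I[OF _ _ _ Rel_smult[OF t(3) k_closed[OF d]] Rel_smult[OF t(4) k_closed[OF d]]
            lm_smult_closed[OF M0 k_closed[OF d] t(5)] lm_smult_closed[OF M0 k_closed[OF d] t(6)]])
      qed (simp_all add: t(1) c k_closed[OF d] simps0 sc0 sm[OF ABC(1) _ d] sm[OF ABC(2) _ d] sm[OF ABC(3) _ d]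
          t(3,4) lm_smult_add[OF M3]) }
  qed
  have fun0: "t = \<zero>\<^bsub>W2\<^esub>" if t0: "(\<zero>\<^bsub>M0\<^esub>, t) \<in> \<Gamma>0" for t
  proof -
    obtain u u' v v' p q where t: "\<zero>\<^bsub>M0\<^esub> = (u \<oplus>\<^bsub>M0\<^esub> v') \<oplus>\<^bsub>M0\<^esub> (mx M0 p \<oplus>\<^bsub>M0\<^esub> my M0 q)"
      "t = (B (u, u') \<oplus>\<^bsub>M3\<^esub> C (v, v'), A (u, u') \<oplus>\<^bsub>M3\<^esub> B (v, v'))"
      "(u, u') \<in> Rel" "(v, v') \<in> Rel" "p \<in> carrier M0" "q \<in> carrier M0" using t0 unfolding \<Gamma>0_def by blast
    have "h u = \<zero>\<^bsub>M3\<^esub> \<and> h u' = \<zero>\<^bsub>M3\<^esub> \<and> h v = \<zero>\<^bsub>M3\<^esub> \<and> h v' = \<zero>\<^bsub>M3\<^esub>"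
      by (rule h_kills_overlap_radical[OF RelD(1,2)[OF t(3)] RelD(1,2)[OF t(4)] t(5,6) RelD(3)[OF t(3)]
            RelD(3)[OF t(4)] t(1)[symmetric]])
    then show ?thesis using van[OF t(3)] van[OF t(4)] by (simp add: t(2) simps3)
  qed
  obtain f where f: "f \<in> linear_maps k M0 W2" "\<And>w. w \<in> Domain \<Gamma> \<Longrightarrow> (w, f w) \<in> \<Gamma>"
    "\<And>w t. (w, t) \<in> \<Gamma>0 \<Longrightarrow> f w = t"
    by (rule linear_selection[OF M0 lmW(1) ring_axioms k G G0 sub fun0], assumption, rule that)
  have proj: "fst \<in> linear_maps k W2 M3" "snd \<in> linear_maps k W2 M3" by (rule linear_mapsI; auto)+
  show thesis
  proof (rule that[of "fst \<circ> f" "snd \<circ> f"])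
    show "h u = cubic ((snd \<circ> f) u) ((fst \<circ> f) u)" if u: "u \<in> carrier M0" for u
    proof -
      obtain a b where "a \<in> carrier M3" "b \<in> carrier M3" "h u = cubic b a"
        using h_cubic[OF u] unfolding cubic_def by blast
      then have "(u, (a, b)) \<in> \<Gamma>" using u by (simp add: \<Gamma>_def)
      then have "u \<in> Domain \<Gamma>" by blast
      then have "(u, f u) \<in> \<Gamma>" by (rule f(2))
      then show ?thesis unfolding \<Gamma>_def by auto
    qed
    show "(fst \<circ> f) u = (snd \<circ> f) v" if uv: "(u, v) \<in> Rel" for u v
    proof -
      note c = RelD(1,2)[OF uv] cl[OF uv]
      have "(u, (B (u, v), A (u, v))) \<in> \<Gamma>0"
        by (rule \<Gamma>0I[OF _ _ _ uv Rel_zero lm_zero_closed[OF M0] lm_zero_closed[OF M0]])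
          (simp_all add: c simps0 simps3 z)
      moreover have "(v, (C (u, v), B (u, v))) \<in> \<Gamma>0"
        by (rule \<Gamma>0I[OF _ _ _ Rel_zero uv lm_zero_closed[OF M0] lm_zero_closed[OF M0]])
          (simp_all add: c simps0 simps3 z)
      ultimately show ?thesis using f(3) by simp
    qed
    fix u v assume u: "u \<in> carrier M0" and v: "v \<in> carrier M0"
    have "(mx M0 u \<oplus>\<^bsub>M0\<^esub> my M0 v, (\<zero>\<^bsub>M3\<^esub>, \<zero>\<^bsub>M3\<^esub>)) \<in> \<Gamma>0"
      by (rule \<Gamma>0I[OF _ _ _ Rel_zero Rel_zero u v]) (simp_all add: simps0 simps3 z u v)
    then show "(fst \<circ> f) (mx M0 u \<oplus>\<^bsub>M0\<^esub> my M0 v) = \<zero>\<^bsub>M3\<^esub>"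
      "(snd \<circ> f) (mx M0 u \<oplus>\<^bsub>M0\<^esub> my M0 v) = \<zero>\<^bsub>M3\<^esub>"
      using f(3) by simp_all
  qed (intro linear_maps_comp[OF f(1)] proj)+
qed

text \<open>\<open>\<Lambda>(xu + yv) = \<alpha> u + \<beta> v\<close> is well defined since \<open>xu + yv = 0\<close> makes \<open>(u, -v)\<close> a relation. As \<open>\<Lambda>\<close> vanishes on
  \<open>J\<^sup>2 M0\<close> and \<open>x\<^sup>2y\<^sup>2\<close> kills \<open>M3\<close>, the trace of \<open>\<Lambda>\<close> at \<open>u\<close> reduces to \<open>x\<^sup>2y \<Lambda>(yu) + xy\<^sup>2 \<Lambda>(xu) = h u\<close>.\<close>

lemma h_traced: "traced M0 M3 h"
proof -
  obtain \<alpha> \<beta> where \<alpha>: "\<alpha> \<in> linear_maps k M0 M3" and \<beta>: "\<beta> \<in> linear_maps k M0 M3"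
    and h: "\<And>u. u \<in> carrier M0 \<Longrightarrow> h u = cubic (\<beta> u) (\<alpha> u)"
    and rel: "\<And>u v. (u, v) \<in> Rel \<Longrightarrow> \<alpha> u = \<beta> v"
    and \<alpha>0: "\<And>u v. u \<in> carrier M0 \<Longrightarrow> v \<in> carrier M0 \<Longrightarrow> \<alpha> (mx M0 u \<oplus>\<^bsub>M0\<^esub> my M0 v) = \<zero>\<^bsub>M3\<^esub>"
    and \<beta>0: "\<And>u v. u \<in> carrier M0 \<Longrightarrow> v \<in> carrier M0 \<Longrightarrow> \<beta> (mx M0 u \<oplus>\<^bsub>M0\<^esub> my M0 v) = \<zero>\<^bsub>M3\<^esub>"
    by (rule cubic_coefficients, rule that)
  note lc = linear_maps_closed[OF \<alpha>] linear_maps_closed[OF \<beta>] linear_maps_add[OF \<alpha>] linear_maps_add[OF \<beta>]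
    linear_maps_smult[OF \<alpha>] linear_maps_smult[OF \<beta>] linear_maps_zero[OF \<alpha> M0 M3] linear_maps_zero[OF \<beta> M0 M3]
  define \<Gamma>0 where "\<Gamma>0 = {(mx M0 u \<oplus>\<^bsub>M0\<^esub> my M0 v, \<alpha> u \<oplus>\<^bsub>M3\<^esub> \<beta> v) | u v. u \<in> carrier M0 \<and> v \<in> carrier M0}"
  have \<Gamma>0I: "(w, t) \<in> \<Gamma>0" if "w = mx M0 u \<oplus>\<^bsub>M0\<^esub> my M0 v" "t = \<alpha> u \<oplus>\<^bsub>M3\<^esub> \<beta> v" "u \<in> carrier M0" "v \<in> carrier M0" for w t u v
    using that unfolding \<Gamma>0_def by blast
  have full: "linear_relation k M0 M3 (carrier M0 \<times> carrier M3)"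
    by (auto simp: linear_relation_def simps0 simps3 k_closed)
  have sub: "\<Gamma>0 \<subseteq> carrier M0 \<times> carrier M3" by (auto simp: \<Gamma>0_def simps0 simps3 lc)
  have G0: "linear_relation k M0 M3 \<Gamma>0"
    unfolding linear_relation_def
  proof (intro conjI allI impI)
    show "\<Gamma>0 \<subseteq> carrier M0 \<times> carrier M3" by (rule sub)
    show "(\<zero>\<^bsub>M0\<^esub>, \<zero>\<^bsub>M3\<^esub>) \<in> \<Gamma>0"
      by (rule \<Gamma>0I[OF _ _ lm_zero_closed[OF M0] lm_zero_closed[OF M0]]) (simp_all add: simps0 simps3 lc)
    fix w t assume "(w, t) \<in> \<Gamma>0"
    then obtain u v where 1: "w = mx M0 u \<oplus>\<^bsub>M0\<^esub> my M0 v" "t = \<alpha> u \<oplus>\<^bsub>M3\<^esub> \<beta> v" "u \<in> carrier M0" "v \<in> carrier M0"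
      unfolding \<Gamma>0_def by blast
    { fix w' t' assume "(w', t') \<in> \<Gamma>0"
      then obtain u' v' where 2: "w' = mx M0 u' \<oplus>\<^bsub>M0\<^esub> my M0 v'" "t' = \<alpha> u' \<oplus>\<^bsub>M3\<^esub> \<beta> v'" "u' \<in> carrier M0" "v' \<in> carrier M0"
        unfolding \<Gamma>0_def by blast
      show "(w \<oplus>\<^bsub>M0\<^esub> w', t \<oplus>\<^bsub>M3\<^esub> t') \<in> \<Gamma>0"
        by (rule \<Gamma>0I[OF _ _ lm_add_closed[OF M0 1(3) 2(3)] lm_add_closed[OF M0 1(4) 2(4)]])
          (simp_all add: 1 2 simps0 ac0 lc lm_rules[OF M3] ac3) }
    { fix d assume d: "d \<in> k"
      show "(d \<odot>\<^bsub>M0\<^esub> w, d \<odot>\<^bsub>M3\<^esub> t) \<in> \<Gamma>0"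
        by (rule \<Gamma>0I[OF _ _ lm_smult_closed[OF M0 k_closed[OF d] 1(3)] lm_smult_closed[OF M0 k_closed[OF d] 1(4)]])
          (simp_all add: 1 simps0 sc0 k_closed[OF d] d lc lm_smult_add[OF M3]) }
  qed
  have fun0: "t = \<zero>\<^bsub>M3\<^esub>" if t0: "(\<zero>\<^bsub>M0\<^esub>, t) \<in> \<Gamma>0" for t
  proof -
    obtain u v where 1: "\<zero>\<^bsub>M0\<^esub> = mx M0 u \<oplus>\<^bsub>M0\<^esub> my M0 v" "t = \<alpha> u \<oplus>\<^bsub>M3\<^esub> \<beta> v" "u \<in> carrier M0" "v \<in> carrier M0"
      using t0 unfolding \<Gamma>0_def by blast
    have "mx M0 u = \<ominus>\<^bsub>M0\<^esub> (my M0 v)"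
      using abelian_group.minus_equality[OF lm_abelian[OF M0] 1(1)[symmetric]] 1(3,4) by (simp add: simps0)
    then have "(u, \<ominus>\<^bsub>M0\<^esub> v) \<in> Rel" using 1(3,4) by (simp add: Rel_def simps0 lm_smult_neg[OF M0])
    from rel[OF this] have "\<alpha> u = \<ominus>\<^bsub>M3\<^esub> \<beta> v" using linear_maps_neg[OF \<beta> M0 M3 1(4)] by simp
    then show ?thesis using 1(3,4) by (simp add: 1(2) lc lm_add_comm[OF M3] lm_neg_closed[OF M3] lm_add_neg[OF M3])
  qed
  obtain \<Lambda> where \<Lambda>: "\<Lambda> \<in> linear_maps k M0 M3" and val: "\<And>w t. (w, t) \<in> \<Gamma>0 \<Longrightarrow> \<Lambda> w = t"
    by (rule linear_selection[OF M0 M3 ring_axioms k full G0 sub fun0], assumption, rule that)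
  have \<Lambda>x: "\<Lambda> (mx M0 u) = \<alpha> u" and \<Lambda>y: "\<Lambda> (my M0 u) = \<beta> u"
    and rad: "\<alpha> (mx M0 u) = \<zero>\<^bsub>M3\<^esub>" "\<alpha> (my M0 u) = \<zero>\<^bsub>M3\<^esub>"
      "\<beta> (mx M0 u) = \<zero>\<^bsub>M3\<^esub>" "\<beta> (my M0 u) = \<zero>\<^bsub>M3\<^esub>" if u: "u \<in> carrier M0" for u
    using val[OF \<Gamma>0I[OF refl refl u lm_zero_closed[OF M0]]] val[OF \<Gamma>0I[OF refl refl lm_zero_closed[OF M0] u]]
      \<alpha>0[OF u lm_zero_closed[OF M0]] \<alpha>0[OF lm_zero_closed[OF M0] u]
      \<beta>0[OF u lm_zero_closed[OF M0]] \<beta>0[OF lm_zero_closed[OF M0] u] u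
    by (simp_all add: simps0 lc lm_rules[OF M3])
  have "\<forall>u\<in>carrier M0. h u = Tr M0 M3 \<Lambda> u"
    by (simp add: Tr_def trace1_def h cubic_def simps0 simps3 \<Lambda>x \<Lambda>y rad lc linear_maps_closed[OF \<Lambda>]
        linear_maps_zero[OF \<Lambda> M0 M3])
  then show ?thesis using \<Lambda> unfolding traced_def by blast
qed

end

section \<open>Reduction to modules without free summands\<close>

lemma inj_on_kernel:
  assumes A: "left_module R A" and B: "left_module R B" and f: "f \<in> lmod_hom R A B"
    and ker: "\<And>u. u \<in> carrier A \<Longrightarrow> f u = \<zero>\<^bsub>B\<^esub> \<Longrightarrow> u = \<zero>\<^bsub>A\<^esub>"
  shows "inj_on f (carrier A)"
proof (rule inj_onI)
  fix u v assume u: "u \<in> carrier A" and v: "v \<in> carrier A" and "f u = f v"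
  then have "f (u \<ominus>\<^bsub>A\<^esub> v) = \<zero>\<^bsub>B\<^esub>"
    by (simp add: hom_minus[OF f A B] lm_minus_self[OF B] hom_closed[OF f])
  then show "u = v" using ker[of "u \<ominus>\<^bsub>A\<^esub> v"] lm_minus_eq_zero[OF A u v] lm_minus_closed[OF A u v] by simp
qed

lemma is_Omega_nat_left_module:
  assumes "is_Omega_nat R n M N"
  shows "left_module R M \<longleftrightarrow> left_module R N"
  using assms
proof (induction n arbitrary: N)
  case (Suc n)
  then obtain L where "is_Omega_nat R n M L" "is_Omega R L N" by auto
  then show ?case using Suc.IH unfolding is_Omega_def Omega_seq_def short_exact_def by blast
qed simp

context truncated_algebra
begin

lemma ghostly_comp_left:
  assumes f: "ghostly M N f" and N: "left_module R N" and g: "g \<in> lmod_hom R N Q"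
  shows "ghostly M Q (g \<circ> f)"
proof -
  note s = hom_add[OF g] hom_smult[OF g] lm_smult_closed[OF N] x_closed y_closed
  have "g u \<in> top_part Q" if "u \<in> top_part N" for u
    using that hom_closed[OF g] unfolding top_part_def by (auto simp: s)
  moreover have "g u \<in> radical Q" if "u \<in> radical N" for u
    using that hom_closed[OF g] unfolding radical_def by (force simp: s)
  moreover have "(g u, g v) \<in> syzygy_pairs Q" if uv: "(u, v) \<in> syzygy_pairs N" for u v
  proof -
    obtain a b c where "a \<in> carrier N" "b \<in> carrier N" "c \<in> carrier N"
      "u = mx N (mx N a) \<oplus>\<^bsub>N\<^esub> my N b" "v = mx N b \<oplus>\<^bsub>N\<^esub> my N (my N c)"
      using uv unfolding syzygy_pairs_def by blast
    then show ?thesis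
      unfolding syzygy_pairs_def using hom_closed[OF g]
      by (intro CollectI exI[of _ "g a"] exI[of _ "g b"] exI[of _ "g c"]) (simp add: s)
  qed
  ultimately show ?thesis
    using ghostlyD[OF f] hom_comp[OF _ g] unfolding ghostly_def by simp
qed

lemma ghostly_comp_right:
  assumes f: "ghostly M N f" and L: "left_module R L" and M: "left_module R M" and g: "g \<in> lmod_hom R L M"
  shows "ghostly L N (f \<circ> g)"
proof -
  note s = hom_smult[OF g, symmetric] lm_smult_closed[OF L] x_closed y_closed hom_zero[OF g L M]
  note f' = ghostlyD[OF f]
  show ?thesis
    unfolding ghostly_def comp_apply
  proof (intro conjI ballI impI)
    fix u assume u: "u \<in> carrier L"
    note c = hom_closed[OF g]
    show "f (g u) \<in> top_part N" if "mx L u = \<zero>\<^bsub>L\<^esub>" "my L u = \<zero>\<^bsub>L\<^esub>"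
      by (rule f'(2)[OF c[OF u]]) (simp_all add: s u that)
    show "f (g u) \<in> radical N" if "mx L (mx L (my L (my L u))) = \<zero>\<^bsub>L\<^esub>"
      by (rule f'(3)[OF c[OF u]]) (simp_all add: s u that)
    show "(f (g u), f (g v)) \<in> syzygy_pairs N" if "v \<in> carrier L" "mx L u = my L v" for v
      by (rule f'(4)[OF c[OF u] c[OF that(1)]]) (simp add: s u that)
  qed (rule hom_comp[OF g f'(1), unfolded comp_def[of f g]])
qed

lemma yx_comm: "left_module R M \<Longrightarrow> u \<in> carrier M \<Longrightarrow> my M (mx M u) = mx M (my M u)"
  by (rule lcomm[OF _ y_closed x_closed])

text \<open>Let \<open>t\<close> be a \<open>k\<close>-linear map with \<open>s t(v) = v\<close> for all multiples \<open>v\<close> of \<open>s = x\<^sup>2y\<^sup>2\<close>, and \<open>e\<close> its trace. Then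
  \<open>s e(u) = s t(s u) = s u\<close>, since \<open>s\<close> kills the other summands. Hence \<open>s\<close> annihilates the image of
  \<open>p = 1 - e\<close>, while \<open>p\<close> and the identity differ by a trace.\<close>

lemma socle_free_part:
  assumes M: "left_module R M"
  obtains M' p where "left_module R M'" "socle_free M'" "p \<in> lmod_hom R M M'" "id \<in> lmod_hom R M' M"
    "p \<in> lmod_hom R M M" "traced M M (\<lambda>u. u \<ominus>\<^bsub>M\<^esub> p u)"
proof -
  note r = lm_rules[OF M] x_closed y_closed yx_comm[OF M] cube_smult[OF M]
  let ?s = "x \<otimes> (x \<otimes> (y \<otimes> y))"
  have s_closed: "?s \<in> carrier R" by (simp add: x_closed y_closed)
  have s: "?s \<odot>\<^bsub>M\<^esub> u = mx M (mx M (my M (my M u)))" if "u \<in> carrier M" for u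
    using that by (simp add: r)
  obtain t where t: "t \<in> linear_maps k M M"
    and st: "\<And>v. v \<in> (\<lambda>u. ?s \<odot>\<^bsub>M\<^esub> u) ` carrier M \<Longrightarrow> ?s \<odot>\<^bsub>M\<^esub> t v = v"
    by (rule linear_section[OF M M hom_linear[OF smult_hom[OF M s_closed]]], rule that)
  note tc = linear_maps_closed[OF t]
  let ?e = "Tr M M t"
  have e: "?e \<in> lmod_hom R M M" by (rule Tr_hom[OF M M t])
  define p where "p u = u \<ominus>\<^bsub>M\<^esub> ?e u" for u
  have p: "p \<in> lmod_hom R M M" unfolding p_def using hom_diff[OF M M hom_id e] by simp
  have se: "?s \<odot>\<^bsub>M\<^esub> ?e u = ?s \<odot>\<^bsub>M\<^esub> u" if u: "u \<in> carrier M" for u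
  proof -
    have "?s \<odot>\<^bsub>M\<^esub> ?e u = ?s \<odot>\<^bsub>M\<^esub> t (?s \<odot>\<^bsub>M\<^esub> u)"
      using u by (simp add: Tr_def trace1_def r tc)
    then show ?thesis using st u by simp
  qed
  let ?M' = "M\<lparr>carrier := p ` carrier M\<rparr>"
  have M': "left_module R ?M'"
    by (rule left_module_submodule[OF M])
      (use hom_closed[OF p] hom_zero[OF p M M, symmetric] lm_zero_closed[OF M] hom_image_add[OF M p]
        hom_image_smult[OF M p] in \<open>blast+\<close>)
  have "socle_free ?M'"
    unfolding socle_free_def
  proof
    fix v assume "v \<in> carrier ?M'"
    then obtain u where u: "u \<in> carrier M" "v = p u" by auto
    have "?s \<odot>\<^bsub>M\<^esub> v = \<zero>\<^bsub>M\<^esub>"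
      using u(1) unfolding u(2) p_def
      by (simp only: lm_smult_minus[OF M] s_closed hom_closed[OF e] se lm_minus_self[OF M] lm_smult_closed[OF M])
    then show "mx ?M' (mx ?M' (my ?M' (my ?M' v))) = \<zero>\<^bsub>?M'\<^esub>"
      using s[of v] u hom_closed[OF p] by simp
  qed
  moreover have "p \<in> lmod_hom R M ?M'" using p by (auto simp: lmod_hom_def)
  moreover have "id \<in> lmod_hom R ?M' M" using hom_closed[OF p] by (auto simp: lmod_hom_def)
  moreover have "traced M M ?e" unfolding traced_def using t by blast
  then have "traced M M (\<lambda>u. u \<ominus>\<^bsub>M\<^esub> p u)"
  proof (rule traced_cong)
    fix u assume u: "u \<in> carrier M"
    have "?e u \<oplus>\<^bsub>M\<^esub> p u = p u \<oplus>\<^bsub>M\<^esub> ?e u" using u hom_closed[OF e] hom_closed[OF p] lm_add_comm[OF M] by blast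
    also have "\<dots> = u" unfolding p_def by (rule lm_minus_add_cancel[OF M u hom_closed[OF e u]])
    finally show "u \<ominus>\<^bsub>M\<^esub> p u = ?e u"
      using u hom_closed[OF e] hom_closed[OF p] by (simp add: lm_minus_eq_iff[OF M])
  qed
  ultimately show thesis using that M' p by blast
qed

definition trace_equal :: "('r, 'm) module \<Rightarrow> ('r, 'n) module \<Rightarrow> ('m \<Rightarrow> 'n) \<Rightarrow> ('m \<Rightarrow> 'n) \<Rightarrow> bool" where
  "trace_equal M N f g \<longleftrightarrow> traced M N (\<lambda>u. f u \<ominus>\<^bsub>N\<^esub> g u)"

text \<open>Used to insert a projection \<open>p\<close> after every map of a composite without changing its stable class.\<close>

lemma trace_equal_step:
  assumes M: "left_module R M" and N: "left_module R N" and Q: "left_module R Q"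
    and fg: "trace_equal M N f g" "f \<in> lmod_hom R M N" "g \<in> lmod_hom R M N" and h: "h \<in> lmod_hom R N Q"
    and p: "traced Q Q (\<lambda>u. u \<ominus>\<^bsub>Q\<^esub> p u)" "p \<in> lmod_hom R Q Q"
  shows "trace_equal M Q (h \<circ> f) (p \<circ> (h \<circ> g))"
proof -
  have hg: "h \<circ> g \<in> lmod_hom R M Q" by (rule hom_comp[OF fg(3) h])
  have "traced M Q (\<lambda>u. (h \<circ> (\<lambda>u. f u \<ominus>\<^bsub>N\<^esub> g u)) u \<oplus>\<^bsub>Q\<^esub> ((\<lambda>u. u \<ominus>\<^bsub>Q\<^esub> p u) \<circ> (h \<circ> g)) u)"
    by (intro traced_add[OF M Q] traced_comp_left[OF M N _ h] traced_comp_right[OF M p(1) hg])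
      (use fg(1) in \<open>simp add: trace_equal_def\<close>)
  then show ?thesis
    unfolding trace_equal_def
  proof (rule traced_cong)
    fix u assume u: "u \<in> carrier M"
    let ?a = "h (f u)" and ?b = "h (g u)"
    have c: "?a \<in> carrier Q" "?b \<in> carrier Q" "p ?b \<in> carrier Q"
      using u hom_closed[OF fg(2)] hom_closed[OF fg(3)] hom_closed[OF h] hom_closed[OF p(2)] by auto
    have "(?a \<ominus>\<^bsub>Q\<^esub> ?b) \<oplus>\<^bsub>Q\<^esub> (?b \<ominus>\<^bsub>Q\<^esub> p ?b) = ?a \<ominus>\<^bsub>Q\<^esub> p ?b"
      using c by (simp add: lm_minus_eq_iff[OF Q, THEN iffD2] lm_rules[OF Q] eq_commute[of _ "?a \<ominus>\<^bsub>Q\<^esub> p ?b"]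
          lm_minus_eq_iff[OF Q] lm_minus_add_cancel[OF Q])
    then show "(h \<circ> f) u \<ominus>\<^bsub>Q\<^esub> (p \<circ> (h \<circ> g)) u =
      (h \<circ> (\<lambda>u. f u \<ominus>\<^bsub>N\<^esub> g u)) u \<oplus>\<^bsub>Q\<^esub> ((\<lambda>u. u \<ominus>\<^bsub>Q\<^esub> p u) \<circ> (h \<circ> g)) u"
      using u by (simp add: hom_minus[OF h N Q] hom_closed[OF fg(2)] hom_closed[OF fg(3)])
  qed
qed

text \<open>Up to traces, the composite does not change if each module is replaced by its socle-free part, and
  there \<open>three_ghosts\<close> applies.\<close>

theorem ghostly_triple_traced:
  assumes M0: "left_module R M0" and M1: "left_module R M1" and M2: "left_module R M2" and M3: "left_module R M3"
    and f1: "ghostly M0 M1 f1" and f2: "ghostly M1 M2 f2" and f3: "ghostly M2 M3 f3"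
  shows "traced M0 M3 (f3 \<circ> (f2 \<circ> f1))"
proof -
  obtain M0' p0 where 0: "left_module R M0'" "socle_free M0'" "p0 \<in> lmod_hom R M0 M0'" "id \<in> lmod_hom R M0' M0"
    "p0 \<in> lmod_hom R M0 M0" "traced M0 M0 (\<lambda>u. u \<ominus>\<^bsub>M0\<^esub> p0 u)" by (rule socle_free_part[OF M0], rule that)
  obtain M1' p1 where 1: "left_module R M1'" "socle_free M1'" "p1 \<in> lmod_hom R M1 M1'" "id \<in> lmod_hom R M1' M1"
    "p1 \<in> lmod_hom R M1 M1" "traced M1 M1 (\<lambda>u. u \<ominus>\<^bsub>M1\<^esub> p1 u)" by (rule socle_free_part[OF M1], rule that)
  obtain M2' p2 where 2: "left_module R M2'" "socle_free M2'" "p2 \<in> lmod_hom R M2 M2'" "id \<in> lmod_hom R M2' M2"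
    "p2 \<in> lmod_hom R M2 M2" "traced M2 M2 (\<lambda>u. u \<ominus>\<^bsub>M2\<^esub> p2 u)" by (rule socle_free_part[OF M2], rule that)
  obtain M3' p3 where 3: "left_module R M3'" "socle_free M3'" "p3 \<in> lmod_hom R M3 M3'" "id \<in> lmod_hom R M3' M3"
    "p3 \<in> lmod_hom R M3 M3" "traced M3 M3 (\<lambda>u. u \<ominus>\<^bsub>M3\<^esub> p3 u)" by (rule socle_free_part[OF M3], rule that)
  have h: "f1 \<in> lmod_hom R M0 M1" "f2 \<in> lmod_hom R M1 M2" "f3 \<in> lmod_hom R M2 M3"
    using f1 f2 f3 by (simp_all add: ghostlyD(1))
  have g1: "ghostly M0' M1' (p1 \<circ> f1)"
    using ghostly_comp_right[OF ghostly_comp_left[OF f1 M1 1(3)] 0(1) M0 0(4)] by simp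
  have g2: "ghostly M1' M2' (p2 \<circ> f2)"
    using ghostly_comp_right[OF ghostly_comp_left[OF f2 M2 2(3)] 1(1) M1 1(4)] by simp
  have g3: "ghostly M2' M3' (p3 \<circ> f3)"
    using ghostly_comp_right[OF ghostly_comp_left[OF f3 M3 3(3)] 2(1) M2 2(4)] by simp
  interpret T: three_ghosts R k x y form M0' M1' M2' M3' "p1 \<circ> f1" "p2 \<circ> f2" "p3 \<circ> f3"
    by (intro three_ghosts.intro three_ghosts_axioms.intro truncated_algebra_axioms 0 1 2 3 g1 g2 g3)
  have "traced M0 M3 (id \<circ> (T.h \<circ> p0))"
    by (rule traced_comp_left[OF M0 3(1) traced_comp_right[OF M0 T.h_traced 0(3)] 3(4)])
  then have G: "traced M0 M3 (p3 \<circ> (f3 \<circ> (p2 \<circ> (f2 \<circ> (p1 \<circ> (f1 \<circ> p0))))))"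
    by (simp add: T.h_def comp_assoc)
  note c1 = hom_comp[OF hom_id h(1)] and d1 = hom_comp[OF hom_comp[OF 0(5) h(1)] 1(5)]
  note c2 = hom_comp[OF c1 h(2)] and d2 = hom_comp[OF hom_comp[OF d1 h(2)] 2(5)]
  have t0: "trace_equal M0 M0 id p0" by (simp add: trace_equal_def 0(6))
  note t1 = trace_equal_step[OF M0 M0 M1 t0 hom_id 0(5) h(1) 1(6,5)]
  note t2 = trace_equal_step[OF M0 M1 M2 t1 c1 d1 h(2) 2(6,5)]
  note t3 = trace_equal_step[OF M0 M2 M3 t2 c2 d2 h(3) 3(6,5)]
  have cl: "(f3 \<circ> (f2 \<circ> f1)) \<in> lmod_hom R M0 M3" by (rule hom_comp[OF hom_comp[OF h(1,2)] h(3)])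
  have cl': "p3 \<circ> (f3 \<circ> (p2 \<circ> (f2 \<circ> (p1 \<circ> (f1 \<circ> p0))))) \<in> lmod_hom R M0 M3"
    by (rule hom_comp[OF hom_comp[OF d2 h(3)] 3(5)])
  show ?thesis
    by (rule traced_cong[OF traced_add[OF M0 M3 t3[unfolded trace_equal_def] G]])
      (use hom_closed[OF cl] hom_closed[OF cl'] in \<open>simp add: lm_minus_add_cancel[OF M3]\<close>)
qed

end

section \<open>Test modules\<close>

definition multiples :: "'r \<Rightarrow> ('r, 'm) module \<Rightarrow> ('r, 'm) module" where
  "multiples a M = M\<lparr>carrier := (\<lambda>u. a \<odot>\<^bsub>M\<^esub> u) ` carrier M\<rparr>"

lemma multiples_simps [simp]:
  "carrier (multiples a M) = (\<lambda>u. a \<odot>\<^bsub>M\<^esub> u) ` carrier M" "\<zero>\<^bsub>multiples a M\<^esub> = \<zero>\<^bsub>M\<^esub>"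
  "u \<oplus>\<^bsub>multiples a M\<^esub> v = u \<oplus>\<^bsub>M\<^esub> v" "c \<odot>\<^bsub>multiples a M\<^esub> u = c \<odot>\<^bsub>M\<^esub> u"
  by (simp_all add: multiples_def)

context truncated_algebra
begin

text \<open>Expand \<open>f u = x\<^sup>2G(u) + xG(xu) + G(x\<^sup>2u)\<close>, where \<open>G\<close> is the trace in \<open>y\<close> alone and commutes with \<open>y\<close>. If
  \<open>xu = yv\<close>, the last two summands are \<open>yb\<close> for \<open>b = xG(v) + G(xv)\<close>, and the first two summands of \<open>f v\<close>
  are \<open>xb\<close> for the same \<open>b\<close>.\<close>

lemma traced_ghostly:
  assumes M: "left_module R M" and N: "left_module R N" and f: "traced M N f" and fh: "f \<in> lmod_hom R M N"
  shows "ghostly M N f"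
proof -
  obtain L where L: "L \<in> linear_maps k M N" and fL: "\<And>u. u \<in> carrier M \<Longrightarrow> f u = Tr M N L u"
    using f unfolding traced_def by blast
  let ?G = "trace1 M N y L"
  have G: "?G \<in> linear_maps k M N" by (rule trace1_linear[OF M N L y_closed])
  have Gy: "?G (my M u) = my N (?G u)" if "u \<in> carrier M" for u
    by (rule trace1_commutes_self[OF M N L _ that]) simp
  note r = lm_rules[OF M] lm_rules[OF N] x_closed y_closed yx_comm[OF M] yx_comm[OF N]
    linear_maps_closed[OF L] linear_maps_closed[OF G] linear_maps_zero[OF L M N] linear_maps_zero[OF G M N]
  have fG: "f u = mx N (mx N (?G u)) \<oplus>\<^bsub>N\<^esub> (mx N (?G (mx M u)) \<oplus>\<^bsub>N\<^esub> ?G (mx M (mx M u)))"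
    if "u \<in> carrier M" for u
    unfolding fL[OF that] Tr_def by (simp only: trace1_def[of M N x])
  have GL: "?G u = my N (my N (L u)) \<oplus>\<^bsub>N\<^esub> (my N (L (my M u)) \<oplus>\<^bsub>N\<^esub> L (my M (my M u)))" for u
    by (simp only: trace1_def)
  show ?thesis
    unfolding ghostly_def
  proof (intro conjI ballI impI)
    fix u assume u: "u \<in> carrier M"
    { assume "mx M u = \<zero>\<^bsub>M\<^esub>" "my M u = \<zero>\<^bsub>M\<^esub>"
      then have "f u = mx N (mx N (my N (my N (L u))))" using u by (simp add: fG r) (simp add: GL r)
      then show "f u \<in> top_part N" using u linear_maps_closed[OF L] unfolding top_part_def by blast }
    { assume s: "mx M (mx M (my M (my M u))) = \<zero>\<^bsub>M\<^esub>"
      let ?a = "mx N (?G u) \<oplus>\<^bsub>N\<^esub> ?G (mx M u)" and ?v = "mx M (mx M u)"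
      have "?G ?v = my N (my N (L ?v) \<oplus>\<^bsub>N\<^esub> L (my M ?v))"
        unfolding GL using u s by (simp add: r)
      then have "f u = mx N ?a \<oplus>\<^bsub>N\<^esub> my N (my N (L ?v) \<oplus>\<^bsub>N\<^esub> L (my M ?v))"
        using u by (simp add: fG r)
      moreover have "?a \<in> carrier N" "my N (L ?v) \<oplus>\<^bsub>N\<^esub> L (my M ?v) \<in> carrier N" using u by (simp_all add: r)
      ultimately show "f u \<in> radical N" unfolding radical_def by blast }
    fix v assume v: "v \<in> carrier M" and uv: "mx M u = my M v"
    let ?b = "mx N (?G v) \<oplus>\<^bsub>N\<^esub> ?G (mx M v)" and ?v = "mx M (mx M v)"
    have "mx M (mx M u) = my M (mx M v)" using u v by (simp add: uv r)
    then have 1: "f u = mx N (mx N (?G u)) \<oplus>\<^bsub>N\<^esub> my N ?b"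
      unfolding fG[OF u] uv using u v by (simp only: Gy lm_smult_closed[OF M] x_closed) (simp add: r)
    have "mx M (mx M (my M v)) = \<zero>\<^bsub>M\<^esub>" using u by (simp add: uv[symmetric] cube_smult[OF M])
    then have "?G ?v = my N (my N (L ?v))" unfolding GL using v by (simp add: r)
    then have 2: "f v = mx N ?b \<oplus>\<^bsub>N\<^esub> my N (my N (L ?v))"
      unfolding fG[OF v] using v by (simp add: r)
    have "?G u \<in> carrier N" "?b \<in> carrier N" "L ?v \<in> carrier N" using u v by (simp_all add: r)
    then show "(f u, f v) \<in> syzygy_pairs N" using 1 2 unfolding syzygy_pairs_def by blast
  qed (rule fh)
qed

definition free_on :: "('r, 'm) module \<Rightarrow> 'm \<Rightarrow> bool" where
  "free_on P g \<longleftrightarrow> left_module R P \<and> g \<in> carrier P \<and> (\<forall>u\<in>carrier P. \<exists>a\<in>carrier R. u = a \<odot>\<^bsub>P\<^esub> g) \<and>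
    (\<forall>a\<in>carrier R. a \<odot>\<^bsub>P\<^esub> g = \<zero>\<^bsub>P\<^esub> \<longrightarrow> a = \<zero>) \<and> traced P P id"

lemma free_on_transport:
  assumes j: "inj_on j (carrier R)"
  shows "free_on (transport j reg) (j \<one>)"
  unfolding free_on_def
proof (intro conjI ballI impI)
  show "left_module R (transport j reg)" using transport_isomorphic(1)[OF lm_reg] j by simp
  show "traced (transport j reg) (transport j reg) id"
    using traced_id_transport[OF lm_reg traced_id_regular] j by simp
qed (use j in \<open>auto simp: transport_simps dest!: inj_onD\<close>)

lemma free_universal:
  assumes P: "free_on P g" and N: "left_module R N" and m: "m \<in> carrier N"
  obtains \<rho> where "\<rho> \<in> lmod_hom R P N" "\<And>a. a \<in> carrier R \<Longrightarrow> \<rho> (a \<odot>\<^bsub>P\<^esub> g) = a \<odot>\<^bsub>N\<^esub> m"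
proof -
  have lP: "left_module R P" and g: "g \<in> carrier P" and gen: "\<forall>u\<in>carrier P. \<exists>a\<in>carrier R. u = a \<odot>\<^bsub>P\<^esub> g"
    and ann: "\<forall>a\<in>carrier R. a \<odot>\<^bsub>P\<^esub> g = \<zero>\<^bsub>P\<^esub> \<longrightarrow> a = \<zero>"
    using P by (auto simp: free_on_def)
  have surj: "(\<lambda>a. a \<odot>\<^bsub>P\<^esub> g) ` carrier reg = carrier P"
    using gen g by (auto simp: lm_smult_closed[OF lP])
  show thesis
    by (rule factor_through_surjection[OF lm_reg lP N scalar_hom[OF lP g] surj scalar_hom[OF N m]])
      (use ann in \<open>auto simp: lm_zero_smult[OF N m] intro: that\<close>)
qed

definition "soc = x \<otimes> (x \<otimes> (y \<otimes> y))"

lemma soc_closed: "soc \<in> carrier R" by (simp add: soc_def x_closed y_closed)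

lemma soc_smult: "left_module R M \<Longrightarrow> u \<in> carrier M \<Longrightarrow>
    soc \<odot>\<^bsub>M\<^esub> u = mx M (mx M (my M (my M u)))"
  by (simp add: soc_def x_closed y_closed lm_rules)

lemma soc_annihilated:
  assumes "left_module R M" "u \<in> carrier M"
  shows "mx M (soc \<odot>\<^bsub>M\<^esub> u) = \<zero>\<^bsub>M\<^esub>" "my M (soc \<odot>\<^bsub>M\<^esub> u) = \<zero>\<^bsub>M\<^esub>"
  using assms by (simp_all add: soc_smult cube_smult yx_comm lm_rules x_closed y_closed)

text \<open>In the expansion of \<open>a\<close> by \<open>Tr_form\<close> all summands but one contain \<open>xa\<close> or \<open>ya\<close>.\<close>

lemma annihilated_imp_soc:
  assumes a: "a \<in> carrier R" and xa: "x \<otimes> a = \<zero>" and ya: "y \<otimes> a = \<zero>"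
  shows "a = soc \<otimes> form a"
proof -
  have f: "form s \<in> carrier R" if "s \<in> carrier R" for s using form_values[OF that] k_closed by blast
  have "form \<zero> = \<zero>" using linear_maps_zero[OF form_linear lm_reg lm_reg] by simp
  then have "Tr reg reg form a = soc \<otimes> form a"
    using a by (simp add: Tr_def trace1_def xa ya x_closed y_closed f soc_def m_assoc)
  then show ?thesis using Tr_form[OF a] by simp
qed

text \<open>On an element killed by \<open>x\<close> and \<open>y\<close> the algebra acts through scalars, and through the same scalars as
  on \<open>soc\<close>.\<close>

lemma soc_mult_zero:
  assumes a: "a \<in> carrier R" and sa: "soc \<otimes> a = \<zero>"
    and N: "left_module R N" and m: "m \<in> carrier N" "mx N m = \<zero>\<^bsub>N\<^esub>" "my N m = \<zero>\<^bsub>N\<^esub>"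
  shows "a \<odot>\<^bsub>N\<^esub> m = \<zero>\<^bsub>N\<^esub>"
proof -
  note sr = soc_annihilated[OF lm_reg, simplified]
  let ?S = "{a \<in> carrier R. \<exists>c\<in>k. soc \<otimes> a = c \<otimes> soc \<and> a \<odot>\<^bsub>N\<^esub> m = c \<odot>\<^bsub>N\<^esub> m}"
  have "?S = carrier R"
  proof (rule generated)
    show "k \<subseteq> ?S" using k_closed soc_closed by (auto simp: m_comm)
    show "a \<oplus> b \<in> ?S" if a: "a \<in> ?S" and b: "b \<in> ?S" for a b
    proof -
      obtain c d where "c \<in> k" "soc \<otimes> a = c \<otimes> soc" "a \<odot>\<^bsub>N\<^esub> m = c \<odot>\<^bsub>N\<^esub> m" 
        "d \<in> k" "soc \<otimes> b = d \<otimes> soc" "b \<odot>\<^bsub>N\<^esub> m = d \<odot>\<^bsub>N\<^esub> m" using a b by blast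
      then show ?thesis using a b k_closed soc_closed m(1)
        by (intro CollectI conjI bexI[of _ "c \<oplus> d"]) (auto simp: r_distr l_distr lm_add_smult[OF N] k_facts(6))
    qed
    show "x \<otimes> a \<in> ?S" if a: "a \<in> ?S" for a
    proof -
      have "soc \<otimes> (x \<otimes> a) = x \<otimes> (soc \<otimes> a)" "(x \<otimes> a) \<odot>\<^bsub>N\<^esub> m = a \<odot>\<^bsub>N\<^esub> (mx N m)"
        using a x_closed soc_closed m(1) by (auto simp: m_lcomm lm_mult_smult[OF N] lcomm[OF N])
      then show ?thesis using a x_closed soc_closed
        by (intro CollectI conjI bexI[of _ \<zero>]) (auto simp: k_facts(2) sr m lm_rules[OF N])
    qed
    show "y \<otimes> a \<in> ?S" if a: "a \<in> ?S" for a
    proof -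
      have "soc \<otimes> (y \<otimes> a) = y \<otimes> (soc \<otimes> a)" "(y \<otimes> a) \<odot>\<^bsub>N\<^esub> m = a \<odot>\<^bsub>N\<^esub> (my N m)"
        using a y_closed soc_closed m(1) by (auto simp: m_lcomm lm_mult_smult[OF N] lcomm[OF N])
      then show ?thesis using a y_closed soc_closed
        by (intro CollectI conjI bexI[of _ \<zero>]) (auto simp: k_facts(2) sr m lm_rules[OF N])
    qed
  qed blast
  then obtain c where c: "c \<in> k" "soc \<otimes> a = c \<otimes> soc" "a \<odot>\<^bsub>N\<^esub> m = c \<odot>\<^bsub>N\<^esub> m" using a by blast
  have "form (c \<odot>\<^bsub>reg\<^esub> soc) = c \<odot>\<^bsub>reg\<^esub> form soc" by (rule linear_maps_smult[OF form_linear c(1)]) (simp add: soc_closed)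
  moreover have "form soc = \<one>" using form_values9 by (simp add: soc_def)
  ultimately have "c = \<zero>" using c(2) sa linear_maps_zero[OF form_linear lm_reg lm_reg] k_closed[OF c(1)] by simp
  then show ?thesis using c(3) m(1) by (simp add: lm_zero_smult[OF N])
qed

lemma left_module_multiples:
  assumes M: "left_module R M" and a: "a \<in> carrier R"
  shows "left_module R (multiples a M)"
  unfolding multiples_def
  by (rule left_module_submodule[OF M])
    (use hom_closed[OF smult_hom[OF M a]] hom_zero[OF smult_hom[OF M a] M M, symmetric] lm_zero_closed[OF M]
      hom_image_add[OF M smult_hom[OF M a]] hom_image_smult[OF M smult_hom[OF M a]] in \<open>blast+\<close>)

lemma multiples_hom:
  assumes M: "left_module R M" and a: "a \<in> carrier R"
  shows "(\<lambda>u. a \<odot>\<^bsub>M\<^esub> u) \<in> lmod_hom R M (multiples a M)" "id \<in> lmod_hom R (multiples a M) M"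
  using smult_hom[OF M a] lm_smult_closed[OF M a] by (auto simp: lmod_hom_def)

text \<open>The multiples of \<open>soc\<close> form a copy of \<open>k\<close>, spanned by \<open>soc g\<close>.\<close>

lemma socle_universal:
  assumes P: "free_on P g" and N: "left_module R N" and m: "m \<in> carrier N" "mx N m = \<zero>\<^bsub>N\<^esub>" "my N m = \<zero>\<^bsub>N\<^esub>"
  obtains t where "t \<in> lmod_hom R (multiples soc P) N" "t (soc \<odot>\<^bsub>P\<^esub> g) = m"
proof -
  have lP: "left_module R P" and g: "g \<in> carrier P" and gen: "\<forall>u\<in>carrier P. \<exists>a\<in>carrier R. u = a \<odot>\<^bsub>P\<^esub> g"
    and ann: "\<forall>a\<in>carrier R. a \<odot>\<^bsub>P\<^esub> g = \<zero>\<^bsub>P\<^esub> \<longrightarrow> a = \<zero>"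
    using P by (auto simp: free_on_def)
  obtain \<rho> where \<rho>: "\<rho> \<in> lmod_hom R P N" "\<And>a. a \<in> carrier R \<Longrightarrow> \<rho> (a \<odot>\<^bsub>P\<^esub> g) = a \<odot>\<^bsub>N\<^esub> m"
    using free_universal[OF P N m(1)] by blast
  have ker: "\<rho> u = \<zero>\<^bsub>N\<^esub>" if u: "u \<in> carrier P" "soc \<odot>\<^bsub>P\<^esub> u = \<zero>\<^bsub>multiples soc P\<^esub>" for u
  proof -
    obtain a where a: "a \<in> carrier R" "u = a \<odot>\<^bsub>P\<^esub> g" using gen u(1) by blast
    then have "(soc \<otimes> a) \<odot>\<^bsub>P\<^esub> g = \<zero>\<^bsub>P\<^esub>" using u(2) g soc_closed by (simp add: lm_mult_smult[OF lP])
    then have "soc \<otimes> a = \<zero>" using ann a(1) soc_closed by simp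
    then show ?thesis using soc_mult_zero[OF a(1) _ N m] a \<rho>(2) by simp
  qed
  obtain t where t: "t \<in> lmod_hom R (multiples soc P) N" "\<And>u. u \<in> carrier P \<Longrightarrow> t (soc \<odot>\<^bsub>P\<^esub> u) = \<rho> u"
    by (rule factor_through_surjection[OF lP left_module_multiples[OF lP soc_closed] N
          multiples_hom(1)[OF lP soc_closed] _ \<rho>(1) ker]) auto
  have "\<rho> (\<one> \<odot>\<^bsub>P\<^esub> g) = m" using \<rho>(2)[of \<one>] by (simp add: lm_one_smult[OF N] m(1))
  then have "t (soc \<odot>\<^bsub>P\<^esub> g) = m" using t(2)[OF g] by (simp add: lm_one_smult[OF lP] g)
  with t(1) show thesis using that by blast
qed

text \<open>A copy of \<open>\<Omega>\<^sup>-\<^sup>1k = R/soc R\<close>.\<close>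

lemma first_cosyzygy:
  fixes P :: "('r, 'm) module"
  assumes P: "free_on P g"
  obtains L :: "('r, 'm) module" and q where "left_module R L" "is_Omega R L (multiples soc P)"
    "q \<in> lmod_hom R P L" "q ` carrier P = carrier L"
    "\<And>u. u \<in> carrier P \<Longrightarrow> q u = \<zero>\<^bsub>L\<^esub> \<longleftrightarrow> u \<in> carrier (multiples soc P)"
proof -
  have lP: "left_module R P" and g: "g \<in> carrier P" and trP: "traced P P id"
    using P by (auto simp: free_on_def)
  let ?T = "multiples soc P"
  note sh = smult_hom[OF lP soc_closed]
  have S: "carrier ?T \<subseteq> carrier P" "\<zero>\<^bsub>P\<^esub> \<in> carrier ?T"
    using hom_closed[OF sh] hom_zero[OF sh lP lP, symmetric] lm_zero_closed[OF lP] by auto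
  have S_add: "u \<oplus>\<^bsub>P\<^esub> v \<in> carrier ?T" if "u \<in> carrier ?T" "v \<in> carrier ?T" for u v
    using hom_image_add[OF lP sh] that by simp
  have S_smult: "a \<odot>\<^bsub>P\<^esub> u \<in> carrier ?T" if "a \<in> carrier R" "u \<in> carrier ?T" for a u
    using hom_image_smult[OF lP sh] that by simp
  obtain L :: "('r, 'm) module" and q where L: "left_module R L" and q: "q \<in> lmod_hom R P L"
    "q ` carrier P = carrier L" "\<And>u. u \<in> carrier P \<Longrightarrow> q u = \<zero>\<^bsub>L\<^esub> \<longleftrightarrow> u \<in> carrier ?T"
    by (rule quotient_module[OF lP S S_add S_smult], assumption, assumption, assumption, assumption, rule that)
  have "Omega_seq R ?T P L id q"
    unfolding Omega_seq_def short_exact_def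
    using left_module_multiples[OF lP soc_closed] lP L q multiples_hom(2)[OF lP soc_closed]
      traced_id_projective[OF lP trP] S(1) by auto
  then show thesis using that L q unfolding is_Omega_def by blast
qed

lemma first_cosyzygy_universal:
  assumes P: "free_on P g" and L: "left_module R L" and q: "q \<in> lmod_hom R P L" "q ` carrier P = carrier L"
    and ker: "\<And>u. u \<in> carrier P \<Longrightarrow> q u = \<zero>\<^bsub>L\<^esub> \<longleftrightarrow> u \<in> carrier (multiples soc P)"
    and M: "left_module R M" and u: "u \<in> carrier M" "mx M (mx M (my M (my M u))) = \<zero>\<^bsub>M\<^esub>"
  obtains t where "t \<in> lmod_hom R L M" "t (q g) = u"
proof -
  have lP: "left_module R P" and g: "g \<in> carrier P" and gen: "\<forall>u\<in>carrier P. \<exists>a\<in>carrier R. u = a \<odot>\<^bsub>P\<^esub> g"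
    using P by (auto simp: free_on_def)
  obtain \<rho> where \<rho>: "\<rho> \<in> lmod_hom R P M" "\<And>a. a \<in> carrier R \<Longrightarrow> \<rho> (a \<odot>\<^bsub>P\<^esub> g) = a \<odot>\<^bsub>M\<^esub> u"
    using free_universal[OF P M u(1)] by blast
  have "\<rho> v = \<zero>\<^bsub>M\<^esub>" if v: "v \<in> carrier P" "q v = \<zero>\<^bsub>L\<^esub>" for v
  proof -
    obtain w where w: "w \<in> carrier P" "v = soc \<odot>\<^bsub>P\<^esub> w" using ker v by auto
    obtain a where a: "a \<in> carrier R" "w = a \<odot>\<^bsub>P\<^esub> g" using gen w(1) by blast
    have "\<rho> v = soc \<odot>\<^bsub>M\<^esub> (a \<odot>\<^bsub>M\<^esub> u)"
      unfolding w(2) hom_smult[OF \<rho>(1) soc_closed w(1)] unfolding a(2) \<rho>(2)[OF a(1)] ..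
    also have "\<dots> = a \<odot>\<^bsub>M\<^esub> (soc \<odot>\<^bsub>M\<^esub> u)" by (rule lcomm[OF M soc_closed a(1) u(1)])
    finally show ?thesis using u a by (simp add: soc_smult[OF M] lm_smult_zero[OF M])
  qed
  then obtain t where t: "t \<in> lmod_hom R L M" "\<And>v. v \<in> carrier P \<Longrightarrow> t (q v) = \<rho> v"
    using factor_through_surjection[OF lP L M q \<rho>(1)] by blast
  have "t (q g) = u" using t(2)[OF g] \<rho>(2)[of \<one>] by (simp add: lm_one_smult[OF lP] lm_one_smult[OF M] g u)
  then show thesis using that t(1) by blast
qed

text \<open>A copy of \<open>\<Omega>\<^sup>-\<^sup>2k\<close>, the cokernel of the embedding of \<open>R/soc R\<close> into \<open>R\<^sup>2\<close> given by \<open>u \<mapsto> (xu, -yu)\<close>. The sign in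
  the embedding makes the relation between the two generators read \<open>x e1 = y e2\<close>.\<close>

lemma second_cosyzygy:
  fixes P L :: "('r, 'm) module"
  assumes inf: "infinite (UNIV :: 'm set)"
    and P: "free_on P g" and L: "left_module R L" and q: "q \<in> lmod_hom R P L" "q ` carrier P = carrier L"
    and qker: "\<And>u. u \<in> carrier P \<Longrightarrow> q u = \<zero>\<^bsub>L\<^esub> \<longleftrightarrow> u \<in> carrier (multiples soc P)"
  obtains L2 :: "('r, 'm) module" and e1 e2 where "left_module R L2" "is_Omega R L2 L"
    "e1 \<in> carrier L2" "e2 \<in> carrier L2" "mx L2 e1 = my L2 e2"
    "\<And>(M :: ('r, 'm) module) u v. left_module R M \<Longrightarrow> u \<in> carrier M \<Longrightarrow> v \<in> carrier M \<Longrightarrow>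
       mx M u = my M v \<Longrightarrow> \<exists>t\<in>lmod_hom R L2 M. t e1 = u \<and> t e2 = v"
proof -
  have lP: "left_module R P" and g: "g \<in> carrier P" and gen: "\<forall>u\<in>carrier P. \<exists>a\<in>carrier R. u = a \<odot>\<^bsub>P\<^esub> g"
    and ann: "\<forall>a\<in>carrier R. a \<odot>\<^bsub>P\<^esub> g = \<zero>\<^bsub>P\<^esub> \<longrightarrow> a = \<zero>" and trP: "traced P P id"
    using P by (auto simp: free_on_def)
  note rP = lm_rules[OF lP] x_closed y_closed soc_closed
  let ?T = "multiples soc P"
  \<comment> \<open>Injectivity of \<open>R/soc R \<rightarrow> R\<^sup>2\<close>.\<close>
  have in_soc: "u \<in> carrier ?T" if u: "u \<in> carrier P" "mx P u = \<zero>\<^bsub>P\<^esub>" "my P u = \<zero>\<^bsub>P\<^esub>" for u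
  proof -
    obtain a where a: "a \<in> carrier R" "u = a \<odot>\<^bsub>P\<^esub> g" using gen u(1) by blast
    have "x \<otimes> a = \<zero>" "y \<otimes> a = \<zero>" using ann u a g by (simp_all add: lm_mult_smult[OF lP] x_closed y_closed)
    then have "a = soc \<otimes> form a" by (rule annihilated_imp_soc[OF a(1)])
    then have "u = soc \<odot>\<^bsub>P\<^esub> (form a \<odot>\<^bsub>P\<^esub> g)"
      using a g form_values[OF a(1)] k_closed soc_closed by (metis lm_mult_smult[OF lP])
    then show ?thesis using g form_values[OF a(1)] k_closed by (auto simp: lm_smult_closed[OF lP])
  qed
  obtain pr :: "'m \<times> 'm \<Rightarrow> 'm" where pr: "inj pr" using infinite_pairs_injection[OF inf] by blast
  let ?D = "module_sum P P"
  have lD: "left_module R ?D" by (rule left_module_module_sum[OF lP lP])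
  have prD: "inj_on pr (carrier ?D)" using pr by (rule inj_on_subset) simp
  define P2 where "P2 = transport pr ?D"
  note t2 = transport_isomorphic[OF lD prD, folded P2_def]
  have trP2: "traced P2 P2 id" unfolding P2_def
    by (rule traced_id_transport[OF lD traced_id_module_sum[OF lP lP trP trP] prD])
  have d: "(\<lambda>u. (mx P u, (\<ominus> y) \<odot>\<^bsub>P\<^esub> u)) \<in> lmod_hom R P ?D"
    by (rule homI) (simp_all add: rP lcomm[OF lP])
  let ?d = "pr \<circ> (\<lambda>u. (mx P u, (\<ominus> y) \<odot>\<^bsub>P\<^esub> u))"
  have dh: "?d \<in> lmod_hom R P P2" by (rule hom_comp[OF d t2(2)])
  have zero2: "\<zero>\<^bsub>P2\<^esub> = pr (\<zero>\<^bsub>P\<^esub>, \<zero>\<^bsub>P\<^esub>)" by (simp add: P2_def transport_simps)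
  have dker: "?d u = \<zero>\<^bsub>P2\<^esub>" if u: "u \<in> carrier P" "q u = \<zero>\<^bsub>L\<^esub>" for u
  proof -
    obtain v where "v \<in> carrier P" "u = soc \<odot>\<^bsub>P\<^esub> v" using qker u by auto
    moreover have "\<ominus>\<^bsub>P\<^esub> \<zero>\<^bsub>P\<^esub> = \<zero>\<^bsub>P\<^esub>"
      using lm_add_neg[OF lP lm_zero_closed[OF lP]] lm_zero_add[OF lP] lm_neg_closed[OF lP] lm_zero_closed[OF lP] by metis
    ultimately show ?thesis using soc_annihilated[OF lP] by (simp add: zero2 rP lm_neg_smult[OF lP])
  qed
  obtain i where i: "i \<in> lmod_hom R L P2" and iq: "\<And>u. u \<in> carrier P \<Longrightarrow> i (q u) = ?d u"
    by (rule factor_through_surjection[OF lP L t2(1) q(1,2) dh dker], assumption, assumption, rule that)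
  have inj: "inj_on i (carrier L)"
  proof (rule inj_on_kernel[OF L t2(1) i])
    fix v assume "v \<in> carrier L" "i v = \<zero>\<^bsub>P2\<^esub>"
    moreover obtain u where u: "u \<in> carrier P" "v = q u" using q(2) \<open>v \<in> carrier L\<close> by blast
    ultimately have "pr (mx P u, (\<ominus> y) \<odot>\<^bsub>P\<^esub> u) = pr (\<zero>\<^bsub>P\<^esub>, \<zero>\<^bsub>P\<^esub>)" by (simp add: iq zero2)
    then have e: "mx P u = \<zero>\<^bsub>P\<^esub>" "\<ominus>\<^bsub>P\<^esub> (my P u) = \<zero>\<^bsub>P\<^esub>"
      using pr u(1) by (auto dest!: injD simp: lm_neg_smult[OF lP] y_closed)
    have "my P u = \<zero>\<^bsub>P\<^esub>"
      using e(2) lm_add_neg[OF lP, of "my P u"] u(1) by (simp add: rP)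
    then show "v = \<zero>\<^bsub>L\<^esub>" using in_soc[OF u(1) e(1)] qker u by blast
  qed
  let ?I = "i ` carrier L"
  have I: "?I \<subseteq> carrier P2" "\<zero>\<^bsub>P2\<^esub> \<in> ?I"
    using hom_closed[OF i] hom_zero[OF i L t2(1), symmetric] lm_zero_closed[OF L] by blast+
  obtain L2 :: "('r, 'm) module" and q2 where L2: "left_module R L2" and q2: "q2 \<in> lmod_hom R P2 L2"
    "q2 ` carrier P2 = carrier L2" "\<And>u. u \<in> carrier P2 \<Longrightarrow> q2 u = \<zero>\<^bsub>L2\<^esub> \<longleftrightarrow> u \<in> ?I"
    by (rule quotient_module[OF t2(1) I hom_image_add[OF L i] hom_image_smult[OF L i]],
        assumption, assumption, assumption, assumption, rule that)
  have O2: "is_Omega R L2 L"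
  proof -
    have "Omega_seq R L P2 L2 i q2"
      unfolding Omega_seq_def short_exact_def
      using L t2(1) L2 i inj q2 I(1) traced_id_projective[OF t2(1) trP2] by blast
    then show ?thesis unfolding is_Omega_def by blast
  qed
  define e1 e2 where "e1 = q2 (pr (g, \<zero>\<^bsub>P\<^esub>))" and "e2 = q2 (pr (\<zero>\<^bsub>P\<^esub>, g))"
  have gc: "(g, \<zero>\<^bsub>P\<^esub>) \<in> carrier ?D" "(\<zero>\<^bsub>P\<^esub>, g) \<in> carrier ?D" by (simp_all add: g rP)
  note prc = hom_closed[OF t2(2)]
  have e: "e1 \<in> carrier L2" "e2 \<in> carrier L2"
    unfolding e1_def e2_def by (rule hom_closed[OF q2(1) prc[OF gc(1)]], rule hom_closed[OF q2(1) prc[OF gc(2)]])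
  have pm: "c \<odot>\<^bsub>P2\<^esub> pr w = pr (c \<odot>\<^bsub>?D\<^esub> w)" if "c \<in> carrier R" "w \<in> carrier ?D" for c w
    using hom_smult[OF t2(2) that] by simp
  have pa: "pr v \<oplus>\<^bsub>P2\<^esub> pr w = pr (v \<oplus>\<^bsub>?D\<^esub> w)" if "v \<in> carrier ?D" "w \<in> carrier ?D" for v w
    using hom_add[OF t2(2) that] by simp
  have rel: "mx L2 e1 = my L2 e2"
  proof -
    have c: "pr (mx P g, \<zero>\<^bsub>P\<^esub>) \<in> carrier P2" "pr (\<zero>\<^bsub>P\<^esub>, my P g) \<in> carrier P2" "pr (\<zero>\<^bsub>P\<^esub>, (\<ominus> y) \<odot>\<^bsub>P\<^esub> g) \<in> carrier P2"
      by (rule prc; simp add: g rP)+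
    have "mx L2 e1 \<oplus>\<^bsub>L2\<^esub> (\<ominus> y) \<odot>\<^bsub>L2\<^esub> e2 = q2 (mx P2 (pr (g, \<zero>\<^bsub>P\<^esub>)) \<oplus>\<^bsub>P2\<^esub> (\<ominus> y) \<odot>\<^bsub>P2\<^esub> pr (\<zero>\<^bsub>P\<^esub>, g))"
      using prc[OF gc(1)] prc[OF gc(2)]
      by (simp add: e1_def e2_def hom_add[OF q2(1)] hom_smult[OF q2(1)] x_closed y_closed lm_smult_closed[OF t2(1)])
    also have "\<dots> = q2 (i (q g))"
      using gc by (simp add: pm pa x_closed y_closed iq g rP)
    also have "\<dots> = \<zero>\<^bsub>L2\<^esub>" using q2(3) hom_closed[OF q(1) g] hom_closed[OF i] by blast
    finally have "mx L2 e1 \<ominus>\<^bsub>L2\<^esub> my L2 e2 = \<zero>\<^bsub>L2\<^esub>"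
      using e by (simp add: lm_neg_smult[OF L2] y_closed lm_minus_def[OF L2])
    then show ?thesis using lm_minus_eq_zero[OF L2] e by (simp add: lm_smult_closed[OF L2] x_closed y_closed)
  qed
  show thesis
  proof (rule that[OF L2 O2 e rel])
    fix M :: "('r, 'm) module" and u v
    assume M: "left_module R M" and u: "u \<in> carrier M" and v: "v \<in> carrier M" and uv: "mx M u = my M v"
    obtain \<rho> where \<rho>: "\<rho> \<in> lmod_hom R P M" "\<And>a. a \<in> carrier R \<Longrightarrow> \<rho> (a \<odot>\<^bsub>P\<^esub> g) = a \<odot>\<^bsub>M\<^esub> u"
      using free_universal[OF P M u] by blast
    obtain \<tau> where \<tau>: "\<tau> \<in> lmod_hom R P M" "\<And>a. a \<in> carrier R \<Longrightarrow> \<tau> (a \<odot>\<^bsub>P\<^esub> g) = a \<odot>\<^bsub>M\<^esub> v"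
      using free_universal[OF P M v] by blast
    have st: "(\<lambda>w. \<rho> (fst w) \<oplus>\<^bsub>M\<^esub> \<tau> (snd w)) \<in> lmod_hom R ?D M"
      by (rule homI) (auto simp: hom_closed[OF \<rho>(1)] hom_closed[OF \<tau>(1)] hom_add[OF \<rho>(1)] hom_add[OF \<tau>(1)]
          hom_smult[OF \<rho>(1)] hom_smult[OF \<tau>(1)] lm_rules[OF M] lm_add_comm[OF M] lm_add_lcomm[OF M])
    let ?\<phi> = "(\<lambda>w. \<rho> (fst w) \<oplus>\<^bsub>M\<^esub> \<tau> (snd w)) \<circ> inv_into (carrier ?D) pr"
    have \<phi>: "?\<phi> \<in> lmod_hom R P2 M" by (rule hom_comp[OF t2(3) st])
    have \<phi>pr: "?\<phi> (pr (a, b)) = \<rho> a \<oplus>\<^bsub>M\<^esub> \<tau> b" if "a \<in> carrier P" "b \<in> carrier P" for a b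
      using inv_into_f_f[OF prD, of "(a, b)"] that by simp
    have ker: "?\<phi> z = \<zero>\<^bsub>M\<^esub>" if z: "z \<in> carrier P2" "q2 z = \<zero>\<^bsub>L2\<^esub>" for z
    proof -
      obtain w where w: "w \<in> carrier L" "z = i w" using q2(3) z by blast
      obtain w' where w': "w' \<in> carrier P" "w = q w'" using w(1) q(2) by blast
      obtain a where a: "a \<in> carrier R" "w' = a \<odot>\<^bsub>P\<^esub> g" using gen w'(1) by blast
      have "?\<phi> z = \<rho> (mx P w') \<oplus>\<^bsub>M\<^esub> \<tau> ((\<ominus> y) \<odot>\<^bsub>P\<^esub> w')"
        using w'(1) unfolding w(2) w'(2) iq[OF w'(1)] comp_apply[of pr]
        by (intro \<phi>pr) (simp_all add: rP)
      also have "\<dots> = mx M (a \<odot>\<^bsub>M\<^esub> u) \<oplus>\<^bsub>M\<^esub> (\<ominus> y) \<odot>\<^bsub>M\<^esub> (a \<odot>\<^bsub>M\<^esub> v)"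
        unfolding hom_smult[OF \<rho>(1) x_closed w'(1)] hom_smult[OF \<tau>(1) a_inv_closed[OF y_closed] w'(1)]
        unfolding a(2) \<rho>(2)[OF a(1)] \<tau>(2)[OF a(1)] ..
      also have "\<dots> = a \<odot>\<^bsub>M\<^esub> (mx M u) \<oplus>\<^bsub>M\<^esub> (\<ominus>\<^bsub>M\<^esub> (a \<odot>\<^bsub>M\<^esub> (my M v)))"
        using a(1) u v by (simp add: lm_neg_smult[OF M] lcomm[OF M x_closed a(1) u] lcomm[OF M y_closed a(1) v]
            lm_smult_closed[OF M] y_closed)
      finally show ?thesis using a(1) v by (simp add: uv lm_add_neg[OF M] lm_smult_closed[OF M] y_closed)
    qed
    obtain t where t: "t \<in> lmod_hom R L2 M" "\<And>z. z \<in> carrier P2 \<Longrightarrow> t (q2 z) = ?\<phi> z"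
      by (rule factor_through_surjection[OF t2(1) L2 M q2(1,2) \<phi> ker], assumption, assumption, rule that)
    have one: "\<rho> g = u" "\<tau> g = v"
      using \<rho>(2)[of \<one>] \<tau>(2)[of \<one>] by (simp_all add: lm_one_smult[OF lP] lm_one_smult[OF M] g u v)
    have "t e1 = u" "t e2 = v"
      unfolding e1_def e2_def t(2)[OF prc[OF gc(1)]] t(2)[OF prc[OF gc(2)]]
      by (subst \<phi>pr; simp add: g rP one hom_zero[OF \<rho>(1) lP M] hom_zero[OF \<tau>(1) lP M] u v lm_rules[OF M])+
    then show "\<exists>t\<in>lmod_hom R L2 M. t e1 = u \<and> t e2 = v" using t(1) by blast
  qed
qed

text \<open>Evaluate the traces \<open>f \<circ> t\<close> at the generators of the three test modules; by \<open>traced_ghostly\<close> their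
  values there have the required form.\<close>

lemma ghostly_if_tests:
  fixes P :: "('r, 'm) module"
  assumes inf: "infinite (UNIV :: 'm set)" and P: "free_on P g"
  obtains L1 L2 :: "('r, 'm) module" where
    "is_Omega R L1 (multiples soc P)" "is_Omega R L2 L1"
    "\<And>(M :: ('r, 'm) module) (N :: ('r, 'm) module) f. \<lbrakk>left_module R M; left_module R N; f \<in> lmod_hom R M N;
       \<forall>t\<in>lmod_hom R (multiples soc P) M. traced (multiples soc P) N (f \<circ> t);
       \<forall>t\<in>lmod_hom R L1 M. traced L1 N (f \<circ> t); \<forall>t\<in>lmod_hom R L2 M. traced L2 N (f \<circ> t)\<rbrakk> \<Longrightarrow> ghostly M N f"
proof -
  have lP: "left_module R P" and g: "g \<in> carrier P" using P by (auto simp: free_on_def)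
  let ?T = "multiples soc P"
  note lT = left_module_multiples[OF lP soc_closed]
  obtain L1 :: "('r, 'm) module" and q where L1: "left_module R L1" "is_Omega R L1 ?T"
    and q: "q \<in> lmod_hom R P L1" "q ` carrier P = carrier L1"
      "\<And>u. u \<in> carrier P \<Longrightarrow> q u = \<zero>\<^bsub>L1\<^esub> \<longleftrightarrow> u \<in> carrier ?T"
    by (rule first_cosyzygy[OF P], rule that)
  obtain L2 :: "('r, 'm) module" and e1 e2 where L2: "left_module R L2" "is_Omega R L2 L1"
    and e: "e1 \<in> carrier L2" "e2 \<in> carrier L2" "mx L2 e1 = my L2 e2"
    and univ: "\<And>(M :: ('r, 'm) module) u v. left_module R M \<Longrightarrow> u \<in> carrier M \<Longrightarrow> v \<in> carrier M \<Longrightarrow>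
       mx M u = my M v \<Longrightarrow> \<exists>t\<in>lmod_hom R L2 M. t e1 = u \<and> t e2 = v"
    by (rule second_cosyzygy[OF inf P L1(1) q], assumption, rule that)
  show thesis
  proof (rule that[OF L1(2) L2(2)])
    fix M N :: "('r, 'm) module" and f
    assume M: "left_module R M" and N: "left_module R N" and f: "f \<in> lmod_hom R M N"
      and all: "\<forall>t\<in>lmod_hom R ?T M. traced ?T N (f \<circ> t)"
        "\<forall>t\<in>lmod_hom R L1 M. traced L1 N (f \<circ> t)" "\<forall>t\<in>lmod_hom R L2 M. traced L2 N (f \<circ> t)"
    show "ghostly M N f"
      unfolding ghostly_def
    proof (intro conjI ballI impI)
      fix u assume u: "u \<in> carrier M"
      show "f u \<in> top_part N" if xu: "mx M u = \<zero>\<^bsub>M\<^esub>" "my M u = \<zero>\<^bsub>M\<^esub>"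
      proof -
        obtain t where t: "t \<in> lmod_hom R ?T M" "t (soc \<odot>\<^bsub>P\<^esub> g) = u"
          using socle_universal[OF P M u xu] by blast
        have "(f \<circ> t) (soc \<odot>\<^bsub>P\<^esub> g) \<in> top_part N"
          by (rule ghostlyD(2)[OF traced_ghostly[OF lT N all(1)[rule_format, OF t(1)] hom_comp[OF t(1) f]]])
            (use g soc_annihilated[OF lP g] in simp_all)
        then show ?thesis by (simp add: t(2))
      qed
      show "f u \<in> radical N" if su: "mx M (mx M (my M (my M u))) = \<zero>\<^bsub>M\<^esub>"
      proof -
        obtain t where t: "t \<in> lmod_hom R L1 M" "t (q g) = u"
          using first_cosyzygy_universal[OF P L1(1) q M u su] by blast
        have qg: "q g \<in> carrier L1" by (rule hom_closed[OF q(1) g])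
        have "soc \<odot>\<^bsub>L1\<^esub> q g = q (soc \<odot>\<^bsub>P\<^esub> g)" by (simp add: hom_smult[OF q(1) soc_closed g])
        also have "\<dots> = \<zero>\<^bsub>L1\<^esub>" using q(3)[of "soc \<odot>\<^bsub>P\<^esub> g"] g by (simp add: lm_smult_closed[OF lP soc_closed])
        finally have "mx L1 (mx L1 (my L1 (my L1 (q g)))) = \<zero>\<^bsub>L1\<^esub>" by (simp add: soc_smult[OF L1(1) qg])
        with qg have "(f \<circ> t) (q g) \<in> radical N"
          by (rule ghostlyD(3)[OF traced_ghostly[OF L1(1) N all(2)[rule_format, OF t(1)] hom_comp[OF t(1) f]]])
        then show ?thesis by (simp add: t(2))
      qed
      show "(f u, f v) \<in> syzygy_pairs N" if v: "v \<in> carrier M" and uv: "mx M u = my M v" for v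
      proof -
        obtain t where t: "t \<in> lmod_hom R L2 M" "t e1 = u" "t e2 = v" using univ[OF M u v uv] by blast
        have "((f \<circ> t) e1, (f \<circ> t) e2) \<in> syzygy_pairs N"
          by (rule ghostlyD(4)[OF traced_ghostly[OF L2(1) N all(3)[rule_format, OF t(1)] hom_comp[OF t(1) f]] e])
        then show ?thesis by (simp add: t(2,3))
      qed
    qed (rule f)
  qed
qed

text \<open>Multiplication by \<open>x\<close> on \<open>xy\<^sup>2R\<close> and by \<open>x\<^sup>2\<close> on \<open>y\<^sup>2R\<close> has image \<open>soc R\<close> and kernel \<open>soc R\<close>, respectively
  \<open>xy\<^sup>2R\<close>. So \<open>y\<^sup>2R\<close> is an iterated extension of three copies of \<open>k\<close>.\<close>

lemma multiples_in_thick: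
  fixes P :: "('r, 'm) module"
  assumes inf: "infinite (UNIV :: 'm set)" and P: "free_on P g"
    and thick: "thick_subcategory R \<C>" and T: "multiples soc P \<in> \<C>"
  shows "multiples (y \<otimes> y) P \<in> \<C>"
proof -
  have lP: "left_module R P" and g: "g \<in> carrier P" and gen: "\<forall>u\<in>carrier P. \<exists>a\<in>carrier R. u = a \<odot>\<^bsub>P\<^esub> g"
    and trP: "traced P P id"
    using P by (auto simp: free_on_def)
  note r = lm_rules[OF lP] x_closed y_closed yx_comm[OF lP]
  note c = soc_closed m_closed[OF y_closed y_closed] m_closed[OF x_closed m_closed[OF y_closed y_closed]]
  let ?T = "multiples soc P" and ?B = "multiples (y \<otimes> y) P" and ?A = "multiples (x \<otimes> (y \<otimes> y)) P"
  note l = left_module_multiples[OF lP]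
  \<comment> \<open>If \<open>x\<^sup>2y\<^sup>2u = 0\<close>, then \<open>y\<^sup>2u\<close> is divisible by \<open>x\<close>: expand \<open>u\<close> in powers of \<open>x\<close>, the constant term
    being \<open>G(x\<^sup>2u)\<close> with \<open>G\<close> the trace in \<open>y\<close> alone.\<close>
  have fact: "\<exists>v\<in>carrier P. my P (my P u) = mx P (my P (my P v))"
    if u: "u \<in> carrier P" and z: "mx P (mx P (my P (my P u))) = \<zero>\<^bsub>P\<^esub>" for u
  proof -
    obtain L where L: "L \<in> linear_maps k P P" and id: "\<And>u. u \<in> carrier P \<Longrightarrow> u = Tr P P L u"
      using trP unfolding traced_def by auto
    let ?G = "trace1 P P y L"
    have G: "?G \<in> linear_maps k P P" by (rule trace1_linear[OF lP lP L y_closed])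
    have Gy: "my P (?G w) = ?G (my P w)" if "w \<in> carrier P" for w
      using trace1_commutes_self[OF lP lP L _ that, of y] by simp
    note Gc = linear_maps_closed[OF G]
    have "u = mx P (mx P (?G u)) \<oplus>\<^bsub>P\<^esub> (mx P (?G (mx P u)) \<oplus>\<^bsub>P\<^esub> ?G (mx P (mx P u)))"
      using id[OF u] unfolding Tr_def trace1_def[of P P x] by simp
    then have "my P (my P u) = my P (my P (mx P (mx P (?G u)) \<oplus>\<^bsub>P\<^esub> (mx P (?G (mx P u)) \<oplus>\<^bsub>P\<^esub> ?G (mx P (mx P u)))))"
      by simp
    also have "\<dots> = mx P (my P (my P (mx P (?G u) \<oplus>\<^bsub>P\<^esub> ?G (mx P u)))) \<oplus>\<^bsub>P\<^esub> my P (my P (?G (mx P (mx P u))))"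
      using u by (simp add: r Gc)
    also have "my P (my P (?G (mx P (mx P u)))) = ?G (my P (my P (mx P (mx P u))))"
      using u by (simp only: Gy lm_smult_closed[OF lP] x_closed y_closed)
    also have "\<dots> = \<zero>\<^bsub>P\<^esub>" using u z linear_maps_zero[OF G lP lP] by (simp add: r)
    finally have "my P (my P u) = mx P (my P (my P (mx P (?G u) \<oplus>\<^bsub>P\<^esub> ?G (mx P u))))"
      using u by (simp add: r Gc)
    then show ?thesis using u by (intro bexI[of _ "mx P (?G u) \<oplus>\<^bsub>P\<^esub> ?G (mx P u)"]) (simp_all add: r Gc)
  qed
  have cT: "carrier ?T = (\<lambda>w. mx P (mx P (my P (my P w)))) ` carrier P"
    unfolding multiples_simps by (rule image_cong) (simp_all add: soc_smult[OF lP])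
  have cA: "carrier ?A = (\<lambda>w. mx P (my P (my P w))) ` carrier P"
    and cB: "carrier ?B = (\<lambda>w. my P (my P w)) ` carrier P"
    unfolding multiples_simps by (rule image_cong; simp add: r)+
  have TA: "carrier ?T = {u \<in> carrier ?A. mx P u = \<zero>\<^bsub>P\<^esub>}"
  proof (intro equalityI subsetI)
    fix u assume "u \<in> carrier ?T"
    then obtain w where w: "w \<in> carrier P" "u = mx P (mx P (my P (my P w)))" unfolding cT by blast
    then have e: "u = mx P (my P (my P (mx P w)))" by (simp add: r)
    have "u \<in> carrier ?A" unfolding cA by (rule image_eqI, rule e) (simp add: w(1) r)
    then show "u \<in> {u \<in> carrier ?A. mx P u = \<zero>\<^bsub>P\<^esub>}" using w by (simp add: r cube_smult[OF lP] del: multiples_simps)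
  next
    fix u assume "u \<in> {u \<in> carrier ?A. mx P u = \<zero>\<^bsub>P\<^esub>}"
    then obtain w where w: "w \<in> carrier P" "u = mx P (my P (my P w))" "mx P u = \<zero>\<^bsub>P\<^esub>" unfolding cA by blast
    then obtain v where "v \<in> carrier P" "my P (my P w) = mx P (my P (my P v))"
      using fact[of w] by auto
    then show "u \<in> carrier ?T" unfolding cT w(2) by auto
  qed
  have AB: "carrier ?A = {u \<in> carrier ?B. mx P (mx P u) = \<zero>\<^bsub>P\<^esub>}"
  proof (intro equalityI subsetI)
    fix u assume "u \<in> carrier ?A"
    then obtain w where w: "w \<in> carrier P" "u = mx P (my P (my P w))" unfolding cA by blast
    then have e: "u = my P (my P (mx P w))" by (simp add: r)
    have "u \<in> carrier ?B" unfolding cB by (rule image_eqI, rule e) (simp add: w(1) r)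
    then show "u \<in> {u \<in> carrier ?B. mx P (mx P u) = \<zero>\<^bsub>P\<^esub>}" using w by (simp add: r cube_smult[OF lP] del: multiples_simps)
  next
    fix u assume "u \<in> {u \<in> carrier ?B. mx P (mx P u) = \<zero>\<^bsub>P\<^esub>}"
    then obtain w where w: "w \<in> carrier P" "u = my P (my P w)" "mx P (mx P u) = \<zero>\<^bsub>P\<^esub>" unfolding cB by blast
    then obtain v where "v \<in> carrier P" "u = mx P (my P (my P v))"
      using fact[of w] by auto
    then show "u \<in> carrier ?A" unfolding cA by auto
  qed
  have xA: "(mx P) ` carrier ?A = carrier ?T" unfolding cA cT image_image by simp
  have xB: "(\<lambda>u. mx P (mx P u)) ` carrier ?B = carrier ?T" unfolding cB cT image_image by simp
  note lT = l[OF c(1)] and lA = l[OF c(3)] and lB = l[OF c(2)]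
  have inc: "u \<in> carrier P" if "u \<in> carrier ?A \<or> u \<in> carrier ?B" for u
    using that unfolding cA cB by (auto simp: r)
  have hA: "(mx P) \<in> lmod_hom R ?A ?T"
    by (rule homI) (use xA inc in \<open>auto simp: lcomm[OF lP] x_closed lm_smult_add[OF lP] simp del: multiples_simps(1)\<close>)
  have hB: "(\<lambda>u. mx P (mx P u)) \<in> lmod_hom R ?B ?T"
    by (rule homI) (use xB inc in \<open>auto simp: lcomm[OF lP] lm_smult_closed[OF lP] x_closed lm_smult_add[OF lP] simp del: multiples_simps(1)\<close>)
  have iT: "id \<in> lmod_hom R ?T ?A"
    by (rule homI) (use TA in \<open>auto simp del: multiples_simps(1)\<close>)
  have iA: "id \<in> lmod_hom R ?A ?B"
    by (rule homI) (use AB in \<open>auto simp del: multiples_simps(1)\<close>)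
  have "short_exact R ?T ?A ?T id (mx P)"
    unfolding short_exact_def using lT lA iT hA xA TA by (simp del: multiples_simps(1))
  then have "?A \<in> \<C>" using thick_extension[OF thick _ T T inf] by blast
  moreover have "short_exact R ?A ?B ?T id (\<lambda>u. mx P (mx P u))"
    unfolding short_exact_def using lT lA lB iA hB xB AB by (simp del: multiples_simps(1))
  ultimately show ?thesis using thick_extension[OF thick _ _ T inf] by blast
qed

text \<open>Every summand \<open>x\<^sup>i y\<^sup>j L x\<^sup>2\<^sup>-\<^sup>i y\<^sup>2\<^sup>-\<^sup>j\<close> has a factor \<open>y\<close> on the left or on the right of \<open>L\<close>, and \<open>y\<close> acts as zero on
  both modules.\<close>

lemma traced_zero_on_multiples:
  assumes P: "left_module R P" and N: "left_module R N" and ya: "\<And>v. v \<in> carrier N \<Longrightarrow> my N v = \<zero>\<^bsub>N\<^esub>"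
    and f: "traced (multiples (y \<otimes> y) P) N f" and u: "u \<in> carrier (multiples (y \<otimes> y) P)"
  shows "f u = \<zero>\<^bsub>N\<^esub>"
proof -
  let ?B = "multiples (y \<otimes> y) P"
  have lB: "left_module R ?B" by (rule left_module_multiples[OF P m_closed[OF y_closed y_closed]])
  obtain L where L: "L \<in> linear_maps k ?B N" and fL: "f u = Tr ?B N L u" using f u unfolding traced_def by blast
  have yB: "my ?B v = \<zero>\<^bsub>?B\<^esub>" if "v \<in> carrier ?B" for v
    using that cube_smult[OF P] by (auto simp: lm_mult_smult[OF P] y_closed)
  show ?thesis
    unfolding fL Tr_def trace1_def
    using u by (simp add: yB ya linear_maps_closed[OF L] lm_rules[OF lB] lm_rules[OF N] x_closed y_closed
        linear_maps_zero[OF L lB N] del: multiples_simps)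
qed

end

section \<open>Group algebras\<close>

lemma (in abelian_monoid) finsum_swap:
  assumes "finite A" "finite B" "\<And>a b. a \<in> A \<Longrightarrow> b \<in> B \<Longrightarrow> f a b \<in> carrier G"
  shows "(\<Oplus>a\<in>A. \<Oplus>b\<in>B. f a b) = (\<Oplus>b\<in>B. \<Oplus>a\<in>A. f a b)"
  using assms(1,3)
proof (induction A rule: finite_induct)
  case empty
  then show ?case by simp
next
  case (insert a A)
  have "(\<Oplus>b\<in>B. \<Oplus>a\<in>insert a A. f a b) = (\<Oplus>b\<in>B. f a b \<oplus> (\<Oplus>a\<in>A. f a b))"
    using insert by (intro finsum_cong') (auto intro!: finsum_insert)
  also have "\<dots> = (\<Oplus>b\<in>B. f a b) \<oplus> (\<Oplus>b\<in>B. \<Oplus>a\<in>A. f a b)"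
    using insert by (intro finsum_addf) auto
  also have "\<dots> = (\<Oplus>a\<in>insert a A. \<Oplus>b\<in>B. f a b)"
    using insert by (subst finsum_insert) auto
  finally show ?case ..
qed

locale group_algebra = G: comm_group G + K: field K
  for G :: "('g, 'a) monoid_scheme" and K :: "('k, 'b) ring_scheme" +
  assumes fin: "finite (carrier G)"
begin

abbreviation "kG \<equiv> group_ring G K"

lemma group_ring_simps:
  "carrier kG = carrier G \<rightarrow>\<^sub>E carrier K"
  "\<zero>\<^bsub>kG\<^esub> = (\<lambda>g\<in>carrier G. \<zero>\<^bsub>K\<^esub>)"
  "\<one>\<^bsub>kG\<^esub> = (\<lambda>g\<in>carrier G. if g = \<one>\<^bsub>G\<^esub> then \<one>\<^bsub>K\<^esub> else \<zero>\<^bsub>K\<^esub>)"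
  "a \<oplus>\<^bsub>kG\<^esub> b = (\<lambda>g\<in>carrier G. a g \<oplus>\<^bsub>K\<^esub> b g)"
  "a \<otimes>\<^bsub>kG\<^esub> b = (\<lambda>g\<in>carrier G. \<Oplus>\<^bsub>K\<^esub>h\<in>carrier G. a h \<otimes>\<^bsub>K\<^esub> b (inv\<^bsub>G\<^esub> h \<otimes>\<^bsub>G\<^esub> g))"
  by (simp_all add: group_ring_def)

lemma group_ring_eqI:
  "a \<in> carrier kG \<Longrightarrow> b \<in> carrier kG \<Longrightarrow> (\<And>g. g \<in> carrier G \<Longrightarrow> a g = b g) \<Longrightarrow> a = b"
  unfolding group_ring_simps by (rule PiE_ext)

lemma group_ring_closed:
  "a \<in> carrier kG \<Longrightarrow> g \<in> carrier G \<Longrightarrow> a g \<in> carrier K"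
  "a \<in> carrier kG \<Longrightarrow> b \<in> carrier kG \<Longrightarrow> a \<oplus>\<^bsub>kG\<^esub> b \<in> carrier kG"
  "a \<in> carrier kG \<Longrightarrow> b \<in> carrier kG \<Longrightarrow> a \<otimes>\<^bsub>kG\<^esub> b \<in> carrier kG"
  "\<zero>\<^bsub>kG\<^esub> \<in> carrier kG" "\<one>\<^bsub>kG\<^esub> \<in> carrier kG"
  by (auto simp: group_ring_simps PiE_iff Pi_iff intro!: K.finsum_closed)

lemma group_ring_apply:
  assumes "g \<in> carrier G"
  shows "(a \<oplus>\<^bsub>kG\<^esub> b) g = a g \<oplus>\<^bsub>K\<^esub> b g" "\<zero>\<^bsub>kG\<^esub> g = \<zero>\<^bsub>K\<^esub>"
    "\<one>\<^bsub>kG\<^esub> g = (if g = \<one>\<^bsub>G\<^esub> then \<one>\<^bsub>K\<^esub> else \<zero>\<^bsub>K\<^esub>)"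
    "(a \<otimes>\<^bsub>kG\<^esub> b) g = (\<Oplus>\<^bsub>K\<^esub>h\<in>carrier G. a h \<otimes>\<^bsub>K\<^esub> b (inv\<^bsub>G\<^esub> h \<otimes>\<^bsub>G\<^esub> g))"
  using assms by (simp_all add: group_ring_simps)

lemma conv_single:
  assumes a: "a \<in> carrier kG" and g: "g \<in> carrier G" and l: "l \<in> carrier G" and c: "c \<in> carrier K"
    and s: "\<And>h. h \<in> carrier G \<Longrightarrow> s h = (if h = l then c else \<zero>\<^bsub>K\<^esub>)"
  shows "(s \<otimes>\<^bsub>kG\<^esub> a) g = c \<otimes>\<^bsub>K\<^esub> a (inv\<^bsub>G\<^esub> l \<otimes>\<^bsub>G\<^esub> g)"
proof -
  let ?f = "\<lambda>h. c \<otimes>\<^bsub>K\<^esub> a (inv\<^bsub>G\<^esub> h \<otimes>\<^bsub>G\<^esub> g)"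
  have f: "?f \<in> carrier G \<rightarrow> carrier K" using a g c by (auto simp: group_ring_closed)
  have "(s \<otimes>\<^bsub>kG\<^esub> a) g = (\<Oplus>\<^bsub>K\<^esub>h\<in>carrier G. if l = h then ?f h else \<zero>\<^bsub>K\<^esub>)"
    unfolding group_ring_apply[OF g]
    by (rule K.finsum_cong') (use a g c in \<open>auto simp: s group_ring_closed\<close>)
  also have "\<dots> = ?f l" by (rule K.add.finprod_singleton[OF l fin, unfolded finsum_def[symmetric]]) (use f in simp)
  finally show ?thesis .
qed

lemma conv_assoc:
  assumes a: "a \<in> carrier kG" and b: "b \<in> carrier kG" and c: "c \<in> carrier kG"
  shows "(a \<otimes>\<^bsub>kG\<^esub> b) \<otimes>\<^bsub>kG\<^esub> c = a \<otimes>\<^bsub>kG\<^esub> (b \<otimes>\<^bsub>kG\<^esub> c)"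
proof (rule group_ring_eqI)
  fix g assume g: "g \<in> carrier G"
  note cl = group_ring_closed(1)[OF a] group_ring_closed(1)[OF b] group_ring_closed(1)[OF c]
  let ?t = "\<lambda>l h. (a l \<otimes>\<^bsub>K\<^esub> b (inv\<^bsub>G\<^esub> l \<otimes>\<^bsub>G\<^esub> h)) \<otimes>\<^bsub>K\<^esub> c (inv\<^bsub>G\<^esub> h \<otimes>\<^bsub>G\<^esub> g)"
  have "((a \<otimes>\<^bsub>kG\<^esub> b) \<otimes>\<^bsub>kG\<^esub> c) g = (\<Oplus>\<^bsub>K\<^esub>h\<in>carrier G. \<Oplus>\<^bsub>K\<^esub>l\<in>carrier G. ?t l h)"
    unfolding group_ring_apply(4)[OF g]
    by (rule K.finsum_cong') (use g in \<open>auto simp: group_ring_apply cl K.finsum_ldistr[OF fin] intro!: K.finsum_closed\<close>)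
  also have "\<dots> = (\<Oplus>\<^bsub>K\<^esub>l\<in>carrier G. \<Oplus>\<^bsub>K\<^esub>h\<in>carrier G. ?t l h)"
    by (rule K.finsum_swap[OF fin fin]) (use g in \<open>auto simp: cl\<close>)
  also have "\<dots> = (\<Oplus>\<^bsub>K\<^esub>l\<in>carrier G. a l \<otimes>\<^bsub>K\<^esub> (b \<otimes>\<^bsub>kG\<^esub> c) (inv\<^bsub>G\<^esub> l \<otimes>\<^bsub>G\<^esub> g))"
  proof (rule K.finsum_cong')
    fix l assume l: "l \<in> carrier G"
    have bij: "(\<lambda>h. l \<otimes>\<^bsub>G\<^esub> h) ` carrier G = carrier G" "inj_on (\<lambda>h. l \<otimes>\<^bsub>G\<^esub> h) (carrier G)"
      using l by (auto simp: G.surj_const_mult G.inj_on_cmult)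
    have "(\<Oplus>\<^bsub>K\<^esub>h\<in>carrier G. ?t l h) = (\<Oplus>\<^bsub>K\<^esub>h\<in>(\<lambda>h. l \<otimes>\<^bsub>G\<^esub> h) ` carrier G. ?t l h)" by (simp add: bij)
    also have "\<dots> = (\<Oplus>\<^bsub>K\<^esub>h\<in>carrier G. ?t l (l \<otimes>\<^bsub>G\<^esub> h))"
      by (rule K.finsum_reindex[OF _ bij(2)]) (use l g in \<open>auto simp: cl bij\<close>)
    also have "\<dots> = (\<Oplus>\<^bsub>K\<^esub>h\<in>carrier G. a l \<otimes>\<^bsub>K\<^esub> (b h \<otimes>\<^bsub>K\<^esub> c (inv\<^bsub>G\<^esub> h \<otimes>\<^bsub>G\<^esub> (inv\<^bsub>G\<^esub> l \<otimes>\<^bsub>G\<^esub> g))))"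
    proof (rule K.finsum_cong')
      fix h assume h: "h \<in> carrier G"
      have "inv\<^bsub>G\<^esub> l \<otimes>\<^bsub>G\<^esub> (l \<otimes>\<^bsub>G\<^esub> h) = h" using l h by (simp add: G.m_assoc[symmetric])
      moreover have "inv\<^bsub>G\<^esub> (l \<otimes>\<^bsub>G\<^esub> h) \<otimes>\<^bsub>G\<^esub> g = inv\<^bsub>G\<^esub> h \<otimes>\<^bsub>G\<^esub> (inv\<^bsub>G\<^esub> l \<otimes>\<^bsub>G\<^esub> g)"
        using l h g by (simp add: G.inv_mult_group G.m_assoc)
      ultimately show "?t l (l \<otimes>\<^bsub>G\<^esub> h) = a l \<otimes>\<^bsub>K\<^esub> (b h \<otimes>\<^bsub>K\<^esub> c (inv\<^bsub>G\<^esub> h \<otimes>\<^bsub>G\<^esub> (inv\<^bsub>G\<^esub> l \<otimes>\<^bsub>G\<^esub> g)))"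
        using l h g by (simp add: cl K.m_assoc)
    qed (use l g in \<open>auto simp: cl\<close>)
    also have "\<dots> = a l \<otimes>\<^bsub>K\<^esub> (b \<otimes>\<^bsub>kG\<^esub> c) (inv\<^bsub>G\<^esub> l \<otimes>\<^bsub>G\<^esub> g)"
      using l g by (simp add: group_ring_apply(4) K.finsum_rdistr[OF fin] Pi_iff cl)
    finally show "(\<Oplus>\<^bsub>K\<^esub>h\<in>carrier G. ?t l h) = a l \<otimes>\<^bsub>K\<^esub> (b \<otimes>\<^bsub>kG\<^esub> c) (inv\<^bsub>G\<^esub> l \<otimes>\<^bsub>G\<^esub> g)" .
  qed (use g in \<open>auto simp: cl group_ring_closed(1)[OF group_ring_closed(3)[OF b c]]\<close>)
  also have "\<dots> = (a \<otimes>\<^bsub>kG\<^esub> (b \<otimes>\<^bsub>kG\<^esub> c)) g" by (simp only: group_ring_apply(4)[OF g])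
  finally show "((a \<otimes>\<^bsub>kG\<^esub> b) \<otimes>\<^bsub>kG\<^esub> c) g = (a \<otimes>\<^bsub>kG\<^esub> (b \<otimes>\<^bsub>kG\<^esub> c)) g" .
qed (simp_all add: group_ring_closed a b c)

lemma conv_comm:
  assumes a: "a \<in> carrier kG" and b: "b \<in> carrier kG"
  shows "a \<otimes>\<^bsub>kG\<^esub> b = b \<otimes>\<^bsub>kG\<^esub> a"
proof (rule group_ring_eqI)
  fix g assume g: "g \<in> carrier G"
  note cl = group_ring_closed(1)[OF a] group_ring_closed(1)[OF b]
  let ?r = "\<lambda>h. inv\<^bsub>G\<^esub> h \<otimes>\<^bsub>G\<^esub> g"
  have rr: "?r (?r h) = h" if "h \<in> carrier G" for h
    using that g by (simp add: G.inv_mult_group G.m_assoc G.m_comm[of h g] G.m_assoc[symmetric])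
  have bij: "?r ` carrier G = carrier G" "inj_on ?r (carrier G)"
  proof -
    show "inj_on ?r (carrier G)" by (rule inj_on_inverseI[of _ ?r]) (rule rr)
    show "?r ` carrier G = carrier G"
    proof
      show "carrier G \<subseteq> ?r ` carrier G"
      proof
        fix h assume h: "h \<in> carrier G"
        show "h \<in> ?r ` carrier G" by (rule image_eqI[of _ _ "?r h"]) (use rr[OF h] h g in simp_all)
      qed
    qed (use g in auto)
  qed
  have "(a \<otimes>\<^bsub>kG\<^esub> b) g = (\<Oplus>\<^bsub>K\<^esub>h\<in>?r ` carrier G. a h \<otimes>\<^bsub>K\<^esub> b (?r h))"
    by (simp add: group_ring_apply(4)[OF g] bij)
  also have "\<dots> = (\<Oplus>\<^bsub>K\<^esub>h\<in>carrier G. a (?r h) \<otimes>\<^bsub>K\<^esub> b (?r (?r h)))"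
    by (rule K.finsum_reindex[OF _ bij(2)]) (use g in \<open>auto simp: cl bij\<close>)
  also have "\<dots> = (\<Oplus>\<^bsub>K\<^esub>h\<in>carrier G. b h \<otimes>\<^bsub>K\<^esub> a (?r h))"
    by (rule K.finsum_cong') (use g in \<open>auto simp: cl rr K.m_comm\<close>)
  finally show "(a \<otimes>\<^bsub>kG\<^esub> b) g = (b \<otimes>\<^bsub>kG\<^esub> a) g" by (simp add: group_ring_apply(4)[OF g])
qed (simp_all add: group_ring_closed a b)

lemma cring_group_ring: "cring kG"
proof (rule cringI)
  show "abelian_group kG"
  proof (rule abelian_groupI)
    fix a assume a: "a \<in> carrier kG"
    show "\<exists>b\<in>carrier kG. b \<oplus>\<^bsub>kG\<^esub> a = \<zero>\<^bsub>kG\<^esub>"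
      by (rule bexI[of _ "\<lambda>g\<in>carrier G. \<ominus>\<^bsub>K\<^esub> a g"])
        (use a in \<open>auto simp: group_ring_simps PiE_iff K.l_neg\<close>)
  qed (auto intro!: group_ring_eqI simp: group_ring_closed group_ring_apply K.a_ac)
  show "comm_monoid kG"
  proof (rule comm_monoidI)
    show "\<one>\<^bsub>kG\<^esub> \<otimes>\<^bsub>kG\<^esub> a = a" if a: "a \<in> carrier kG" for a
      by (rule group_ring_eqI)
        (use a conv_single[OF a _ G.one_closed K.one_closed, of _ "\<one>\<^bsub>kG\<^esub>"] in
          \<open>simp_all add: group_ring_closed group_ring_apply(3)\<close>)
    show "a \<otimes>\<^bsub>kG\<^esub> b \<otimes>\<^bsub>kG\<^esub> c = a \<otimes>\<^bsub>kG\<^esub> (b \<otimes>\<^bsub>kG\<^esub> c)"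
      if "a \<in> carrier kG" "b \<in> carrier kG" "c \<in> carrier kG" for a b c by (rule conv_assoc[OF that])
    show "a \<otimes>\<^bsub>kG\<^esub> b = b \<otimes>\<^bsub>kG\<^esub> a" if "a \<in> carrier kG" "b \<in> carrier kG" for a b
      by (rule conv_comm[OF that])
  qed (simp_all add: group_ring_closed)
  fix a b c assume a: "a \<in> carrier kG" and b: "b \<in> carrier kG" and c: "c \<in> carrier kG"
  note cl = group_ring_closed(1)[OF a] group_ring_closed(1)[OF b] group_ring_closed(1)[OF c]
  show "(a \<oplus>\<^bsub>kG\<^esub> b) \<otimes>\<^bsub>kG\<^esub> c = a \<otimes>\<^bsub>kG\<^esub> c \<oplus>\<^bsub>kG\<^esub> b \<otimes>\<^bsub>kG\<^esub> c"
  proof (rule group_ring_eqI)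
    fix g assume g: "g \<in> carrier G"
    have "((a \<oplus>\<^bsub>kG\<^esub> b) \<otimes>\<^bsub>kG\<^esub> c) g =
      (\<Oplus>\<^bsub>K\<^esub>h\<in>carrier G. a h \<otimes>\<^bsub>K\<^esub> c (inv\<^bsub>G\<^esub> h \<otimes>\<^bsub>G\<^esub> g) \<oplus>\<^bsub>K\<^esub> b h \<otimes>\<^bsub>K\<^esub> c (inv\<^bsub>G\<^esub> h \<otimes>\<^bsub>G\<^esub> g))"
      unfolding group_ring_apply(4)[OF g]
      by (rule K.finsum_cong') (use g in \<open>auto simp: group_ring_apply(1) cl K.l_distr\<close>)
    also have "\<dots> = (a \<otimes>\<^bsub>kG\<^esub> c \<oplus>\<^bsub>kG\<^esub> b \<otimes>\<^bsub>kG\<^esub> c) g"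
      unfolding group_ring_apply(1,4)[OF g] by (rule K.finsum_addf) (use g in \<open>auto simp: cl\<close>)
    finally show "((a \<oplus>\<^bsub>kG\<^esub> b) \<otimes>\<^bsub>kG\<^esub> c) g = (a \<otimes>\<^bsub>kG\<^esub> c \<oplus>\<^bsub>kG\<^esub> b \<otimes>\<^bsub>kG\<^esub> c) g" .
  qed (simp_all add: group_ring_closed a b c)
qed

definition single :: "'g \<Rightarrow> 'k \<Rightarrow> 'g \<Rightarrow> 'k" where
  "single l c = (\<lambda>g\<in>carrier G. if g = l then c else \<zero>\<^bsub>K\<^esub>)"

lemma single_closed: "c \<in> carrier K \<Longrightarrow> single l c \<in> carrier kG"
  by (auto simp: single_def group_ring_simps)

lemma single_apply: "g \<in> carrier G \<Longrightarrow> single l c g = (if g = l then c else \<zero>\<^bsub>K\<^esub>)"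
  by (simp add: single_def)

lemma single_mult:
  assumes "a \<in> carrier kG" "g \<in> carrier G" "l \<in> carrier G" "c \<in> carrier K"
  shows "(single l c \<otimes>\<^bsub>kG\<^esub> a) g = c \<otimes>\<^bsub>K\<^esub> a (inv\<^bsub>G\<^esub> l \<otimes>\<^bsub>G\<^esub> g)"
  by (rule conv_single[OF assms]) (simp add: single_apply)

lemma single_single:
  assumes l: "l \<in> carrier G" and l': "l' \<in> carrier G" and c: "c \<in> carrier K" "c' \<in> carrier K"
  shows "single l c \<otimes>\<^bsub>kG\<^esub> single l' c' = single (l \<otimes>\<^bsub>G\<^esub> l') (c \<otimes>\<^bsub>K\<^esub> c')"
proof (rule group_ring_eqI)
  fix g assume g: "g \<in> carrier G"
  have "inv\<^bsub>G\<^esub> l \<otimes>\<^bsub>G\<^esub> g = l' \<longleftrightarrow> g = l \<otimes>\<^bsub>G\<^esub> l'"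
    using G.inv_solve_left'[OF l' l g] by auto
  then show "(single l c \<otimes>\<^bsub>kG\<^esub> single l' c') g = single (l \<otimes>\<^bsub>G\<^esub> l') (c \<otimes>\<^bsub>K\<^esub> c') g"
    using g l c by (simp add: single_mult single_closed single_apply)
qed (use c in \<open>simp_all add: group_ring_closed single_closed\<close>)

lemma one_eq_single: "\<one>\<^bsub>kG\<^esub> = single \<one>\<^bsub>G\<^esub> \<one>\<^bsub>K\<^esub>"
  by (simp add: single_def group_ring_simps)

lemma scalar_mult:
  assumes "a \<in> carrier kG" "g \<in> carrier G" "c \<in> carrier K"
  shows "(single \<one>\<^bsub>G\<^esub> c \<otimes>\<^bsub>kG\<^esub> a) g = c \<otimes>\<^bsub>K\<^esub> a g"
  using single_mult[OF assms(1,2) G.one_closed assms(3)] assms(2) by simp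

lemma scalar_ring_hom: "ring_hom_ring K kG (single \<one>\<^bsub>G\<^esub>)"
proof (rule ring_hom_ringI)
  show "ring K" by (rule K.ring_axioms)
  show "ring kG" using cring_group_ring by (rule cring.axioms)
qed (auto simp: single_closed single_single one_eq_single single_apply group_ring_apply group_ring_closed
    intro!: group_ring_eqI)

lemma scalars_subfield: "subfield (single \<one>\<^bsub>G\<^esub> ` carrier K) kG"
proof (rule ring_hom_ring.img_is_subfield(2)[OF scalar_ring_hom K.carrier_is_subfield])
  have "\<one>\<^bsub>kG\<^esub> \<one>\<^bsub>G\<^esub> \<noteq> \<zero>\<^bsub>kG\<^esub> \<one>\<^bsub>G\<^esub>" by (simp add: group_ring_apply)
  then show "\<one>\<^bsub>kG\<^esub> \<noteq> \<zero>\<^bsub>kG\<^esub>" by metis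
qed

lemma group_ring_span:
  assumes add: "\<And>a b. a \<in> S \<Longrightarrow> b \<in> S \<Longrightarrow> a \<oplus>\<^bsub>kG\<^esub> b \<in> S"
    and single: "\<And>l c. l \<in> carrier G \<Longrightarrow> c \<in> carrier K \<Longrightarrow> single l c \<in> S"
    and a: "a \<in> carrier kG"
  shows "a \<in> S"
proof -
  have zero: "\<zero>\<^bsub>kG\<^esub> \<in> S"
    using single[OF G.one_closed K.zero_closed] by (simp add: single_def group_ring_simps cong: if_cong)
  have "\<forall>b\<in>carrier kG. (\<forall>g\<in>carrier G - A. b g = \<zero>\<^bsub>K\<^esub>) \<longrightarrow> b \<in> S" if "finite A" "A \<subseteq> carrier G" for A
    using that
  proof (induction A rule: finite_induct)
    case empty
    show ?case
    proof (intro ballI impI)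
      fix b assume "b \<in> carrier kG" "\<forall>g\<in>carrier G - {}. b g = \<zero>\<^bsub>K\<^esub>"
      then have "b = \<zero>\<^bsub>kG\<^esub>" by (intro group_ring_eqI) (simp_all add: group_ring_closed group_ring_apply)
      then show "b \<in> S" using zero by simp
    qed
  next
    case (insert l A)
    show ?case
    proof (intro ballI impI)
      fix b assume b: "b \<in> carrier kG" and z: "\<forall>g\<in>carrier G - insert l A. b g = \<zero>\<^bsub>K\<^esub>"
      have l: "l \<in> carrier G" and A: "A \<subseteq> carrier G" using insert.prems by auto
      define b' where "b' = (\<lambda>g\<in>carrier G. if g = l then \<zero>\<^bsub>K\<^esub> else b g)"
      have b': "b' \<in> carrier kG" using b by (auto simp: b'_def group_ring_simps PiE_iff)
      have "b' \<in> S" using insert.IH[OF A] b' z by (auto simp: b'_def)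
      moreover have "single l (b l) \<in> S" by (rule single[OF l]) (simp add: group_ring_closed b l)
      moreover have "b = b' \<oplus>\<^bsub>kG\<^esub> single l (b l)"
        by (rule group_ring_eqI)
          (use b b' l in \<open>auto simp: group_ring_closed single_closed group_ring_apply b'_def single_apply\<close>)
      ultimately show "b \<in> S" using add by metis
    qed
  qed
  from this[OF fin] a show ?thesis by auto
qed

end

section \<open>The group algebra of a product of two cyclic groups of order three\<close>

text \<open>The mixed terms of the binomial expansion have coefficient 3.\<close>

lemma cube_minus_one:
  fixes R (structure)
  assumes "cring R" and s: "s \<in> carrier R" and cube: "s \<otimes> (s \<otimes> s) = \<one>"
    and three: "\<And>a. a \<in> carrier R \<Longrightarrow> a \<oplus> (a \<oplus> a) = \<zero>"
  shows "(s \<ominus> \<one>) [^] (3::nat) = \<zero>"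
proof -
  interpret cring R by fact
  have "(s \<ominus> \<one>) [^] (3::nat) = (s \<ominus> \<one>) \<otimes> ((s \<ominus> \<one>) \<otimes> (s \<ominus> \<one>))"
    using s by (simp add: numeral_3_eq_3 m_assoc)
  also have "\<dots> = (s \<otimes> (s \<otimes> s) \<ominus> \<one>) \<oplus> ((s \<oplus> (s \<oplus> s)) \<ominus> (s \<otimes> s \<oplus> (s \<otimes> s \<oplus> s \<otimes> s)))"
    using s by algebra
  also have "\<dots> = \<zero>" using s by (simp add: cube three minus_eq r_neg)
  finally show ?thesis .
qed

locale c3c3_algebra = group_algebra "integer_mod_group 3 \<times>\<times> integer_mod_group 3" K
  for K :: "('k, 'b) ring_scheme" +
  assumes char: "ring_char K = 3"
begin

abbreviation "G \<equiv> integer_mod_group 3 \<times>\<times> integer_mod_group 3"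

interpretation kG: cring kG by (rule cring_group_ring)

lemma carrier_G: "carrier G = {0, 1, 2} \<times> {0, 1, 2}"
proof -
  have "{0..<3::int} = {0, 1, 2}" by auto
  then show ?thesis by (simp add: carrier_integer_mod_group)
qed

lemma inv_G: "(i, j) \<in> carrier G \<Longrightarrow> inv\<^bsub>G\<^esub> (i, j) = ((- i) mod 3, (- j) mod 3)"
  using inv_DirProd[OF group_integer_mod_group group_integer_mod_group, of i 3 j 3]
  by (simp add: inv_integer_mod_group)

text \<open>The generators \<open>s\<close>, \<open>t\<close> of the group, and the elements that play the parts of \<open>x\<close>, \<open>y\<close> and the form of
  \<open>truncated_algebra\<close>.\<close>

definition "s = single (1, 0) \<one>\<^bsub>K\<^esub>"
definition "t = single (0, 1) \<one>\<^bsub>K\<^esub>"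
definition "ux = s \<ominus>\<^bsub>kG\<^esub> \<one>\<^bsub>kG\<^esub>"
definition "uy = t \<ominus>\<^bsub>kG\<^esub> \<one>\<^bsub>kG\<^esub>"
definition "scalar = single \<one>\<^bsub>G\<^esub>"
definition "top_form a = scalar (a (2, 2))"

lemma s_closed: "s \<in> carrier kG" and t_closed: "t \<in> carrier kG"
  by (simp_all add: s_def t_def single_closed)

lemma ux_closed: "ux \<in> carrier kG" and uy_closed: "uy \<in> carrier kG"
  by (simp_all add: ux_def uy_def s_closed t_closed)

lemma minus_apply:
  assumes a: "a \<in> carrier kG" and b: "b \<in> carrier kG" and g: "g \<in> carrier G"
  shows "(a \<ominus>\<^bsub>kG\<^esub> b) g = a g \<ominus>\<^bsub>K\<^esub> b g"
proof -
  have "((a \<ominus>\<^bsub>kG\<^esub> b) \<oplus>\<^bsub>kG\<^esub> b) g = a g" using a b by (simp add: kG.minus_eq kG.a_assoc kG.l_neg)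
  then have "(a \<ominus>\<^bsub>kG\<^esub> b) g \<oplus>\<^bsub>K\<^esub> b g = a g" using g by (simp add: group_ring_apply)
  moreover have "(a \<ominus>\<^bsub>kG\<^esub> b) g \<in> carrier K" "b g \<in> carrier K" using a b g by (simp_all add: group_ring_closed)
  ultimately show ?thesis by (metis K.minus_eq K.a_assoc K.r_neg K.r_zero K.a_inv_closed)
qed

lemma shift_apply:
  assumes a: "a \<in> carrier kG" and ij: "(i, j) \<in> carrier G"
  shows "(s \<otimes>\<^bsub>kG\<^esub> a) (i, j) = a ((i + 2) mod 3, j)" "(t \<otimes>\<^bsub>kG\<^esub> a) (i, j) = a (i, (j + 2) mod 3)"
proof -
  have c: "(1, 0) \<in> carrier G" "(0, 1) \<in> carrier G" by (simp_all add: carrier_G)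
  have j: "j mod 3 = j" "i mod 3 = i" using ij by (auto simp: carrier_integer_mod_group)
  have ac: "a ((i + 2) mod 3, j) \<in> carrier K" "a (i, (j + 2) mod 3) \<in> carrier K"
    using ij by (auto intro!: group_ring_closed(1)[OF a] simp: carrier_integer_mod_group)
  show "(s \<otimes>\<^bsub>kG\<^esub> a) (i, j) = a ((i + 2) mod 3, j)" "(t \<otimes>\<^bsub>kG\<^esub> a) (i, j) = a (i, (j + 2) mod 3)"
    unfolding s_def t_def single_mult[OF a ij c(1) K.one_closed] single_mult[OF a ij c(2) K.one_closed]
    using ac by (simp_all add: inv_G c j add.commute)
qed

lemma u_apply:
  assumes a: "a \<in> carrier kG" and ij: "(i, j) \<in> carrier G"
  shows "(ux \<otimes>\<^bsub>kG\<^esub> a) (i, j) = a ((i + 2) mod 3, j) \<ominus>\<^bsub>K\<^esub> a (i, j)"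
    "(uy \<otimes>\<^bsub>kG\<^esub> a) (i, j) = a (i, (j + 2) mod 3) \<ominus>\<^bsub>K\<^esub> a (i, j)"
proof -
  have "ux \<otimes>\<^bsub>kG\<^esub> a = s \<otimes>\<^bsub>kG\<^esub> a \<ominus>\<^bsub>kG\<^esub> a" "uy \<otimes>\<^bsub>kG\<^esub> a = t \<otimes>\<^bsub>kG\<^esub> a \<ominus>\<^bsub>kG\<^esub> a"
    unfolding ux_def uy_def using a s_closed t_closed by (simp_all add: kG.minus_eq kG.l_distr kG.l_minus)
  then show "(ux \<otimes>\<^bsub>kG\<^esub> a) (i, j) = a ((i + 2) mod 3, j) \<ominus>\<^bsub>K\<^esub> a (i, j)"
    "(uy \<otimes>\<^bsub>kG\<^esub> a) (i, j) = a (i, (j + 2) mod 3) \<ominus>\<^bsub>K\<^esub> a (i, j)"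
    using shift_apply[OF a ij] a ij s_closed t_closed by (simp_all add: minus_apply)
qed

lemma three_eq_zero: "c \<in> carrier K \<Longrightarrow> c \<oplus>\<^bsub>K\<^esub> (c \<oplus>\<^bsub>K\<^esub> c) = \<zero>\<^bsub>K\<^esub>"
proof -
  assume c: "c \<in> carrier K"
  have "[(3::nat)] \<cdot>\<^bsub>K\<^esub> \<one>\<^bsub>K\<^esub> = \<zero>\<^bsub>K\<^esub>"
    using K.add.pow_ord_eq_1[of "\<one>\<^bsub>K\<^esub>"] char by (simp add: ring_char_def add_pow_def)
  then have "\<one>\<^bsub>K\<^esub> \<oplus>\<^bsub>K\<^esub> (\<one>\<^bsub>K\<^esub> \<oplus>\<^bsub>K\<^esub> \<one>\<^bsub>K\<^esub>) = \<zero>\<^bsub>K\<^esub>"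
    by (simp add: numeral_3_eq_3 add_pow_def K.a_assoc)
  from arg_cong[OF this, of "\<lambda>d. d \<otimes>\<^bsub>K\<^esub> c"] c show ?thesis by (simp add: K.l_distr)
qed

lemma u_cube: "ux [^]\<^bsub>kG\<^esub> (3::nat) = \<zero>\<^bsub>kG\<^esub>" "uy [^]\<^bsub>kG\<^esub> (3::nat) = \<zero>\<^bsub>kG\<^esub>"
proof -
  have three: "a \<oplus>\<^bsub>kG\<^esub> (a \<oplus>\<^bsub>kG\<^esub> a) = \<zero>\<^bsub>kG\<^esub>" if "a \<in> carrier kG" for a
    by (rule group_ring_eqI) (use that in \<open>simp_all add: group_ring_closed group_ring_apply three_eq_zero\<close>)
  have "s \<otimes>\<^bsub>kG\<^esub> (s \<otimes>\<^bsub>kG\<^esub> s) = \<one>\<^bsub>kG\<^esub>" "t \<otimes>\<^bsub>kG\<^esub> (t \<otimes>\<^bsub>kG\<^esub> t) = \<one>\<^bsub>kG\<^esub>"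
    by (simp_all add: s_def t_def single_single carrier_G one_eq_single del: carrier_DirProd)
  then show "ux [^]\<^bsub>kG\<^esub> (3::nat) = \<zero>\<^bsub>kG\<^esub>" "uy [^]\<^bsub>kG\<^esub> (3::nat) = \<zero>\<^bsub>kG\<^esub>"
    unfolding ux_def uy_def using three s_closed t_closed by (simp_all add: cube_minus_one[OF cring_group_ring])
qed

lemma scalar_closed: "c \<in> carrier K \<Longrightarrow> scalar c \<in> carrier kG"
  by (simp add: scalar_def single_closed)

lemma point_closed: "a \<in> carrier kG \<Longrightarrow> i \<in> {0, 1, 2} \<Longrightarrow> j \<in> {0, 1, 2} \<Longrightarrow> a (i, j) \<in> carrier K"
  by (rule group_ring_closed(1), assumption, subst carrier_G, blast)

interpretation scalar: ring_hom_ring K kG scalar unfolding scalar_def by (rule scalar_ring_hom)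

lemma one_apply: "i \<in> {0, 1, 2} \<Longrightarrow> j \<in> {0, 1, 2} \<Longrightarrow>
    \<one>\<^bsub>kG\<^esub> (i, j) = (if i = 0 \<and> j = 0 then \<one>\<^bsub>K\<^esub> else \<zero>\<^bsub>K\<^esub>)"
  by (subst group_ring_apply(3)) (auto simp: carrier_G simp del: carrier_DirProd)

text \<open>In \<open>(s - 1)\<^sup>i(t - 1)\<^sup>j\<close> the group element \<open>s\<^sup>2t\<^sup>2\<close> occurs only for \<open>i = j = 2\<close>, with coefficient 1. This is why the
  coefficient at \<open>(2, 2)\<close> serves as the form.\<close>

lemma top_form_monomial:
  assumes "i \<le> 2" "j \<le> 2"
  shows "top_form (ux [^]\<^bsub>kG\<^esub> (i::nat) \<otimes>\<^bsub>kG\<^esub> uy [^]\<^bsub>kG\<^esub> (j::nat)) = (if i = 2 \<and> j = 2 then \<one>\<^bsub>kG\<^esub> else \<zero>\<^bsub>kG\<^esub>)"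
proof -
  have ux1: "ux (i, j) = \<one>\<^bsub>kG\<^esub> ((i + 2) mod 3, j) \<ominus>\<^bsub>K\<^esub> \<one>\<^bsub>kG\<^esub> (i, j)"
    and uy1: "uy (i, j) = \<one>\<^bsub>kG\<^esub> (i, (j + 2) mod 3) \<ominus>\<^bsub>K\<^esub> \<one>\<^bsub>kG\<^esub> (i, j)" if "(i, j) \<in> carrier G" for i j
    using u_apply[OF kG.one_closed that] ux_closed uy_closed by simp_all
  have m: "i = 0 \<or> i = 1 \<or> i = 2" "j = 0 \<or> j = 1 \<or> j = 2" using assms by auto
  note ev = u_apply ux1 uy1
  from m show ?thesis
    by (elim disjE; simp add: top_form_def numeral_2_eq_2 kG.m_assoc ux_closed uy_closed ev carrier_G one_apply
        K.minus_eq del: carrier_DirProd)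
qed

lemma top_form_linear:
  "top_form \<in> linear_maps (scalar ` carrier K) (regular_module kG) (regular_module kG)"
proof (rule linear_mapsI)
  fix a b assume a: "a \<in> carrier (regular_module kG)"
  then have ac: "a (2, 2) \<in> carrier K" by (simp add: point_closed)
  then show "top_form a \<in> carrier (regular_module kG)" by (simp add: top_form_def scalar_closed)
  { assume "b \<in> carrier (regular_module kG)"
    then have bc: "b (2, 2) \<in> carrier K" by (simp add: point_closed)
    have "(a \<oplus>\<^bsub>kG\<^esub> b) (2, 2) = a (2, 2) \<oplus>\<^bsub>K\<^esub> b (2, 2)"
      by (rule group_ring_apply(1)) (simp add: carrier_G del: carrier_DirProd)
    then show "top_form (a \<oplus>\<^bsub>regular_module kG\<^esub> b) = top_form a \<oplus>\<^bsub>regular_module kG\<^esub> top_form b"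
      using ac bc by (simp add: top_form_def) }
  assume "b \<in> scalar ` carrier K"
  then obtain c where c: "c \<in> carrier K" "b = scalar c" by blast
  have "(scalar c \<otimes>\<^bsub>kG\<^esub> a) (2, 2) = c \<otimes>\<^bsub>K\<^esub> a (2, 2)"
    unfolding scalar_def by (rule scalar_mult) (use a c in \<open>simp_all add: carrier_G del: carrier_DirProd\<close>)
  then show "top_form (b \<odot>\<^bsub>regular_module kG\<^esub> a) = b \<odot>\<^bsub>regular_module kG\<^esub> top_form a"
    using ac c by (simp add: top_form_def)
qed

lemma ux_uy_generate:
  assumes k: "scalar ` carrier K \<subseteq> S" and S: "S \<subseteq> carrier kG"
    and add: "\<And>a b. a \<in> S \<Longrightarrow> b \<in> S \<Longrightarrow> a \<oplus>\<^bsub>kG\<^esub> b \<in> S"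
    and x: "\<And>a. a \<in> S \<Longrightarrow> ux \<otimes>\<^bsub>kG\<^esub> a \<in> S" and y: "\<And>a. a \<in> S \<Longrightarrow> uy \<otimes>\<^bsub>kG\<^esub> a \<in> S"
  shows "S = carrier kG"
proof -
  have "s \<otimes>\<^bsub>kG\<^esub> a = ux \<otimes>\<^bsub>kG\<^esub> a \<oplus>\<^bsub>kG\<^esub> a" "t \<otimes>\<^bsub>kG\<^esub> a = uy \<otimes>\<^bsub>kG\<^esub> a \<oplus>\<^bsub>kG\<^esub> a" if "a \<in> carrier kG" for a
    unfolding ux_def uy_def using that s_closed t_closed
    by (simp_all add: kG.minus_eq kG.l_distr kG.l_minus kG.a_assoc kG.l_neg)
  then have st: "s \<otimes>\<^bsub>kG\<^esub> a \<in> S" "t \<otimes>\<^bsub>kG\<^esub> a \<in> S" if "a \<in> S" for a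
    using that S add x y by (auto simp: subset_iff)
  have single: "single l c \<in> S" if l: "l \<in> carrier G" and c: "c \<in> carrier K" for l c
  proof -
    have s: "single ((i + 1) mod 3, j) c \<in> S" and t: "single (i, (j + 1) mod 3) c \<in> S"
      if "single (i, j) c \<in> S" "(i, j) \<in> carrier G" for i j
    proof -
      have m: "i mod 3 = i" "j mod 3 = j" using that(2) by (auto simp: carrier_integer_mod_group)
      have g: "(1, 0) \<in> carrier G" "(0, 1) \<in> carrier G" by (simp_all add: carrier_G del: carrier_DirProd)
      show "single ((i + 1) mod 3, j) c \<in> S" "single (i, (j + 1) mod 3) c \<in> S"
        using st[OF that(1)] unfolding s_def t_def single_single[OF g(1) that(2) K.one_closed c]
          single_single[OF g(2) that(2) K.one_closed c]
        using c m by (simp_all add: add.commute)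
    qed
    have 0: "single (0, 0) c \<in> S" using k c by (auto simp: scalar_def)
    have i: "single (i, 0) c \<in> S" if "i \<in> {0, 1, 2}" for i
      using that 0 s[of 0 0] s[of 1 0] by (auto simp: carrier_G simp del: carrier_DirProd)
    have "single (i, j) c \<in> S" if "i \<in> {0, 1, 2}" "j \<in> {0, 1, 2}" for i j
      using that(2) i[OF that(1)] t[of i 0] t[of i 1] that(1) by (auto simp: carrier_G simp del: carrier_DirProd)
    then show ?thesis using l by (auto simp: carrier_G simp del: carrier_DirProd)
  qed
  show ?thesis using group_ring_span[OF add single] S by blast
qed

lemma truncated: "truncated_algebra kG (scalar ` carrier K) ux uy top_form"
proof (intro truncated_algebra.intro truncated_algebra_axioms.intro)
  show "cring kG" by (rule cring_group_ring)
  show "subfield (scalar ` carrier K) kG" unfolding scalar_def by (rule scalars_subfield)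
  show "top_form a \<in> scalar ` carrier K" if "a \<in> carrier kG" for a
    using that by (simp add: top_form_def point_closed)
qed (rule ux_closed uy_closed u_cube top_form_linear top_form_monomial ux_uy_generate; assumption)+

section \<open>The ghost number\<close>

interpretation A: truncated_algebra kG "scalar ` carrier K" ux uy top_form by (rule truncated)

text \<open>The coefficients of \<open>s - 1\<close> add up to zero.\<close>

lemma trivial_module_ux:
  assumes T: "is_trivial G K T" and u: "u \<in> carrier T"
  shows "ux \<odot>\<^bsub>T\<^esub> u = \<zero>\<^bsub>T\<^esub>"
proof -
  have lT: "left_module kG T" using T by (simp add: is_trivial_def)
  obtain f where f: "f \<in> lmod_hom kG T (trivial_module G K)" and bij: "bij_betw f (carrier T) (carrier (trivial_module G K))"
    using T unfolding is_trivial_def lmod_iso_def by blast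
  have fc: "f v \<in> carrier K" if "v \<in> carrier T" for v
    using hom_closed[OF f that] by (simp add: trivial_module_def)
  have sum: "(\<Oplus>\<^bsub>K\<^esub>g\<in>carrier G. ux g) = \<zero>\<^bsub>K\<^esub>"
  proof -
    have 10: "(1, 0) \<in> carrier G" by (simp add: carrier_G del: carrier_DirProd)
    have one: "(\<Oplus>\<^bsub>K\<^esub>g\<in>carrier G. single l \<one>\<^bsub>K\<^esub> g) = \<one>\<^bsub>K\<^esub>" if l: "l \<in> carrier G" for l
    proof -
      have "(\<Oplus>\<^bsub>K\<^esub>g\<in>carrier G. single l \<one>\<^bsub>K\<^esub> g) = (\<Oplus>\<^bsub>K\<^esub>g\<in>carrier G. if l = g then \<one>\<^bsub>K\<^esub> else \<zero>\<^bsub>K\<^esub>)"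
        by (rule K.finsum_cong') (auto simp: single_apply)
      also have "\<dots> = \<one>\<^bsub>K\<^esub>" using K.add.finprod_singleton[OF l fin, of "\<lambda>_. \<one>\<^bsub>K\<^esub>"] by (simp add: finsum_def)
      finally show ?thesis .
    qed
    have "ux \<oplus>\<^bsub>kG\<^esub> \<one>\<^bsub>kG\<^esub> = s" unfolding ux_def using s_closed by (simp add: kG.minus_eq kG.a_assoc kG.l_neg)
    then have pt: "s g = ux g \<oplus>\<^bsub>K\<^esub> \<one>\<^bsub>kG\<^esub> g" if "g \<in> carrier G" for g using group_ring_apply(1)[OF that] by metis
    have "(\<Oplus>\<^bsub>K\<^esub>g\<in>carrier G. s g) = (\<Oplus>\<^bsub>K\<^esub>g\<in>carrier G. ux g \<oplus>\<^bsub>K\<^esub> \<one>\<^bsub>kG\<^esub> g)"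
      by (rule K.finsum_cong') (auto simp: pt group_ring_closed(1)[OF ux_closed] group_ring_closed(1)[OF kG.one_closed])
    also have "\<dots> = (\<Oplus>\<^bsub>K\<^esub>g\<in>carrier G. ux g) \<oplus>\<^bsub>K\<^esub> (\<Oplus>\<^bsub>K\<^esub>g\<in>carrier G. \<one>\<^bsub>kG\<^esub> g)"
      by (rule K.finsum_addf) (auto simp: group_ring_closed(1)[OF ux_closed] group_ring_closed(1)[OF kG.one_closed])
    finally have "\<one>\<^bsub>K\<^esub> = (\<Oplus>\<^bsub>K\<^esub>g\<in>carrier G. ux g) \<oplus>\<^bsub>K\<^esub> \<one>\<^bsub>K\<^esub>"
      unfolding s_def one_eq_single one[OF 10] one[OF G.one_closed] .
    moreover have "(\<Oplus>\<^bsub>K\<^esub>g\<in>carrier G. ux g) \<in> carrier K"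
      by (rule K.finsum_closed) (auto simp: group_ring_closed(1)[OF ux_closed])
    ultimately show ?thesis by (metis K.add.r_cancel_one' K.one_closed K.a_comm)
  qed
  have "f \<zero>\<^bsub>T\<^esub> \<oplus>\<^bsub>K\<^esub> f \<zero>\<^bsub>T\<^esub> = f \<zero>\<^bsub>T\<^esub>"
    using hom_add[OF f, of "\<zero>\<^bsub>T\<^esub>" "\<zero>\<^bsub>T\<^esub>"] by (simp add: lm_rules[OF lT] trivial_module_def)
  then have f0: "f \<zero>\<^bsub>T\<^esub> = \<zero>\<^bsub>K\<^esub>" using fc[OF lm_zero_closed[OF lT]] by simp
  have "f (ux \<odot>\<^bsub>T\<^esub> u) = (\<Oplus>\<^bsub>K\<^esub>g\<in>carrier G. ux g) \<otimes>\<^bsub>K\<^esub> f u"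
    using hom_smult[OF f ux_closed u] by (simp add: trivial_module_def del: carrier_DirProd)
  then have "f (ux \<odot>\<^bsub>T\<^esub> u) = f \<zero>\<^bsub>T\<^esub>" using fc[OF u] by (simp add: sum f0 del: carrier_DirProd)
  then show ?thesis
    using bij u lm_smult_closed[OF lT ux_closed] lm_zero_closed[OF lT] unfolding bij_betw_def by (meson inj_onD)
qed

text \<open>Multiples of \<open>soc\<close> are the elements killed by \<open>s - 1\<close> and \<open>t - 1\<close>, that is, the functions on the group
  invariant under both shifts.\<close>

lemma soc_multiple_iff_constant:
  assumes b: "b \<in> carrier kG"
  shows "(\<exists>a\<in>carrier kG. b = A.soc \<otimes>\<^bsub>kG\<^esub> a) \<longleftrightarrow> (\<forall>g\<in>carrier G. b g = b (0, 0))"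
proof
  assume "\<exists>a\<in>carrier kG. b = A.soc \<otimes>\<^bsub>kG\<^esub> a"
  then obtain a where a: "a \<in> carrier kG" "b = A.soc \<otimes>\<^bsub>kG\<^esub> a" by blast
  have ann: "ux \<otimes>\<^bsub>kG\<^esub> b = \<zero>\<^bsub>kG\<^esub>" "uy \<otimes>\<^bsub>kG\<^esub> b = \<zero>\<^bsub>kG\<^esub>"
    using A.soc_annihilated[OF A.lm_reg, of a] a by simp_all
  have eq: "b ((i + 2) mod 3, j) = b (i, j)" "b (i, (j + 2) mod 3) = b (i, j)" if ij: "(i, j) \<in> carrier G" for i j
  proof -
    have ij': "i \<in> {0, 1, 2}" "j \<in> {0, 1, 2}" using ij unfolding carrier_G by blast+
    then have "(i + 2) mod 3 \<in> {0, 1, 2}" "(j + 2) mod 3 \<in> {0, 1, 2}" by auto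
    note m = this
    have c: "b ((i + 2) mod 3, j) \<in> carrier K" "b (i, (j + 2) mod 3) \<in> carrier K" "b (i, j) \<in> carrier K"
      by (rule point_closed[OF b]; rule m ij')+
    have "b ((i + 2) mod 3, j) \<ominus>\<^bsub>K\<^esub> b (i, j) = \<zero>\<^bsub>K\<^esub>" "b (i, (j + 2) mod 3) \<ominus>\<^bsub>K\<^esub> b (i, j) = \<zero>\<^bsub>K\<^esub>"
      using u_apply[OF b ij] group_ring_apply(2)[OF ij] unfolding ann by metis+
    then show "b ((i + 2) mod 3, j) = b (i, j)" "b (i, (j + 2) mod 3) = b (i, j)"
      using K.r_right_minus_eq[OF c(1,3)] K.r_right_minus_eq[OF c(2,3)] by simp_all
  qed
  have "b (1, j) = b (0, j)" "b (2, j) = b (0, j)" if "j \<in> {0, 1, 2}" for j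
    using eq(1)[of 0 j] eq(1)[of 1 j] that by (auto simp: carrier_G simp del: carrier_DirProd)
  moreover have "b (0, 1) = b (0, 0)" "b (0, 2) = b (0, 0)"
    using eq(2)[of 0 0] eq(2)[of 0 1] by (auto simp: carrier_G simp del: carrier_DirProd)
  ultimately show "\<forall>g\<in>carrier G. b g = b (0, 0)" unfolding carrier_G by auto
next
  assume c: "\<forall>g\<in>carrier G. b g = b (0, 0)"
  have c': "b (i, j) = b (0, 0)" if "i \<in> {0, 1, 2}" "j \<in> {0, 1, 2}" for i j
    using c that unfolding carrier_G by blast
  have b0: "b (0, 0) \<in> carrier K" using point_closed[OF b] by simp
  have "ux \<otimes>\<^bsub>kG\<^esub> b = \<zero>\<^bsub>kG\<^esub>" "uy \<otimes>\<^bsub>kG\<^esub> b = \<zero>\<^bsub>kG\<^esub>"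
  proof -
    have "(ux \<otimes>\<^bsub>kG\<^esub> b) g = \<zero>\<^bsub>kG\<^esub> g \<and> (uy \<otimes>\<^bsub>kG\<^esub> b) g = \<zero>\<^bsub>kG\<^esub> g" if g: "g \<in> carrier G" for g
    proof -
      obtain i j where ij: "g = (i, j)" "i \<in> {0, 1, 2}" "j \<in> {0, 1, 2}" using g unfolding carrier_G by blast
      have "(i + 2) mod 3 \<in> {0, 1, 2}" "(j + 2) mod 3 \<in> {0, 1, 2}" using ij(2,3) by auto
      then show ?thesis
        using ij b0 u_apply[OF b, of i j] g group_ring_apply(2)[OF g]
        by (simp add: c' K.minus_eq K.r_neg del: insert_iff carrier_DirProd)
    qed
    then show "ux \<otimes>\<^bsub>kG\<^esub> b = \<zero>\<^bsub>kG\<^esub>" "uy \<otimes>\<^bsub>kG\<^esub> b = \<zero>\<^bsub>kG\<^esub>"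
      using b ux_closed uy_closed by (auto intro!: group_ring_eqI simp: group_ring_closed)
  qed
  from A.annihilated_imp_soc[OF b this] show "\<exists>a\<in>carrier kG. b = A.soc \<otimes>\<^bsub>kG\<^esub> a"
    using A.form_values[OF b] A.k_closed by blast
qed

abbreviation "free_copy j \<equiv> transport j (regular_module kG)"

lemma soc_multiples_trivial:
  fixes j :: "(int \<times> int \<Rightarrow> 'k) \<Rightarrow> 'm"
  assumes j: "inj_on j (carrier kG)"
  shows "is_trivial G K (multiples A.soc (free_copy j))"
proof -
  let ?P = "free_copy j"
  let ?T = "multiples A.soc ?P"
  have jr: "inj_on j (carrier (regular_module kG))" using j by simp
  have lP: "left_module kG ?P" by (rule transport_isomorphic(1)[OF A.lm_reg jr])
  have lT: "left_module kG ?T" by (rule A.left_module_multiples[OF lP A.soc_closed])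
  let ?i = "inv_into (carrier kG) j"
  let ?C = "{b \<in> carrier kG. \<forall>g\<in>carrier G. b g = b (0, 0)}"
  have C: "?C = (\<lambda>a. A.soc \<otimes>\<^bsub>kG\<^esub> a) ` carrier kG"
    using soc_multiple_iff_constant A.soc_closed by blast
  have carT: "carrier ?T = j ` ?C"
    unfolding C image_image by (auto simp: transport_simps j image_image)
  have ij: "?i (j b) = b" if "b \<in> carrier kG" for b using j that by (rule inv_into_f_f)
  let ?f = "\<lambda>u. ?i u (0, 0)"
  have zG: "(0, 0) \<in> carrier G" unfolding carrier_G by simp
  have "?f \<in> lmod_hom kG ?T (trivial_module G K)"
  proof (rule homI)
    fix u assume "u \<in> carrier ?T"
    then obtain b where b: "u = j b" "b \<in> carrier kG" "\<And>g. g \<in> carrier G \<Longrightarrow> b g = b (0, 0)"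
      unfolding carT by blast
    have b0: "b (0, 0) \<in> carrier K" by (rule group_ring_closed(1)[OF b(2) zG])
    then show "?f u \<in> carrier (trivial_module G K)" by (simp add: b(1) ij[OF b(2)] trivial_module_def)
    { fix v assume "v \<in> carrier ?T"
      then obtain d where d: "v = j d" "d \<in> carrier kG" unfolding carT by blast
      show "?f (u \<oplus>\<^bsub>?T\<^esub> v) = ?f u \<oplus>\<^bsub>trivial_module G K\<^esub> ?f v"
        using b(2) d(2) by (simp add: b(1) d(1) transport_simps ij trivial_module_def group_ring_apply(1)[OF zG]) }
    fix a assume a: "a \<in> carrier kG"
    have "(a \<otimes>\<^bsub>kG\<^esub> b) (0, 0) = (\<Oplus>\<^bsub>K\<^esub>h\<in>carrier G. a h \<otimes>\<^bsub>K\<^esub> b (0, 0))"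
      unfolding group_ring_apply(4)[OF zG]
    proof (rule K.finsum_cong')
      fix h assume h: "h \<in> carrier G"
      have "inv\<^bsub>G\<^esub> h \<otimes>\<^bsub>G\<^esub> (0, 0) \<in> carrier G" by (rule G.m_closed[OF G.inv_closed[OF h] zG])
      then show "a h \<otimes>\<^bsub>K\<^esub> b (inv\<^bsub>G\<^esub> h \<otimes>\<^bsub>G\<^esub> (0, 0)) = a h \<otimes>\<^bsub>K\<^esub> b (0, 0)" using b(3) by metis
    qed (use a b0 in \<open>auto simp: group_ring_closed(1)\<close>)
    also have "\<dots> = (\<Oplus>\<^bsub>K\<^esub>h\<in>carrier G. a h) \<otimes>\<^bsub>K\<^esub> b (0, 0)"
      by (rule K.finsum_ldistr[OF fin b0, symmetric]) (use a in \<open>auto simp: group_ring_closed(1)\<close>)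
    finally show "?f (a \<odot>\<^bsub>?T\<^esub> u) = a \<odot>\<^bsub>trivial_module G K\<^esub> ?f u"
      using a b(2) by (simp add: b(1) transport_simps ij trivial_module_def)
  qed
  moreover have "bij_betw ?f (carrier ?T) (carrier (trivial_module G K))"
  proof (rule bij_betwI')
    fix u v assume "u \<in> carrier ?T" "v \<in> carrier ?T"
    then obtain b d where b: "u = j b" "b \<in> carrier kG" "\<And>g. g \<in> carrier G \<Longrightarrow> b g = b (0, 0)"
      and d: "v = j d" "d \<in> carrier kG" "\<And>g. g \<in> carrier G \<Longrightarrow> d g = d (0, 0)" unfolding carT by blast
    have "b = d" if "b (0, 0) = d (0, 0)"
      by (rule group_ring_eqI[OF b(2) d(2)]) (metis b(3) d(3) that)
    moreover have "b = d" if "j b = j d" by (rule inj_onD[OF j that b(2) d(2)])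
    ultimately show "?f u = ?f v \<longleftrightarrow> u = v" unfolding b(1) d(1) ij[OF b(2)] ij[OF d(2)] by blast
  next
    fix u assume "u \<in> carrier ?T"
    then show "?f u \<in> carrier (trivial_module G K)"
      unfolding carT by (auto simp: ij trivial_module_def intro!: group_ring_closed(1)[OF _ zG])
  next
    fix c assume "c \<in> carrier (trivial_module G K)"
    then have c: "c \<in> carrier K" by (simp add: trivial_module_def)
    define b where "b = (\<lambda>g\<in>carrier G. c)"
    have b: "b \<in> carrier kG" "b \<in> ?C" using c zG by (auto simp: b_def group_ring_simps)
    then have "j b \<in> carrier ?T" unfolding carT by blast
    moreover have "?f (j b) = c" using zG by (simp only: ij[OF b(1)]) (simp only: b_def restrict_apply' )
    ultimately show "\<exists>u\<in>carrier ?T. c = ?f u" by metis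
  qed
  ultimately show ?thesis using lT unfolding is_trivial_def lmod_iso_def by blast
qed

lemma group_ring_embeds:
  assumes inf: "infinite (UNIV :: 'm set)" and le: "carrier K \<lesssim> (UNIV :: 'm set)"
  obtains j :: "(int \<times> int \<Rightarrow> 'k) \<Rightarrow> 'm" where "inj_on j (carrier kG)"
proof -
  obtain e :: "'k \<Rightarrow> 'm" where e: "inj_on e (carrier K)" using le unfolding lepoll_def by blast
  obtain d :: "(int \<times> int \<Rightarrow> 'm) \<Rightarrow> 'm" where d: "inj_on d (extensional (carrier G))"
    using infinite_tuples_injection[OF inf fin] by blast
  have "inj_on (\<lambda>a. d (restrict (e \<circ> a) (carrier G))) (carrier kG)"
  proof (rule inj_onI)
    fix a b assume a: "a \<in> carrier kG" and b: "b \<in> carrier kG"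
      and "d (restrict (e \<circ> a) (carrier G)) = d (restrict (e \<circ> b) (carrier G))"
    then have eq: "restrict (e \<circ> a) (carrier G) = restrict (e \<circ> b) (carrier G)"
      using d by (auto dest: inj_onD)
    show "a = b"
    proof (rule group_ring_eqI[OF a b])
      fix g assume g: "g \<in> carrier G"
      have "e (a g) = e (b g)" using fun_cong[OF eq, of g] g by simp
      then show "a g = b g" using e group_ring_closed(1)[OF a g] group_ring_closed(1)[OF b g] by (auto dest: inj_onD)
    qed
  qed
  then show thesis using that by blast
qed

lemma Thick_k_left_module: "M \<in> Thick_k G K \<Longrightarrow> left_module kG M"
proof -
  have "{T. is_trivial G K T} \<subseteq> {M. left_module kG M}" by (auto simp: is_trivial_def)
  then show "M \<in> Thick_k G K \<Longrightarrow> left_module kG M" unfolding Thick_k_def using thick_left_modules by blast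
qed

text \<open>The test modules are \<open>\<Omega>\<^sup>nk\<close> for \<open>n = 0, -1, -2\<close>.\<close>

lemma ghost_ghostly:
  fixes M N :: "((int \<times> int) \<Rightarrow> 'k, 'm) module" and j :: "(int \<times> int \<Rightarrow> 'k) \<Rightarrow> 'm"
  assumes inf: "infinite (UNIV :: 'm set)" and j: "inj_on j (carrier kG)"
    and M: "left_module kG M" and N: "left_module kG N" and f: "ghost G K M N f"
  shows "A.ghostly M N f"
proof -
  let ?T = "multiples A.soc (free_copy j)"
  obtain L1 L2 :: "((int \<times> int) \<Rightarrow> 'k, 'm) module" where O: "is_Omega kG L1 ?T" "is_Omega kG L2 L1"
    and test: "\<And>(M :: ((int \<times> int) \<Rightarrow> 'k, 'm) module) (N :: ((int \<times> int) \<Rightarrow> 'k, 'm) module) f.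
       \<lbrakk>left_module kG M; left_module kG N; f \<in> lmod_hom kG M N;
       \<forall>t\<in>lmod_hom kG ?T M. A.traced ?T N (f \<circ> t); \<forall>t\<in>lmod_hom kG L1 M. A.traced L1 N (f \<circ> t);
       \<forall>t\<in>lmod_hom kG L2 M. A.traced L2 N (f \<circ> t)\<rbrakk> \<Longrightarrow> A.ghostly M N f"
    by (rule A.ghostly_if_tests[OF inf A.free_on_transport[OF j]], rule that)
  have fh: "f \<in> lmod_hom kG M N" using f by (simp add: ghost_def)
  note T = soc_multiples_trivial[OF j]
  have l: "left_module kG ?T" "left_module kG L1" "left_module kG L2"
    using O unfolding is_Omega_def Omega_seq_def short_exact_def by blast+
  have tr: "A.traced L N (f \<circ> u)" if "is_Omega_int kG n ?T L" "left_module kG L" "u \<in> lmod_hom kG L M" for L n u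
  proof -
    have "stably_zero kG L N (f \<circ> u)" using f T that(1,3) unfolding ghost_def by blast
    then show ?thesis using A.stably_zero_iff_traced[OF that(2) N inf] by blast
  qed
  have "is_Omega_int kG 0 ?T ?T" by (simp add: is_Omega_int_def)
  moreover have "is_Omega_int kG (- 1) ?T L1" using O(1) by (simp add: is_Omega_int_def)
  moreover have "is_Omega_nat kG (Suc (Suc 0)) L2 ?T" using O by auto
  then have "is_Omega_int kG (- 2) ?T L2" by (simp add: is_Omega_int_def numeral_2_eq_2)
  ultimately show ?thesis using tr l test[OF M N fh] by blast
qed

text \<open>A map \<open>t\<close> from \<open>\<Omega>\<^sup>nk\<close> commutes with multiplication by \<open>ux\<close>, and this multiplication is stably zero on
  \<open>\<Omega>\<^sup>nk\<close> because it is zero on \<open>k\<close>.\<close>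

lemma ghost_ux:
  fixes M :: "((int \<times> int) \<Rightarrow> 'k, 'm) module"
  assumes inf: "infinite (UNIV :: 'm set)" and M: "left_module kG M"
  shows "ghost G K M M (\<lambda>u. ux \<odot>\<^bsub>M\<^esub> u)"
  unfolding ghost_def
proof (intro conjI allI impI ballI)
  show "(\<lambda>u. ux \<odot>\<^bsub>M\<^esub> u) \<in> lmod_hom kG M M" by (rule A.smult_hom[OF M ux_closed])
  fix n and T L :: "((int \<times> int) \<Rightarrow> 'k, 'm) module" and t
  assume T: "is_trivial G K T" and O: "is_Omega_int kG n T L" and t: "t \<in> lmod_hom kG L M"
  have lT: "left_module kG T" using T by (simp add: is_trivial_def)
  have tT: "A.traced T T (\<lambda>u. ux \<odot>\<^bsub>T\<^esub> u)"
    by (rule A.traced_cong[OF A.traced_zero[OF lT lT]]) (rule trivial_module_ux[OF T])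
  have L: "left_module kG L" "A.traced L L (\<lambda>u. ux \<odot>\<^bsub>L\<^esub> u)"
    using O lT tT is_Omega_nat_left_module[of kG _ T L] is_Omega_nat_left_module[of kG _ L T]
      A.traced_smult_Omega_nat[OF ux_closed inf, of _ T L] A.traced_smult_Omega_nat[OF ux_closed inf, of _ L T]
    unfolding is_Omega_int_def by (auto split: if_splits)
  have "A.traced L M (t \<circ> (\<lambda>u. ux \<odot>\<^bsub>L\<^esub> u))" by (rule A.traced_comp_left[OF L(1) L(1) L(2) t])
  then have "A.traced L M ((\<lambda>u. ux \<odot>\<^bsub>M\<^esub> u) \<circ> t)"
    by (rule A.traced_cong) (simp add: hom_smult[OF t ux_closed])
  then show "stably_zero kG L M ((\<lambda>u. ux \<odot>\<^bsub>M\<^esub> u) \<circ> t)" using A.stably_zero_iff_traced[OF L(1) M inf] by blast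
qed

lemma ghost_length_le_3:
  fixes M :: "((int \<times> int) \<Rightarrow> 'k, 'm) module"
  assumes inf: "infinite (UNIV :: 'm set)" and le: "carrier K \<lesssim> (UNIV :: 'm set)" and M: "M \<in> Thick_k G K"
  shows "ghost_length G K M \<le> 3"
proof -
  obtain j :: "(int \<times> int \<Rightarrow> 'k) \<Rightarrow> 'm" where j: "inj_on j (carrier kG)" using group_ring_embeds[OF inf le] by blast
  have one: "M \<in> Thick_k G K \<and> N \<in> Thick_k G K \<and> ghost G K M N f" if "ghost_composite G K 1 M N f"
    for M N :: "((int \<times> int) \<Rightarrow> 'k, 'm) module" and f
    using that by (cases rule: ghost_composite.cases) auto
  have suc: "\<exists>L f' g. ghost_composite G K n M L f' \<and> N \<in> Thick_k G K \<and> ghost G K L N g \<and> f = g \<circ> f'"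
    if "ghost_composite G K (Suc n) M N f" "n \<ge> 1"
    for M N :: "((int \<times> int) \<Rightarrow> 'k, 'm) module" and f n
    using that by (cases rule: ghost_composite.cases) auto
  have "stably_zero kG M N f" if f: "ghost_composite G K 3 M N f" for N f
  proof -
    obtain L2 f' f3 where 3: "ghost_composite G K 2 M L2 f'" "N \<in> Thick_k G K" "ghost G K L2 N f3" "f = f3 \<circ> f'"
      using suc[of 2 M N f] f by (auto simp: numeral_3_eq_3 numeral_2_eq_2)
    obtain L1 f1 f2 where 2: "ghost_composite G K 1 M L1 f1" "L2 \<in> Thick_k G K" "ghost G K L1 L2 f2" "f' = f2 \<circ> f1"
      using suc[of 1 M L2 f'] 3(1) by (auto simp: numeral_2_eq_2)
    note 1 = one[OF 2(1)]
    have l: "left_module kG M" "left_module kG L1" "left_module kG L2" "left_module kG N"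
      using 1 2(2) 3(2) Thick_k_left_module by blast+
    have "A.traced M N (f3 \<circ> (f2 \<circ> f1))"
      by (rule A.ghostly_triple_traced[OF l]) (use 1 2(3) 3(3) ghost_ghostly[OF inf j] l in blast)+
    then show ?thesis using A.stably_zero_iff_traced[OF l(1,4) inf] 2(4) 3(4) by simp
  qed
  then have "enat 3 \<in> {enat n | n. \<forall>N f. ghost_composite G K n M N f \<longrightarrow> stably_zero kG M N f}" by blast
  then have "ghost_length G K M \<le> enat 3" unfolding ghost_length_def by (rule Inf_lower)
  then show ?thesis by (simp add: numeral_eq_enat)
qed

lemma exists_ghost_length_ge_3:
  assumes inf: "infinite (UNIV :: 'm set)" and le: "carrier K \<lesssim> (UNIV :: 'm set)"
  obtains M :: "((int \<times> int) \<Rightarrow> 'k, 'm) module" where "M \<in> Thick_k G K" "ghost_length G K M \<ge> 3"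
proof -
  obtain j :: "(int \<times> int \<Rightarrow> 'k) \<Rightarrow> 'm" where j: "inj_on j (carrier kG)" using group_ring_embeds[OF inf le] by blast
  let ?P = "free_copy j" and ?B = "multiples (uy \<otimes>\<^bsub>kG\<^esub> uy) (free_copy j)"
  note P = A.free_on_transport[OF j]
  have lP: "left_module kG ?P" using P by (simp add: A.free_on_def)
  have yy: "uy \<otimes>\<^bsub>kG\<^esub> uy \<in> carrier kG" using uy_closed by simp
  have lB: "left_module kG ?B" by (rule A.left_module_multiples[OF lP yy])
  have B: "?B \<in> Thick_k G K"
    unfolding Thick_k_def using A.multiples_in_thick[OF inf P] soc_multiples_trivial[OF j] by blast
  let ?x = "\<lambda>u. ux \<odot>\<^bsub>?B\<^esub> u"
  have x: "ghost G K ?B ?B ?x" by (rule ghost_ux[OF inf lB])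
  have yB: "uy \<odot>\<^bsub>?B\<^esub> v = \<zero>\<^bsub>?B\<^esub>" if "v \<in> carrier ?B" for v
    using that A.cube_smult[OF lP] by (auto simp: lm_mult_smult[OF lP] uy_closed)
  let ?w = "(uy \<otimes>\<^bsub>kG\<^esub> uy) \<odot>\<^bsub>?P\<^esub> j \<one>\<^bsub>kG\<^esub>"
  have g: "j \<one>\<^bsub>kG\<^esub> \<in> carrier ?P" using P by (simp add: A.free_on_def)
  have w: "?w \<in> carrier ?B" using g by simp
  have xxw: "?x (?x ?w) \<noteq> \<zero>\<^bsub>?B\<^esub>"
  proof
    assume "?x (?x ?w) = \<zero>\<^bsub>?B\<^esub>"
    then have "A.soc \<odot>\<^bsub>?P\<^esub> j \<one>\<^bsub>kG\<^esub> = \<zero>\<^bsub>?P\<^esub>"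
      using g by (simp add: A.soc_smult[OF lP] lm_mult_smult[OF lP] uy_closed)
    then have "A.soc = \<zero>\<^bsub>kG\<^esub>" using P A.soc_closed unfolding A.free_on_def by blast
    moreover have "top_form A.soc = \<one>\<^bsub>kG\<^esub>" using A.form_values9 by (simp add: A.soc_def)
    moreover have "top_form \<zero>\<^bsub>kG\<^esub> = \<zero>\<^bsub>kG\<^esub>" using linear_maps_zero[OF A.form_linear A.lm_reg A.lm_reg] by simp
    ultimately show False using subfieldE(6)[OF A.k] by simp
  qed
  \<comment> \<open>All traces into \<open>y\<^sup>2R\<close> vanish, so a map that is not zero at \<open>y\<^sup>2\<close> is not stably zero.\<close>
  have not0: "\<not> stably_zero kG ?B ?B f" if "f ?w \<noteq> \<zero>\<^bsub>?B\<^esub>" for f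
    using A.traced_zero_on_multiples[OF lP lB yB _ w] A.stably_zero_iff_traced[OF lB lB inf] that by blast
  have xx0: "?x \<zero>\<^bsub>?B\<^esub> = \<zero>\<^bsub>?B\<^esub>" by (rule lm_smult_zero[OF lB ux_closed])
  have c0: "ghost_composite G K 0 ?B ?B id" by (rule ghost_composite.none[OF B B hom_id])
  have c1: "ghost_composite G K 1 ?B ?B ?x" by (rule ghost_composite.one[OF B B x])
  have c2: "ghost_composite G K (Suc 1) ?B ?B (?x \<circ> ?x)" by (rule ghost_composite.step[OF _ c1 B x]) simp
  have n: "\<not> stably_zero kG ?B ?B id" "\<not> stably_zero kG ?B ?B ?x" "\<not> stably_zero kG ?B ?B (?x \<circ> ?x)"
    using xxw xx0 by (auto intro!: not0 simp del: multiples_simps)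
  have "3 \<le> ghost_length G K ?B"
    unfolding ghost_length_def
  proof (rule Inf_greatest)
    fix e assume "e \<in> {enat n | n. \<forall>N f. ghost_composite G K n ?B N f \<longrightarrow> stably_zero kG ?B N f}"
    then obtain m where m: "e = enat m" "\<forall>N f. ghost_composite G K m ?B N f \<longrightarrow> stably_zero kG ?B N f" by blast
    have "m \<noteq> 0" using m(2)[rule_format, of ?B id] c0 n(1) by (intro notI) simp
    moreover have "m \<noteq> 1" using m(2)[rule_format, of ?B ?x] c1 n(2) by (intro notI) simp
    moreover have "m \<noteq> Suc 1" using m(2)[rule_format, of ?B "?x \<circ> ?x"] c2 n(3) by blast
    ultimately have "3 \<le> m" by simp
    then show "3 \<le> e" unfolding m(1) by (simp add: numeral_eq_enat)
  qed
  with B show thesis using that by blast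
qed

end

theorem theorem4p28:
  fixes K :: "('k, 'b) ring_scheme"
  assumes "field K" and "ring_char K = 3"
    and "infinite (UNIV :: 'm set)" and "carrier K \<lesssim> (UNIV :: 'm set)"
  shows "ghost_number TYPE('m) (integer_mod_group 3 \<times>\<times> integer_mod_group 3) K = 3"
proof -
  let ?G = "integer_mod_group 3 \<times>\<times> integer_mod_group 3"
  have "comm_group ?G"
  proof (rule group.group_comm_groupI)
    show "group ?G" by (simp add: DirProd_group)
  qed (auto simp: add.commute)
  moreover have "finite (carrier ?G)" by (simp add: carrier_integer_mod_group)
  ultimately have "group_algebra ?G K"
    using assms(1) by (simp add: group_algebra_def group_algebra_axioms_def)
  then interpret c3c3_algebra K using assms(2) by (simp add: c3c3_algebra_def c3c3_algebra_axioms_def)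
  obtain M :: "((int \<times> int) \<Rightarrow> 'k, 'm) module" where M: "M \<in> Thick_k ?G K" "ghost_length ?G K M \<ge> 3"
    using exists_ghost_length_ge_3[OF assms(3,4)] by blast
  show ?thesis
    unfolding ghost_number_def
  proof (rule antisym)
    show "(SUP M \<in> (Thick_k ?G K :: ((int \<times> int) \<Rightarrow> 'k, 'm) module set). ghost_length ?G K M) \<le> 3"
      by (rule SUP_least) (rule ghost_length_le_3[OF assms(3,4)])
    show "3 \<le> (SUP M \<in> (Thick_k ?G K :: ((int \<times> int) \<Rightarrow> 'k, 'm) module set). ghost_length ?G K M)"
      by (rule SUP_upper2, rule M(1), rule M(2))
  qed
qed

end
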